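(* Let $1<p<\infty$ and $\omega\in\widehat{\mathcal{D}}\setminus\check{\mathcal{D}}$. Then $P_\omega:L^p_\omega\to L^p_\omega$ is bounded but $P^+_\omega:L^p_\omega\to L^p_\omega$ is not.
   Context: $\mathbb{D}$ is the open unit disc of $\mathbb{C}$ and $dA(z)=\frac{dx\,dy}{\pi}$. A radial weight is a nonnegative function $\omega\in L^1([0,1))$ extended to $\mathbb{D}$ by $\omega(z)=\omega(|z|)$; it is assumed throughout that $\widehat{\omega}(z)=\int_{|z|}^1\omega(s)\,ds>0$ for all $z\in\mathbb{D}$. For radial weights: $\omega\in\widehat{\mathcal{D}}$ if there is $C\ge1$ with $\widehat{\omega}(r)\le C\widehat{\omega}\left(\frac{1+r}{2}\right)$ for all $0\le r<1$; $\omega\in\check{\mathcal{D}}$ if there are $K>1$ and $C>1$ with $\widehat{\omega}(r)\ge C\widehat{\omega}\left(1-\frac{1-r}{K}\right)$ for all $0\le r<1$. $L^p_\omega$ is the space of measurable $f$ on $\mathbb{D}$ with $\|f\|_{L^p_\omega}^p=\int_{\mathbb{D}}|f(z)|^p\omega(z)\,dA(z)<\infty$. Write $\omega_x=\int_0^1r^x\omega(r)\,dr$ for $x\ge0$ and $B^\omega_z(\zeta)=\sum_{n=0}^\infty\frac{(\overline{z}\zeta)^n}{2\omega_{2n+1}}$ (the reproducing kernel of the Hilbert space of analytic functions in $L^2_\omega$). The Bergman projection and the maximal Bergman projection are $P_\omega(f)(z)=\int_{\mathbb{D}}f(\zeta)\overline{B^\omega_z(\zeta)}\,\omega(\zeta)\,dA(\zeta)$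 and $P^+_\omega(f)(z)=\int_{\mathbb{D}}f(\zeta)|B^\omega_z(\zeta)|\,\omega(\zeta)\,dA(\zeta)$. *)

theory Defs
  imports "HOL-Analysis.Analysis"
begin

text \<open>
  A radial weight is represented by its profile on \<open>[0,1)\<close>; the weight on the unit disc is
  \<open>\<lambda>z. \<omega> (cmod z)\<close>. Values of the profile outside \<open>[0,1)\<close> are irrelevant throughout.
\<close>

definition weight_hat :: "(real \<Rightarrow> real) \<Rightarrow> real \<Rightarrow> real" where
  "weight_hat \<omega> r = (LINT s:{r..<1}|lebesgue. \<omega> s)"

definition radial_weight :: "(real \<Rightarrow> real) \<Rightarrow> bool" where
  "radial_weight \<omega> \<longleftrightarrow>
     (\<forall>r\<in>{0..<1}. 0 \<le> \<omega> r) \<and>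
     set_integrable lebesgue {0..<1} \<omega> \<and>
     (\<forall>r\<in>{0..<1}. 0 < weight_hat \<omega> r)"

definition D_hat :: "(real \<Rightarrow> real) set" where
  "D_hat = {\<omega>. radial_weight \<omega> \<and>
     (\<exists>C\<ge>1. \<forall>r\<in>{0..<1}. weight_hat \<omega> r \<le> C * weight_hat \<omega> ((1 + r) / 2))}"

definition D_check :: "(real \<Rightarrow> real) set" where
  "D_check = {\<omega>. radial_weight \<omega> \<and>
     (\<exists>K>1. \<exists>C>1. \<forall>r\<in>{0..<1}. weight_hat \<omega> r \<ge> C * weight_hat \<omega> (1 - (1 - r) / K))}"

definition disc_area :: "complex measure" where
  "disc_area = density (lebesgue_on (ball 0 1)) (\<lambda>_. ennreal (1 / pi))"

text \<open>
  For measurable \<open>f\<close> the integrand below is measurable and nonnegative on the disc, so integrability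
  says exactly that \<open>\<integral>|f|\<^sup>p \<omega> dA\<close> is finite.
\<close>

definition weighted_Lp :: "real \<Rightarrow> (real \<Rightarrow> real) \<Rightarrow> (complex \<Rightarrow> complex) set" where
  "weighted_Lp p \<omega> = {f. f \<in> borel_measurable disc_area \<and>
     integrable disc_area (\<lambda>z. cmod (f z) powr p * \<omega> (cmod z))}"

definition weighted_Lp_norm ::
    "real \<Rightarrow> (real \<Rightarrow> real) \<Rightarrow> (complex \<Rightarrow> complex) \<Rightarrow> real" where
  "weighted_Lp_norm p \<omega> f = (LINT z|disc_area. cmod (f z) powr p * \<omega> (cmod z)) powr (1 / p)"

definition bounded_on_weighted_Lp ::
    "real \<Rightarrow> (real \<Rightarrow> real) \<Rightarrow> ((complex \<Rightarrow> complex) \<Rightarrow> (complex \<Rightarrow> complex)) \<Rightarrow> bool" where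
  "bounded_on_weighted_Lp p \<omega> T \<longleftrightarrow>
     (\<exists>C. \<forall>f\<in>weighted_Lp p \<omega>.
        T f \<in> weighted_Lp p \<omega> \<and> weighted_Lp_norm p \<omega> (T f) \<le> C * weighted_Lp_norm p \<omega> f)"

definition weight_moment :: "(real \<Rightarrow> real) \<Rightarrow> real \<Rightarrow> real" where
  "weight_moment \<omega> x = (LINT r:{0..<1}|lebesgue. r powr x * \<omega> r)"

text \<open>
  For a radial weight the moments are positive and \<open>\<omega>\<^sub>x \<ge> r\<^sup>x * weight_hat \<omega> r\<close>
  for \<open>0 < r < 1\<close>, so the series converges whenever \<open>|z \<zeta>| < 1\<close>. For fixed \<open>z\<close> in the disc the
  kernel is moreover bounded in \<open>\<zeta>\<close>, hence for \<open>p \<ge> 1\<close> the integrals defining the two projections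
  converge absolutely for every \<open>f\<close> in \<open>weighted_Lp p \<omega>\<close>; no default values of
  \<open>suminf\<close> or of the integral occur there.
\<close>

definition bergman_kernel :: "(real \<Rightarrow> real) \<Rightarrow> complex \<Rightarrow> complex \<Rightarrow> complex" where
  "bergman_kernel \<omega> z \<zeta> =
     (\<Sum>n. (cnj z * \<zeta>) ^ n / of_real (2 * weight_moment \<omega> (2 * real n + 1)))"

definition bergman_proj ::
    "(real \<Rightarrow> real) \<Rightarrow> (complex \<Rightarrow> complex) \<Rightarrow> complex \<Rightarrow> complex" where
  "bergman_proj \<omega> f z =
     (LINT \<zeta>|disc_area. f \<zeta> * cnj (bergman_kernel \<omega> z \<zeta>) * of_real (\<omega> (cmod \<zeta>)))"

definition max_bergman_proj ::
    "(real \<Rightarrow> real) \<Rightarrow> (complex \<Rightarrow> complex) \<Rightarrow> complex \<Rightarrow> complex" where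
  "max_bergman_proj \<omega> f z =
     (LINT \<zeta>|disc_area. f \<zeta> * of_real (cmod (bergman_kernel \<omega> z \<zeta>)) * of_real (\<omega> (cmod \<zeta>)))"

end

(*
  Write W for the tail integral of the weight. On a pair of circles |z| = r, |y| = s the kernel acts
  as a Fourier multiplier with increasing coefficients c_j, damped geometrically. Summation by parts
  and the M. Riesz theorem (proved from the mean value property of F^p for the Herglotz integral F)
  bound its norm on L^p of the circle by (1 - a) times the sum of c_j a^j, a = (1 + min r s) / 2,
  which the doubling condition turns into C / max (W r) (W s). As W maps w(s) ds to Lebesgue measure,
  Schur's test with the weight W^(-1/p) bounds the projection.

  The modulus of the kernel destroys this cancellation: Hardy's inequality bounds its circular means
  below by sums of c_j a^j / (j + 1). If the weight is not in D-check, W varies by less than a factor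
  2 on some interval [r, t] with (1 - r) / (1 - t) arbitrarily large, so those sums contain an
  arbitrarily long piece of the harmonic series with comparable coefficients, and the maximal
  projection of the indicator of the annulus t <= |z| < 1 is arbitrarily large on that annulus.
*)
theory Submission imports Defs "HOL-Complex_Analysis.Complex_Analysis"
begin

section \<open>Rotations and radial functions\<close>

text \<open>The size of the kernel cannot give boundedness: Schur's test on its modulus would bound
  the maximal projection too. Hence moduli are taken only after the angular integration, and just
  the norms \<open>1 / max (W |z|) (W |y|)\<close> on pairs of circles enter Schur's test. No
  pointwise regularity of the weight is available, only that of \<open>W\<close>. Doubling gives
  polynomial growth, \<open>W s <= C * ((1 - s) / (1 - r)) ^ N * W r\<close> for
  \<open>s <= r\<close>, and this makes the moment of order \<open>2 * j + 1\<close> comparable to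
  \<open>W\<close> at distance about \<open>1 / j\<close> from 1. The lower bound for moments serves
  the projection, the upper bound serves the failure of the maximal one. The radius \<open>a\<close>
  lies halfway between \<open>min r s\<close> and 1 because a factor \<open>a\<close> is split off
  from the variable and the rest must stay inside the disc; doubling pays for replacing
  \<open>W a\<close> by \<open>W (min r s)\<close>. The mean value argument is confined to
  \<open>1 < p <= 2\<close>, where \<open>p\<close> times an angle below \<open>pi / 2\<close> does
  not exceed \<open>pi\<close>; larger exponents follow by duality. Weights and functions are only
  Lebesgue measurable, so all estimates are made for Borel versions and transferred at the
  end.\<close>

lemma nn_integral_lborel_shift:
  fixes f :: "'a::euclidean_space \<Rightarrow> ennreal"
  assumes [measurable]: "f \<in> borel_measurable borel"
  shows "(\<integral>\<^sup>+x. f (c + x) \<partial>lborel) = (\<integral>\<^sup>+x. f x \<partial>lborel)"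
proof -
  have "(\<integral>\<^sup>+x. f x \<partial>lborel) = (\<integral>\<^sup>+x. f x \<partial>(distr lborel borel ((+) c)))"
    by (simp add: lborel_distr_plus)
  also have "\<dots> = (\<integral>\<^sup>+x. f (c + x) \<partial>lborel)"
    by (subst nn_integral_distr) auto
  finally show ?thesis by simp
qed

lemma nn_integral_lborel_reflect:
  fixes f :: "'a::euclidean_space \<Rightarrow> ennreal"
  assumes [measurable]: "f \<in> borel_measurable borel"
  shows "(\<integral>\<^sup>+x. f (c - x) \<partial>lborel) = (\<integral>\<^sup>+x. f x \<partial>lborel)"
proof -
  have "(\<integral>\<^sup>+x. f x \<partial>lborel) =
      (\<integral>\<^sup>+x. f x \<partial>(density (distr lborel borel (\<lambda>x. c + (-1) *\<^sub>R x)) (\<lambda>_. \<bar>-1::real\<bar> ^ DIM('a))))"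
    by (subst lborel_affine[of "-1" c]) auto
  also have "\<dots> = (\<integral>\<^sup>+x. f (c - x) \<partial>lborel)"
    by (subst nn_integral_density) (auto simp: nn_integral_distr)
  finally show ?thesis by simp
qed

text \<open>
  Uniqueness of Haar measure: integrating \<open>1\<^sub>A(e x) 1\<^sub>B(e x + y)\<close> in both orders,
  with \<open>A\<close> the unit ball, compares \<open>B\<close> with its rotated copy.
\<close>
lemma emeasure_lborel_rotation:
  fixes e :: complex
  assumes e: "cmod e = 1" and [measurable]: "B \<in> sets borel"
  shows "emeasure lborel {x. e * x \<in> B} = emeasure lborel B"
proof -
  define A :: "complex set" where "A = ball 0 1"
  have [measurable]: "A \<in> sets borel" by (simp add: A_def)
  have e0: "e \<noteq> 0" using e by auto
  have Ae: "indicator A (e * x) = (indicator A x :: ennreal)" for x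
    by (simp add: A_def indicator_def norm_mult e)
  define I where "I = (\<integral>\<^sup>+x. \<integral>\<^sup>+y. indicator A (e * x) * indicator B (e * x + y) \<partial>lborel \<partial>lborel)"
  have "I = (\<integral>\<^sup>+x. indicator A x * emeasure lborel B \<partial>lborel)"
    unfolding I_def
    by (subst nn_integral_cmult) (auto simp: Ae nn_integral_lborel_shift[of "indicator B"])
  then have 1: "I = emeasure lborel A * emeasure lborel B"
    by (simp add: nn_integral_multc)
  have "I = (\<integral>\<^sup>+y. \<integral>\<^sup>+x. indicator A (e * x) * indicator B (e * x + y) \<partial>lborel \<partial>lborel)"
    unfolding I_def by (rule lborel_pair.Fubini') measurable
  also have "\<dots> = (\<integral>\<^sup>+y. \<integral>\<^sup>+x. indicator A (e * x - y) * indicator B (e * x) \<partial>lborel \<partial>lborel)"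
  proof (rule nn_integral_cong)
    fix y
    show "(\<integral>\<^sup>+x. indicator A (e * x) * indicator B (e * x + y) \<partial>lborel) =
      (\<integral>\<^sup>+x. indicator A (e * x - y) * indicator B (e * x) \<partial>lborel)"
      using nn_integral_lborel_shift[of "\<lambda>x. indicator A (e * x - y) * indicator B (e * x) :: ennreal" "y / e"] e0
      by (simp add: algebra_simps)
  qed
  also have "\<dots> = (\<integral>\<^sup>+x. \<integral>\<^sup>+y. indicator A (e * x - y) * indicator B (e * x) \<partial>lborel \<partial>lborel)"
    by (rule lborel_pair.Fubini') measurable
  also have "\<dots> = (\<integral>\<^sup>+x. emeasure lborel A * indicator B (e * x) \<partial>lborel)"
    by (subst nn_integral_multc) (auto simp: nn_integral_lborel_reflect[of "indicator A"])
  also have "\<dots> = emeasure lborel A * (\<integral>\<^sup>+x. indicator B (e * x) \<partial>lborel)"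
    by (subst nn_integral_cmult) auto
  also have "(\<integral>\<^sup>+x. indicator B (e * x) \<partial>lborel) = (\<integral>\<^sup>+x. indicator {x. e * x \<in> B} x \<partial>lborel)"
    by (rule nn_integral_cong) (simp add: indicator_def)
  also have "\<dots> = emeasure lborel {x. e * x \<in> B}"
    by (subst nn_integral_indicator) auto
  finally have 2: "I = emeasure lborel A * emeasure lborel {x. e * x \<in> B}" .
  have "emeasure lborel A = ennreal pi"
    by (simp add: A_def emeasure_ball unit_ball_vol_2)
  then show ?thesis using 1 2 pi_gt_zero
    by (metis ennreal_mult_cancel_left ennreal_eq_0_iff ennreal_neq_top not_le)
qed

lemma nn_integral_lborel_rotation:
  fixes e :: complex
  assumes e: "cmod e = 1" and [measurable]: "f \<in> borel_measurable borel"
  shows "(\<integral>\<^sup>+x. f (e * x) \<partial>lborel) = (\<integral>\<^sup>+x. f x \<partial>lborel)"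
proof -
  have "distr lborel borel ((*) e) = (lborel :: complex measure)"
  proof (rule measure_eqI)
    fix B assume "B \<in> sets (distr lborel borel ((*) e))"
    then have B[measurable]: "B \<in> sets borel" by simp
    show "emeasure (distr lborel borel ((*) e)) B = emeasure lborel B"
      by (subst emeasure_distr) (auto simp: vimage_def emeasure_lborel_rotation[OF e B])
  qed simp
  then have "(\<integral>\<^sup>+x. f x \<partial>lborel) = (\<integral>\<^sup>+x. f x \<partial>(distr lborel borel ((*) e)))"
    by simp
  also have "\<dots> = (\<integral>\<^sup>+x. f (e * x) \<partial>lborel)"
    by (subst nn_integral_distr) auto
  finally show ?thesis by simp
qed

lemma measure_eqI_atMost:
  fixes M N :: "real measure"
  assumes "sets M = sets borel" "sets N = sets borel"
    and eq: "\<And>a. emeasure M {..a} = emeasure N {..a}" and fin: "\<And>a. emeasure N {..a} \<noteq> \<infinity>"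
  shows "M = N"
proof (rule measure_eqI_generator_eq[where E="range atMost" and \<Omega>=UNIV and A="\<lambda>n. {..real n}"])
  show "Int_stable (range (atMost :: real \<Rightarrow> _))"
    by (auto simp: Int_stable_def)
  show "sets M = sigma_sets UNIV (range atMost)" "sets N = sigma_sets UNIV (range atMost)"
    using assms by (simp_all add: borel_eq_atMost)
  show "(\<Union>n. {..real n}) = UNIV" by (auto simp: real_arch_simple)
qed (use eq fin in auto)

text \<open>Polar coordinates in the radial variable only: on the half-line up to
  \<open>a >= 0\<close> both measures give the area \<open>pi * a^2\<close> of a disc, and
  half-lines determine a measure.\<close>

lemma distr_lborel_cmod:
  "distr lborel borel cmod = density lborel (\<lambda>s. ennreal (2 * pi * s) * indicator {0..} s)"
    (is "?M = ?N")
proof -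
  have ball: "emeasure ?M {..a} = emeasure lborel (cball (0::complex) a)" for a
    by (subst emeasure_distr) (auto intro!: arg_cong[where f="emeasure lborel"])
  have M: "emeasure ?M {..a} = emeasure ?N {..a}" for a
  proof (cases "a \<ge> 0")
    case True
    have "emeasure ?N {..a} = (\<integral>\<^sup>+s. ennreal (2 * pi * s) * indicator {0..a} s \<partial>lborel)"
      by (subst emeasure_density) (auto intro!: nn_integral_cong simp: indicator_def)
    also have "\<dots> = ennreal (pi * a\<^sup>2 - pi * 0\<^sup>2)"
      by (rule nn_integral_FTC_Icc) (use True in \<open>auto intro!: derivative_eq_intros\<close>)
    finally show ?thesis using True by (simp add: ball emeasure_cball unit_ball_vol_2)
  next
    case False
    then have z: "ennreal (2 * pi * s) * indicator {0..} s * indicator {..a} s = 0" for s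
      by (auto split: split_indicator)
    have "emeasure ?N {..a} = 0"
      by (subst emeasure_density) (simp_all add: z)
    with False show ?thesis by (simp add: ball)
  qed
  have fin: "emeasure ?N {..a} \<noteq> \<infinity>" for a
    using M[of a] ball[of a] emeasure_lborel_cball_finite[of "0::complex" a] by auto
  show ?thesis by (rule measure_eqI_atMost) (use M fin in auto)
qed

lemma nn_integral_radial:
  assumes [measurable]: "g \<in> borel_measurable borel"
  shows "(\<integral>\<^sup>+z. g (cmod (z::complex)) \<partial>lborel) = (\<integral>\<^sup>+s. ennreal (2 * pi * s) * indicator {0..} s * g s \<partial>lborel)"
proof -
  have "(\<integral>\<^sup>+z. g (cmod (z::complex)) \<partial>lborel) = (\<integral>\<^sup>+s. g s \<partial>(distr lborel borel cmod))"
    by (subst nn_integral_distr) auto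
  also have "\<dots> = (\<integral>\<^sup>+s. ennreal (2 * pi * s) * indicator {0..} s * g s \<partial>lborel)"
    unfolding distr_lborel_cmod by (subst nn_integral_density) auto
  finally show ?thesis .
qed

text \<open>This is the tangent line of the convex function \<open>t powr p\<close> at
  \<open>t = c\<close>, solved for \<open>t\<close>; the proof obtains it from the weighted
  arithmetic-geometric mean inequality.\<close>

lemma powr_tangent_ineq:
  fixes p c t :: real
  assumes "1 < p" "0 < c" "0 \<le> t"
  shows "t \<le> (1 - 1/p) * c + c powr (1 - p) * t powr p / p"
proof (cases "t = 0")
  case True
  then show ?thesis using assms by simp
next
  case False
  define b where "b = c powr (1 - p) * t powr p"
  have b: "b > 0" using False assms by (simp add: b_def)
  have "c powr (1 - 1/p) * b powr (1/p) \<le> (1 - 1/p) * c + (1/p) * b"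
    by (rule Youngs_inequality_0) (use assms b in auto)
  also have "c powr (1 - 1/p) * b powr (1/p) = t"
  proof -
    have "b powr (1/p) = c powr ((1 - p) / p) * t"
      using assms False by (simp add: b_def powr_mult powr_powr)
    moreover have "c powr (1 - 1/p) * c powr ((1 - p)/p) = 1"
      using assms by (simp add: powr_add[symmetric] field_simps)
    ultimately show ?thesis by (metis mult.assoc mult_1)
  qed
  finally show ?thesis by (simp add: b_def)
qed

text \<open>Jensen's inequality for \<open>g / v\<close> under the measure \<open>v dM\<close>,
  normalised by its mass. As \<open>X\<close> and \<open>V\<close> are only one-sided bounds,
  \<open>X\<close> can be the norm of a vector-valued integral and \<open>V\<close> a Schur bound.
  It is applied to the Poisson kernel, to a series and to Schur's test.\<close>

lemma Jensen_weighted: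
  fixes g v :: "'a \<Rightarrow> real"
  assumes p: "1 < p" and [measurable]: "g \<in> borel_measurable M" "v \<in> borel_measurable M"
    and g: "\<And>x. x \<in> space M \<Longrightarrow> 0 \<le> g x" and v: "\<And>x. x \<in> space M \<Longrightarrow> 0 < v x"
    and X: "0 \<le> X" "ennreal X \<le> (\<integral>\<^sup>+x. ennreal (g x) \<partial>M)"
    and V: "0 < V" "(\<integral>\<^sup>+x. ennreal (v x) \<partial>M) \<le> ennreal V"
  shows "ennreal (X powr p) \<le>
    ennreal (V powr (p - 1)) * (\<integral>\<^sup>+x. ennreal (g x powr p * v x powr (1 - p)) \<partial>M)"
proof -
  define I where "I = (\<integral>\<^sup>+x. ennreal (g x powr p * v x powr (1 - p)) \<partial>M)"
  show ?thesis
  proof (cases "X = 0 \<or> I = top")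
    case True
    then show ?thesis
    proof
      assume "I = top"
      then show ?thesis using V by (simp add: I_def[symmetric] ennreal_mult_top)
    qed (use p in simp)
  next
    case False
    then obtain i where i: "I = ennreal i" "0 \<le> i" by (cases I) auto
    from False X have X0: "X > 0" by auto
    \<comment> \<open>The tangent is taken at the mean value of \<open>g / v\<close>, which is the
      optimal point.\<close>
    define c where "c = X / V"
    have c: "c > 0" using X0 V by (simp add: c_def)
    have pt: "g x \<le> ((1 - 1/p) * c) * v x + (c powr (1 - p) / p) * (g x powr p * v x powr (1 - p))"
      if "x \<in> space M" for x
    proof -
      have vx: "v x > 0" "g x \<ge> 0" using v g that by auto
      have "g x / v x \<le> (1 - 1/p) * c + c powr (1 - p) * (g x / v x) powr p / p"
        by (rule powr_tangent_ineq) (use p c vx in auto)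
      then have "g x / v x * v x \<le> ((1 - 1/p) * c + c powr (1 - p) * (g x / v x) powr p / p) * v x"
        using vx by (intro mult_right_mono) auto
      then have "g x \<le> (1 - 1/p) * c * v x + c powr (1 - p) / p * ((g x / v x) powr p * v x)"
        using vx by (simp add: distrib_right)
      moreover have "(g x / v x) powr p * v x = g x powr p * v x powr (1 - p)"
        using vx by (simp add: powr_divide powr_diff)
      ultimately show ?thesis by simp
    qed
    have "ennreal X \<le> (\<integral>\<^sup>+x. ennreal (g x) \<partial>M)" by (rule X)
    also have "\<dots> \<le> (\<integral>\<^sup>+x. ennreal ((1 - 1/p) * c) * ennreal (v x) +
        ennreal (c powr (1 - p) / p) * ennreal (g x powr p * v x powr (1 - p)) \<partial>M)"
    proof (rule nn_integral_mono)
      fix x assume x: "x \<in> space M"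
      have "v x > 0" using v x by auto
      then show "ennreal (g x) \<le> ennreal ((1 - 1/p) * c) * ennreal (v x) +
        ennreal (c powr (1 - p) / p) * ennreal (g x powr p * v x powr (1 - p))"
        using pt[OF x] p c
        by (simp add: ennreal_mult'[symmetric] ennreal_plus[symmetric] del: ennreal_plus)
    qed
    also have "\<dots> = ennreal ((1 - 1/p) * c) * (\<integral>\<^sup>+x. ennreal (v x) \<partial>M) + ennreal (c powr (1 - p) / p) * I"
      by (simp add: nn_integral_add nn_integral_cmult I_def)
    also have "\<dots> \<le> ennreal ((1 - 1/p) * c) * ennreal V + ennreal (c powr (1 - p) / p) * ennreal i"
      unfolding i by (intro add_mono mult_left_mono V) auto
    also have "\<dots> = ennreal ((1 - 1/p) * c * V + c powr (1 - p) / p * i)"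
      using p c V i by (simp add: ennreal_mult'[symmetric] ennreal_plus[symmetric] del: ennreal_plus)
    finally have "X \<le> (1 - 1/p) * c * V + c powr (1 - p) / p * i"
      using p c V i by (subst (asm) ennreal_le_iff) auto
    then have "X \<le> X - X/p + c powr (1 - p) / p * i"
      using V by (simp add: c_def algebra_simps)
    then have "X / p \<le> c powr (1 - p) * i / p" by simp
    then have "X \<le> c powr (1 - p) * i" using p by (simp add: divide_le_cancel)
    then have "X * c powr (p - 1) \<le> c powr (1 - p) * i * c powr (p - 1)"
      using c by (intro mult_right_mono) auto
    also have "\<dots> = i" using c by (simp add: powr_diff field_simps)
    finally have "X * c powr (p - 1) \<le> i" .
    then have "X * c powr (p - 1) * V powr (p - 1) \<le> i * V powr (p - 1)"
      by (intro mult_right_mono) auto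
    moreover have "X * c powr (p - 1) * V powr (p - 1) = X powr p"
      using X0 V by (simp add: c_def powr_divide powr_diff)
    ultimately have "ennreal (X powr p) \<le> ennreal (V powr (p - 1)) * ennreal i"
      using i by (subst ennreal_mult'[symmetric]) (auto simp: mult.commute intro!: ennreal_leI)
    then show ?thesis unfolding I_def[symmetric] i(1) .
  qed
qed

section \<open>The M. Riesz theorem\<close>

definition circ :: "real \<Rightarrow> complex" where "circ t = cis (2 * pi * t)"

text \<open>Normalised arc length, carried by the parameter interval but kept as a measure on the
  whole line, so that measurability is plain Borel measurability.\<close>

definition haar :: "real measure" where
  "haar = density lborel (indicator {0..1})"

abbreviation Lp_int :: "'a measure \<Rightarrow> real \<Rightarrow> ('a \<Rightarrow> complex) \<Rightarrow> ennreal" where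
  "Lp_int M p f \<equiv> (\<integral>\<^sup>+x. ennreal (cmod (f x) powr p) \<partial>M)"

lemma cmod_circ [simp]: "cmod (circ t) = 1"
  by (simp add: circ_def)

lemma circ_nonzero [simp]: "circ t \<noteq> 0"
  by (simp add: circ_def)

lemma continuous_on_circ [continuous_intros]:
  assumes "continuous_on S f"
  shows "continuous_on S (\<lambda>x. circ (f x))"
  using assms by (auto simp: circ_def intro!: continuous_intros)

lemma borel_measurable_circ [measurable]: "circ \<in> borel_measurable borel"
  by (intro borel_measurable_continuous_onI continuous_intros)

lemma sets_haar [simp, measurable_cong]: "sets haar = sets borel"
  by (simp add: haar_def)

lemma space_haar [simp]: "space haar = UNIV"
  by (simp add: haar_def)

lemma emeasure_haar_UNIV [simp]: "emeasure haar UNIV = 1"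
  by (simp add: haar_def emeasure_density)

lemma measure_haar_UNIV [simp]: "measure haar UNIV = 1"
  by (simp add: measure_def)

interpretation circle: finite_measure haar
  by standard (simp add: haar_def emeasure_density)

interpretation circle_pair: pair_sigma_finite haar haar
  by standard

lemma integrable_circle_bounded:
  fixes f :: "real \<Rightarrow> 'b::{banach, second_countable_topology}"
  assumes "f \<in> borel_measurable borel" "\<And>t. norm (f t) \<le> B"
  shows "integrable haar f"
  by (rule circle.integrable_const_bound[where B=B]) (use assms in \<open>auto simp: measurable_def\<close>)

lemma integral_circle_eq:
  fixes f :: "real \<Rightarrow> complex"
  assumes "continuous_on UNIV f"
  shows "(LINT t|haar. f t) = integral {0..1} f"
proof -
  have [measurable]: "f \<in> borel_measurable borel"
    using assms by (rule borel_measurable_continuous_onI)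
  have "(LINT t|haar. f t) = (LINT t:{0..1}|lborel. f t)"
  proof -
    have h: "haar = density lborel (\<lambda>t. ennreal (indicator {0..1} t))"
      unfolding haar_def by (intro arg_cong[where f="density lborel"] ext) (simp add: ennreal_indicator)
    show ?thesis
      unfolding set_lebesgue_integral_def h by (subst integral_density) auto
  qed
  also have "\<dots> = integral {0..1} f"
    by (rule set_borel_integral_eq_integral(2))
      (auto intro!: borel_integrable_compact continuous_on_subset[OF assms] simp: set_integrable_def)
  finally show ?thesis .
qed

text \<open>Cauchy's formula at the centre: along this parametrisation \<open>du / u\<close> equals
  \<open>2 * pi * i * dt\<close>.\<close>

lemma mean_value_circle:
  assumes "f holomorphic_on ball 0 R" "R > 1"
  shows "(LINT t|haar. f (circ t)) = f 0"
proof -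
  have hol: "f holomorphic_on cball 0 1"
    using assms by (auto intro: holomorphic_on_subset)
  have c: "continuous_on UNIV (\<lambda>t. f (circ t))"
    using holomorphic_on_imp_continuous_on[OF hol]
    by (rule continuous_on_compose2) (auto intro!: continuous_intros)
  have "((\<lambda>u. f u / (u - 0)) has_contour_integral 2 * of_real pi * \<i> * f 0) (circlepath 0 1)"
    by (rule Cauchy_integral_circlepath_simple) (use hol in auto)
  then have 1: "((\<lambda>t. f (circlepath 0 1 t) / (circlepath 0 1 t - 0) *
      vector_derivative (circlepath 0 1) (at t within {0..1})) has_integral 2 * of_real pi * \<i> * f 0) {0..1}"
    unfolding has_contour_integral_def .
  have 2: "circlepath 0 1 t = circ t"
    "t \<in> {0..1} \<Longrightarrow> vector_derivative (circlepath 0 1) (at t within {0..1}) = 2 * of_real pi * \<i> * circ t" for t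
    by (simp_all add: vector_derivative_circlepath01)
      (simp_all add: circlepath circ_def cis_conv_exp mult_ac)
  have "((\<lambda>t. f (circ t) * (2 * of_real pi * \<i>)) has_integral 2 * of_real pi * \<i> * f 0) {0..1}"
    by (rule has_integral_eq[OF _ 1]) (simp add: 2)
  moreover define d where "d = 2 * of_real pi * \<i>"
  ultimately have "((\<lambda>t. f (circ t) * d * inverse d) has_integral d * f 0 * inverse d) {0..1}"
    by (intro has_integral_mult_left) simp
  moreover have "d \<noteq> 0" by (simp add: d_def)
  ultimately have "((\<lambda>t. f (circ t)) has_integral f 0) {0..1}"
    by (simp add: divide_inverse[symmetric])
  then show ?thesis
    by (simp add: integral_circle_eq[OF c] integral_unique)
qed

text \<open>Only the angle of \<open>z\<close> matters. Near the imaginary axis \<open>p\<close>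
  times the angle lies between \<open>pi / 2\<close> and \<open>pi\<close>, so its cosine is
  negative and a large \<open>B\<close> makes the left side nonpositive. Away from the axis the real
  part is comparable to the modulus and a large \<open>A\<close> suffices. The bound
  \<open>p <= 2\<close> keeps the multiplied angle where the cosine decreases.\<close>

lemma riesz_pointwise:
  fixes p :: real
  assumes p: "1 < p" "p \<le> 2"
  obtains A B where "A > 0" "B > 0"
    "\<And>z. Re z > 0 \<Longrightarrow> cmod z powr p + B * Re (z powr of_real p) \<le> A * Re z powr p"
proof -
  \<comment> \<open>The angle separating the two regimes: any value strictly between
    \<open>pi / (2 * p)\<close> and \<open>pi / 2\<close> would do, and the midpoint is
    taken.\<close>
  define g where "g = (pi / (2 * p) + pi / 2) / 2"
  have g: "pi / (2 * p) < g" "g < pi / 2" "0 < g"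
    using p by (auto simp: g_def field_simps add_pos_pos)
  have pg: "pi / 2 < p * g" "p * g < pi"
  proof -
    show "pi / 2 < p * g" using g(1) p by (simp add: field_simps)
    have "p * g \<le> 2 * g" using p g by (intro mult_right_mono) auto
    then show "p * g < pi" using g by linarith
  qed
  have c1: "cos (p * g) < 0"
    using pg cos_lt_zero_pi[of "p * g"] cos_gt_zero_pi[of "pi - p * g"] by (simp add: cos_diff)
  have c2: "cos g > 0" using g by (intro cos_gt_zero_pi) auto
  define B where "B = - 1 / cos (p * g)"
  define A where "A = (1 + B) / cos g powr p"
  have B: "B > 0" using c1 by (simp add: B_def field_simps)
  have A: "A > 0" using B c2 by (simp add: A_def)
  have key: "1 + B * cos (p * x) \<le> A * cos x powr p" if x: "\<bar>x\<bar> < pi / 2" for x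
  proof (cases "\<bar>x\<bar> \<ge> g")
    case True
    have "p * \<bar>x\<bar> \<le> 2 * \<bar>x\<bar>" using p by (intro mult_right_mono) auto
    then have "p * \<bar>x\<bar> \<le> pi" using x by simp
    then have "cos (p * \<bar>x\<bar>) \<le> cos (p * g)"
      using True pg p g by (intro cos_monotone_0_pi_le) auto
    then have "cos (p * x) \<le> cos (p * g)"
      by (cases "x \<ge> 0") auto
    then have "B * cos (p * x) \<le> B * cos (p * g)" using B by simp
    also have "\<dots> = -1" using c1 by (simp add: B_def)
    finally show ?thesis using A by (simp add: add.commute order_trans[of _ 0])
  next
    case False
    have "cos g \<le> cos \<bar>x\<bar>"
      using False g x by (intro cos_monotone_0_pi_le) auto
    then have "cos g powr p \<le> cos x powr p"
      using c2 p by (intro powr_mono2) auto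
    then have "A * cos g powr p \<le> A * cos x powr p" using A by simp
    moreover have "A * cos g powr p = 1 + B" using c2 by (simp add: A_def)
    moreover have "B * cos (p * x) \<le> B" using B by simp
    ultimately show ?thesis by linarith
  qed
  show ?thesis
  proof (rule that[OF A B])
    fix z assume z: "Re z > 0"
    then have z0: "z \<noteq> 0" by auto
    define r where "r = cmod z"
    define x where "x = Arg z"
    have r: "r > 0" using z0 by (simp add: r_def)
    have x: "\<bar>x\<bar> < pi / 2" using Arg_Re_pos[of z] z by (simp add: x_def)
    have zp: "z = of_real r * cis x" using Arg_eq[OF z0] by (simp add: r_def x_def cis_conv_exp)
    have "Ln z = of_real (ln r) + \<i> * of_real x"
      using z0 by (simp add: r_def x_def Arg_eq_Im_Ln complex_eq_iff Re_Ln)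
    then have "z powr of_real p = exp (of_real (p * ln r) + \<i> * of_real (p * x))"
      using z0 by (simp add: powr_def algebra_simps)
    then have Rp: "Re (z powr of_real p) = r powr p * cos (p * x)"
      using r by (simp add: Re_exp powr_def)
    have Rz: "Re z = r * cos x" by (subst zp) simp
    have cx: "cos x > 0" using x by (intro cos_gt_zero_pi) auto
    have "r powr p * (1 + B * cos (p * x)) \<le> r powr p * (A * cos x powr p)"
      using key[OF x] by (intro mult_left_mono) auto
    then show "cmod z powr p + B * Re (z powr of_real p) \<le> A * Re z powr p"
      unfolding Rp Rz using r cx by (simp add: r_def[symmetric] powr_mult algebra_simps)
  qed
qed

text \<open>The analytic part of \<open>u\<close>: the power series of its Fourier coefficients of
  index \<open>n >= 0\<close>. It is only used inside the disc, with bounds uniform in the radius,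
  so boundary values never occur.\<close>

definition cauchy_int :: "(real \<Rightarrow> complex) \<Rightarrow> complex \<Rightarrow> complex" where
  "cauchy_int u x = (LINT y|haar. u y / (1 - x * cnj (circ y)))"

lemma norm_one_minus_ge:
  fixes x :: "'a::real_normed_algebra_1"
  shows "norm (1 - x) \<ge> 1 - norm x"
  using norm_triangle_ineq2[of 1 x] by simp

lemma borel_measurable_cnj [measurable]: "cnj \<in> borel_measurable borel"
  by (intro borel_measurable_continuous_onI continuous_intros)

lemma cauchy_int_sums:
  assumes u: "integrable haar u" and x: "cmod x < 1"
  shows "(\<lambda>n. (LINT y|haar. u y * cnj (circ y) ^ n) * x ^ n) sums cauchy_int u x"
proof -
  have [measurable]: "u \<in> borel_measurable borel"
    using borel_measurable_integrable[OF u] by (simp add: measurable_def)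
  have int: "integrable haar (\<lambda>y. u y * (x * cnj (circ y)) ^ n)" for n
    by (rule Bochner_Integration.integrable_bound[OF u])
      (use x in \<open>auto simp: norm_mult norm_power mult_left_le power_le_one measurable_def[symmetric]\<close>)
  have "(\<lambda>n. LINT y|haar. u y * (x * cnj (circ y)) ^ n) sums
      (LINT y|haar. (\<Sum>n. u y * (x * cnj (circ y)) ^ n))"
  proof (rule sums_integral[OF int])
    show "AE y in haar. summable (\<lambda>n. norm (u y * (x * cnj (circ y)) ^ n))"
      using x by (auto simp: norm_mult norm_power intro!: summable_mult summable_geometric)
    show "summable (\<lambda>n. LINT y|haar. norm (u y * (x * cnj (circ y)) ^ n))"
      using x by (auto simp: norm_mult norm_power intro!: summable_mult summable_geometric)
  qed
  moreover have "(\<Sum>n. u y * (x * cnj (circ y)) ^ n) = u y / (1 - x * cnj (circ y))" for y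
    using x by (subst suminf_mult) (auto simp: suminf_geometric norm_mult intro!: summable_geometric)
  moreover have "(LINT y|haar. u y * (x * cnj (circ y)) ^ n) =
      (LINT y|haar. u y * cnj (circ y) ^ n) * x ^ n" for n
    by (simp add: power_mult_distrib mult_ac flip: integral_mult_right_zero)
  ultimately show ?thesis by (simp add: cauchy_int_def)
qed

lemma holomorphic_cauchy_int:
  assumes u: "integrable haar u"
  shows "cauchy_int u holomorphic_on ball 0 1"
  by (rule power_series_holomorphic[where a="\<lambda>n. LINT y|haar. u y * cnj (circ y) ^ n"])
    (use cauchy_int_sums[OF u] in simp)

lemma cauchy_int_0: "cauchy_int u 0 = (LINT y|haar. u y)"
  by (simp add: cauchy_int_def)

lemma integrable_cauchy_kernel:
  assumes u: "integrable haar u" and x: "cmod x < 1"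
  shows "integrable haar (\<lambda>y. u y / (1 - x * cnj (circ y)))"
proof (rule Bochner_Integration.integrable_bound)
  show "integrable haar (\<lambda>y. (1 / (1 - cmod x)) *\<^sub>R u y)"
    using u by simp
  have [measurable]: "u \<in> borel_measurable borel"
    using borel_measurable_integrable[OF u] by (simp add: measurable_def)
  show "(\<lambda>y. u y / (1 - x * cnj (circ y))) \<in> borel_measurable haar"
    by (subst measurable_cong_sets[OF sets_haar refl]) measurable
  show "AE y in haar. norm (u y / (1 - x * cnj (circ y))) \<le> norm ((1 / (1 - cmod x)) *\<^sub>R u y)"
  proof (rule AE_I2)
    fix y
    have "1 - cmod x \<le> cmod (1 - x * cnj (circ y))"
      using norm_one_minus_ge[of "x * cnj (circ y)"] by (simp add: norm_mult)
    then show "norm (u y / (1 - x * cnj (circ y))) \<le> norm ((1 / (1 - cmod x)) *\<^sub>R u y)"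
      using x by (simp add: norm_divide frac_le)
  qed
qed

text \<open>For \<open>w = x * cnj (circ t)\<close> this is the Poisson kernel at the point
  \<open>x\<close>.\<close>

lemma Re_Cayley: "Re ((1 + w) / (1 - w)) = (1 - (cmod w)\<^sup>2) / (cmod (1 - w))\<^sup>2"
  unfolding Re_divide cmod_power2 by (simp add: algebra_simps power2_eq_square)

lemma Re_Cayley_pos: "cmod w < 1 \<Longrightarrow> Re ((1 + w) / (1 - w)) > 0"
proof -
  assume w: "cmod w < 1"
  then have "1 - w \<noteq> 0" by auto
  moreover have "(cmod w)\<^sup>2 < 1" using w by (simp add: power_less_one_iff)
  ultimately show ?thesis unfolding Re_Cayley by simp
qed

text \<open>The Poisson kernel has mean one in either variable, by the mean value property and by
  conjugation. One version normalises the measure in Jensen's inequality, the other removes the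
  kernel after Fubini.\<close>

lemma Cayley_mean:
  assumes b: "cmod b < 1"
  shows "(\<integral>\<^sup>+t. ennreal (Re ((1 + b * circ t) / (1 - b * circ t))) \<partial>haar) = 1"
    and "(\<integral>\<^sup>+t. ennreal (Re ((1 + b * cnj (circ t)) / (1 - b * cnj (circ t)))) \<partial>haar) = 1"
proof -
  have main: "(\<integral>\<^sup>+t. ennreal (Re ((1 + b * circ t) / (1 - b * circ t))) \<partial>haar) = 1"
    if b: "cmod b < 1" for b
  proof -
    \<comment> \<open>The modulus of the pole of the Cayley transform; without a pole any number
      above 1 serves.\<close>
    define R where "R = (if b = 0 then 2 else 1 / cmod b)"
    have R: "R > 1" using b by (simp add: R_def)
    have nz: "b * x \<noteq> 1" if "cmod x < R" for x
      using that b by (auto simp: R_def field_simps norm_mult[symmetric] split: if_splits)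
    have "(LINT t|haar. (1 + b * circ t) / (1 - b * circ t)) = (1 + b * 0) / (1 - b * 0)"
      by (rule mean_value_circle[OF _ R]) (use nz in \<open>auto intro!: holomorphic_intros\<close>)
    then have 1: "(LINT t|haar. (1 + b * circ t) / (1 - b * circ t)) = 1" by simp
    have int: "integrable haar (\<lambda>t. (1 + b * circ t) / (1 - b * circ t))"
    proof (rule integrable_circle_bounded)
      show "norm ((1 + b * circ t) / (1 - b * circ t)) \<le> 2 / (1 - cmod b)" for t
      proof -
        have "cmod (1 + b * circ t) \<le> 2"
          using norm_triangle_ineq[of 1 "b * circ t"] b by (simp add: norm_mult)
        moreover have "1 - cmod b \<le> cmod (1 - b * circ t)"
          using norm_one_minus_ge[of "b * circ t"] by (simp add: norm_mult)
        ultimately show ?thesis using b by (simp add: norm_divide frac_le)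
      qed
    qed measurable
    have "(\<integral>\<^sup>+t. ennreal (Re ((1 + b * circ t) / (1 - b * circ t))) \<partial>haar) =
        ennreal (LINT t|haar. Re ((1 + b * circ t) / (1 - b * circ t)))"
      by (rule nn_integral_eq_integral)
        (use int Re_Cayley_pos[of "b * circ _"] b in \<open>auto simp: norm_mult intro!: less_imp_le\<close>)
    also have "\<dots> = 1" using 1 int by simp
    finally show ?thesis .
  qed
  show "(\<integral>\<^sup>+t. ennreal (Re ((1 + b * circ t) / (1 - b * circ t))) \<partial>haar) = 1"
    by (rule main[OF b])
  have "Re ((1 + b * cnj (circ t)) / (1 - b * cnj (circ t))) = Re ((1 + cnj b * circ t) / (1 - cnj b * circ t))" for t
    using complex_cnj_divide[of "1 + b * cnj (circ t)" "1 - b * cnj (circ t)"]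
    by (metis complex_cnj_add complex_cnj_diff complex_cnj_mult complex_cnj_cnj complex_cnj_one cnj.simps(1))
  then show "(\<integral>\<^sup>+t. ennreal (Re ((1 + b * cnj (circ t)) / (1 - b * cnj (circ t)))) \<partial>haar) = 1"
    using main[of "cnj b"] b by simp
qed

lemma integrable_circle_continuous:
  fixes f :: "complex \<Rightarrow> 'b::{banach, second_countable_topology}"
  assumes "continuous_on (sphere 0 1) f"
  shows "integrable haar (\<lambda>t. f (circ t))"
proof -
  have "compact (f ` sphere 0 1)"
    by (rule compact_continuous_image[OF assms]) simp
  then obtain B where "\<And>y. y \<in> f ` sphere 0 1 \<Longrightarrow> norm y \<le> B"
    by (meson compact_imp_bounded bounded_iff)
  moreover have "continuous_on UNIV (\<lambda>t. f (circ t))"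
    by (rule continuous_on_compose2[OF assms]) (auto intro!: continuous_intros)
  ultimately show ?thesis
    by (intro integrable_circle_bounded[where B=B] borel_measurable_continuous_onI) auto
qed

text \<open>For \<open>u >= 0\<close> the Herglotz integral \<open>H = 2 * cauchy_int u - c\<close>
  takes values in the right half-plane, unless \<open>u\<close> vanishes almost everywhere, so its
  principal \<open>p\<close>-th power is holomorphic. Integrating the pointwise inequality over a
  circle, \<open>Re (H^p)\<close> contributes the nonnegative mean value \<open>c powr p\<close>,
  which is dropped. What remains is the \<open>p\<close>-norm of \<open>Re H\<close>, a Poisson
  integral of \<open>u\<close>.\<close>

lemma riesz_nonneg:
  fixes p :: real
  assumes p: "1 < p" "p \<le> 2"
  shows "\<exists>C\<ge>0. \<forall>a u. cmod a < 1 \<longrightarrow> integrable haar u \<longrightarrow> (\<forall>t. 0 \<le> u t) \<longrightarrow>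
    Lp_int haar p (\<lambda>t. cauchy_int (\<lambda>s. of_real (u s)) (a * circ t))
      \<le> ennreal C * (\<integral>\<^sup>+t. ennreal (u t powr p) \<partial>haar)"
proof -
  obtain A B where AB: "A > 0" "B > 0"
    "\<And>z. Re z > 0 \<Longrightarrow> cmod z powr p + B * Re (z powr of_real p) \<le> A * Re z powr p"
    using riesz_pointwise[OF p] by blast
  have "Lp_int haar p (\<lambda>t. cauchy_int (\<lambda>s. of_real (u s)) (a * circ t))
      \<le> ennreal (A + 1) * (\<integral>\<^sup>+t. ennreal (u t powr p) \<partial>haar)"
    if a: "cmod a < 1" and u: "integrable haar u" and u0: "\<And>t. 0 \<le> u t" for a u
  proof -
    define U where "U = (\<lambda>t. complex_of_real (u t))"
    define c where "c = (LINT t|haar. u t)"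
    define I where "I = (\<integral>\<^sup>+t. ennreal (u t powr p) \<partial>haar)"
    define H where "H = (\<lambda>x. 2 * cauchy_int U x - of_real c)"
    define P where "P = (\<lambda>x t. Re ((1 + x * cnj (circ t)) / (1 - x * cnj (circ t))))"
    have [measurable]: "u \<in> borel_measurable borel"
      using borel_measurable_integrable[OF u] by (simp add: measurable_def)
    have Pm[measurable]: "(\<lambda>t. P x t) \<in> borel_measurable borel" for x unfolding P_def by measurable
    have U: "integrable haar U" using u by (simp add: U_def)
    have holH: "H holomorphic_on ball 0 1"
      unfolding H_def by (intro holomorphic_intros holomorphic_cauchy_int U)
    have H0: "H 0 = of_real c" by (simp add: H_def cauchy_int_0 U_def c_def)
    have c0: "c \<ge> 0" unfolding c_def by (simp add: u0)
    have Ppos: "P x t > 0" if "cmod x < 1" for x t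
      unfolding P_def by (rule Re_Cayley_pos) (use that in \<open>simp add: norm_mult\<close>)
    have ReH: "integrable haar (\<lambda>t. u t * P x t)" "Re (H x) = (LINT t|haar. u t * P x t)"
      if x: "cmod x < 1" for x
    proof -
      have i: "integrable haar (\<lambda>t. 2 * (U t / (1 - x * cnj (circ t))) - U t)"
        using integrable_cauchy_kernel[OF U x] U by (intro Bochner_Integration.integrable_diff integrable_mult_right) auto
      have eq: "2 * (U t / (1 - x * cnj (circ t))) - U t = U t * ((1 + x * cnj (circ t)) / (1 - x * cnj (circ t)))" for t
      proof -
        have "1 - x * cnj (circ t) \<noteq> 0"
          using x by (metis cmod_circ complex_mod_cnj eq_iff_diff_eq_0 less_irrefl mult.right_neutral norm_mult norm_one)
        then show ?thesis by (simp add: field_simps)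
      qed
      have "H x = (LINT t|haar. 2 * (U t / (1 - x * cnj (circ t))) - U t)"
        by (subst Bochner_Integration.integral_diff[OF integrable_mult_right[OF integrable_cauchy_kernel[OF U x]] U])
          (simp only: H_def cauchy_int_def c_def U_def integral_mult_right_zero integral_complex_of_real)
      then have "H x = (LINT t|haar. U t * ((1 + x * cnj (circ t)) / (1 - x * cnj (circ t))))"
        unfolding eq .
      moreover note i' = i[unfolded eq]
      ultimately have "Re (H x) = (LINT t|haar. Re (U t * ((1 + x * cnj (circ t)) / (1 - x * cnj (circ t)))))"
        by simp
      moreover have "integrable haar (\<lambda>t. Re (U t * ((1 + x * cnj (circ t)) / (1 - x * cnj (circ t)))))"
        using i' by (rule integrable_Re)
      moreover have "Re (U t * w) = u t * Re w" for t w by (simp add: U_def)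
      ultimately show "integrable haar (\<lambda>t. u t * P x t)" "Re (H x) = (LINT t|haar. u t * P x t)"
        by (simp_all only: P_def)
    qed
    have acirc: "cmod (a * circ t) < 1" for t using a by (simp add: norm_mult)
    have ReHp: "ennreal (Re (H x) powr p) \<le> (\<integral>\<^sup>+t. ennreal (u t powr p * P x t) \<partial>haar)"
      if x: "cmod x < 1" for x
    proof -
      \<comment> \<open>Jensen with the Poisson kernel as \<open>v\<close> and \<open>u * P\<close>
        as \<open>g\<close>: the powers of the kernel combine to a single factor
        \<open>P\<close>.\<close>
      have "ennreal (Re (H x) powr p) \<le> ennreal (1 powr (p - 1)) *
          (\<integral>\<^sup>+t. ennreal ((u t * P x t) powr p * P x t powr (1 - p)) \<partial>haar)"
      proof (rule Jensen_weighted)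
        show "0 \<le> Re (H x)" unfolding ReH(2)[OF x]
          by (intro integral_nonneg_AE AE_I2 mult_nonneg_nonneg u0 less_imp_le[OF Ppos] x)
        show "ennreal (Re (H x)) \<le> (\<integral>\<^sup>+t. ennreal (u t * P x t) \<partial>haar)"
          unfolding ReH(2)[OF x] using ReH(1)[OF x] u0 Ppos[OF x]
          by (subst nn_integral_eq_integral) (auto intro!: AE_I2 simp: less_imp_le)
        show "(\<integral>\<^sup>+t. ennreal (P x t) \<partial>haar) \<le> ennreal 1"
          unfolding P_def using Cayley_mean(2)[OF x] by simp
      qed (use p u0 Ppos[OF x] in \<open>auto simp: less_imp_le measurable_def[symmetric]\<close>)
      moreover have "(u t * P x t) powr p * P x t powr (1 - p) = u t powr p * P x t" for t
        using u0[of t] Ppos[OF x, of t] by (simp add: powr_mult powr_diff)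
      ultimately show ?thesis by simp
    qed
    have "(\<integral>\<^sup>+t. ennreal (Re (H (a * circ t)) powr p) \<partial>haar) \<le>
        (\<integral>\<^sup>+t. (\<integral>\<^sup>+s. ennreal (u s powr p * P (a * circ t) s) \<partial>haar) \<partial>haar)"
      by (intro nn_integral_mono ReHp acirc)
    also have "\<dots> = (\<integral>\<^sup>+s. (\<integral>\<^sup>+t. ennreal (u s powr p * P (a * circ t) s) \<partial>haar) \<partial>haar)"
      unfolding P_def by (rule circle_pair.Fubini') measurable
    also have "\<dots> = (\<integral>\<^sup>+s. ennreal (u s powr p) * (\<integral>\<^sup>+t. ennreal (P (a * circ t) s) \<partial>haar) \<partial>haar)"
      unfolding P_def by (intro nn_integral_cong) (simp add: ennreal_mult' nn_integral_cmult)
    also have "\<dots> = I"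
    proof -
      have "(\<integral>\<^sup>+t. ennreal (P (a * circ t) s) \<partial>haar) = 1" for s
        using Cayley_mean(1)[of "a * cnj (circ s)"] a by (simp add: P_def norm_mult mult_ac)
      then show ?thesis by (simp add: I_def)
    qed
    finally have ReI: "(\<integral>\<^sup>+t. ennreal (Re (H (a * circ t)) powr p) \<partial>haar) \<le> I" .
    have cI: "ennreal (c powr p) \<le> I"
      using ReHp[of 0] by (simp add: H0 P_def I_def)
    have contH: "continuous_on (sphere 0 1) (\<lambda>x. H (a * x))"
      by (rule continuous_on_compose2[OF holomorphic_on_imp_continuous_on[OF holH]])
        (use a in \<open>auto intro!: continuous_intros simp: norm_mult\<close>)
    have FI: "Lp_int haar p (\<lambda>t. H (a * circ t)) \<le> ennreal A * I"
    \<comment> \<open>If the mean vanishes, so does \<open>u\<close> almost everywhere, and there is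
      no strictly positive real part from which to form the power.\<close>
    proof (cases "c = 0")
      case True
      have "AE t in haar. u t = 0"
        using True integral_nonneg_eq_0_iff_AE[OF u] u0 by (simp add: c_def)
      then have "cauchy_int U x = 0" for x
        unfolding cauchy_int_def U_def by (intro integral_eq_zero_AE) auto
      then show ?thesis by (simp add: H_def True)
    next
      case False
      have Hpos: "Re (H x) > 0" if x: "cmod x < 1" for x
      proof -
        have "Re (H x) \<ge> 0" unfolding ReH(2)[OF x]
          by (intro integral_nonneg_AE AE_I2 mult_nonneg_nonneg u0 less_imp_le[OF Ppos] x)
        moreover have "Re (H x) \<noteq> 0"
        proof
          assume "Re (H x) = 0"
          then have "AE t in haar. u t * P x t = 0"
            using integral_nonneg_eq_0_iff_AE[OF ReH(1)[OF x]] u0 Ppos[OF x]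
            by (simp add: ReH(2)[OF x] less_imp_le)
          then have "AE t in haar. u t = 0"
            by (rule AE_mp) (use Ppos[OF x] in \<open>auto simp: less_le\<close>)
          then have "c = 0" unfolding c_def by (intro integral_eq_zero_AE) auto
          with False show False by simp
        qed
        ultimately show ?thesis by simp
      qed
      define Q where "Q = (\<lambda>x. H x powr of_real p)"
      have holQ: "Q holomorphic_on ball 0 1"
        unfolding Q_def using Hpos
        by (intro holomorphic_on_powr holH holomorphic_intros)
          (metis complex_nonpos_Reals_iff mem_ball_0 not_le)
      \<comment> \<open>For \<open>cmod x < R\<close> the point \<open>a * x\<close> stays in the
        unit disc, where \<open>Q\<close> is holomorphic.\<close>
      define R where "R = (if a = 0 then 2 else 1 / cmod a)"
      have R: "R > 1" using a by (simp add: R_def)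
      have "(LINT t|haar. Q (a * circ t)) = Q (a * 0)"
        by (rule mean_value_circle[OF _ R])
          (rule holomorphic_on_compose_gen[OF _ holQ, unfolded o_def],
           use a in \<open>auto intro!: holomorphic_intros simp: R_def norm_mult field_simps split: if_splits\<close>)
      then have mv: "(LINT t|haar. Q (a * circ t)) = of_real (c powr p)"
        using c0 by (simp add: Q_def H0 powr_of_real)
      have i1: "integrable haar (\<lambda>t. cmod (H (a * circ t)) powr p)"
        by (rule integrable_circle_continuous, rule continuous_on_powr')
          (use p contH in \<open>auto intro!: continuous_intros\<close>)
      have i2: "integrable haar (\<lambda>t. Q (a * circ t))"
        by (rule integrable_circle_continuous)
          (rule continuous_on_compose2[OF holomorphic_on_imp_continuous_on[OF holQ]],
            use a in \<open>auto intro!: continuous_intros simp: norm_mult\<close>)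
      have mv': "(LINT t|haar. Re (Q (a * circ t))) = c powr p"
        using integral_Re[OF i2] mv by simp
      have i3: "integrable haar (\<lambda>t. Re (H (a * circ t)) powr p)"
        by (rule integrable_circle_continuous, rule continuous_on_powr')
          (use p contH less_imp_le[OF Hpos] a in \<open>auto intro!: continuous_intros simp: norm_mult\<close>)
      have "(LINT t|haar. cmod (H (a * circ t)) powr p) + B * c powr p =
          (LINT t|haar. cmod (H (a * circ t)) powr p + B * Re (Q (a * circ t)))"
        using i1 integrable_Re[OF i2] mv' by simp
      also have "\<dots> \<le> (LINT t|haar. A * Re (H (a * circ t)) powr p)"
      proof (rule integral_mono)
        show "cmod (H (a * circ t)) powr p + B * Re (Q (a * circ t)) \<le> A * Re (H (a * circ t)) powr p" for t
          unfolding Q_def by (rule AB(3)[OF Hpos[OF acirc]])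
      qed (intro Bochner_Integration.integrable_add integrable_mult_right integrable_Re i1 i2 i3)+
      also have "\<dots> = A * (LINT t|haar. Re (H (a * circ t)) powr p)"
        by simp
      finally have "(LINT t|haar. cmod (H (a * circ t)) powr p) + B * c powr p \<le>
          A * (LINT t|haar. Re (H (a * circ t)) powr p)" .
      moreover have "B * c powr p \<ge> 0" using AB(2) by simp
      ultimately have "(LINT t|haar. cmod (H (a * circ t)) powr p) \<le>
          A * (LINT t|haar. Re (H (a * circ t)) powr p)"
        by linarith
      then have "ennreal (LINT t|haar. cmod (H (a * circ t)) powr p) \<le>
          ennreal A * ennreal (LINT t|haar. Re (H (a * circ t)) powr p)"
        using AB(1) by (subst ennreal_mult'[symmetric]) (auto intro: ennreal_leI)
      also have "\<dots> \<le> ennreal A * I"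
        using ReI i3 by (intro mult_left_mono) (simp_all add: nn_integral_eq_integral)
      finally show ?thesis using i1 by (simp add: nn_integral_eq_integral)
    qed
    \<comment> \<open>The Cauchy integral is the average of \<open>H\<close> and \<open>c\<close>;
      an average is at most the maximum, so the power of the sum costs no factor.\<close>
    have pt: "cmod (cauchy_int U (a * circ t)) powr p \<le> cmod (H (a * circ t)) powr p + c powr p" for t
    proof -
      have "cauchy_int U (a * circ t) = (H (a * circ t) + of_real c) / 2" by (simp add: H_def)
      then have "cmod (cauchy_int U (a * circ t)) = cmod (H (a * circ t) + of_real c) / 2"
        by (simp only: norm_divide) simp
      then have "cmod (cauchy_int U (a * circ t)) \<le> (cmod (H (a * circ t)) + c) / 2"
        using norm_triangle_ineq[of "H (a * circ t)" "of_real c"] c0 by simp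
      also have "\<dots> \<le> max (cmod (H (a * circ t))) c" by simp
      finally have "cmod (cauchy_int U (a * circ t)) powr p \<le> max (cmod (H (a * circ t))) c powr p"
        using p by (intro powr_mono2) auto
      also have "\<dots> \<le> cmod (H (a * circ t)) powr p + c powr p" by (simp add: max_def)
      finally show ?thesis .
    qed
    have "Lp_int haar p (\<lambda>t. cauchy_int U (a * circ t)) \<le>
        (\<integral>\<^sup>+t. ennreal (cmod (H (a * circ t)) powr p) + ennreal (c powr p) \<partial>haar)"
      using pt by (intro nn_integral_mono) (simp add: ennreal_plus[symmetric] ennreal_leI del: ennreal_plus)
    also have "\<dots> = Lp_int haar p (\<lambda>t. H (a * circ t)) + ennreal (c powr p)"
    proof -
      have "integrable haar (\<lambda>t. cmod (H (a * circ t)) powr p)"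
        by (rule integrable_circle_continuous, rule continuous_on_powr')
          (use p contH in \<open>auto intro!: continuous_intros\<close>)
      then have "(\<lambda>t. cmod (H (a * circ t)) powr p) \<in> borel_measurable haar" by auto
      then show ?thesis by (subst nn_integral_add) auto
    qed
    also have "\<dots> \<le> ennreal A * I + I" by (intro add_mono FI cI)
    also have "\<dots> = ennreal (A + 1) * I" using AB by (simp add: distrib_right)
    finally show ?thesis unfolding I_def U_def .
  qed
  then show ?thesis using AB by (intro exI[of _ "A + 1"]) auto
qed

lemma measurable_haar [simp]: "measurable haar N = measurable borel N"
  by (rule measurable_cong_sets) simp_all

lemma borel_measurable_cauchy_int [measurable]:
  assumes [measurable]: "u \<in> borel_measurable borel"
  shows "(\<lambda>t. cauchy_int u (a * circ t)) \<in> borel_measurable borel"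
proof -
  have "(\<lambda>t. cauchy_int u (a * circ t)) \<in> borel_measurable haar"
    unfolding cauchy_int_def by (rule circle.borel_measurable_lebesgue_integral) measurable
  then show ?thesis by simp
qed

lemma norm_integral_le_nn_integral:
  fixes f :: "'a \<Rightarrow> 'b::{banach, second_countable_topology}"
  shows "ennreal (norm (LINT x|M. f x)) \<le> (\<integral>\<^sup>+x. ennreal (norm (f x)) \<partial>M)"
  by (cases "integrable M f") (auto simp: integral_norm_bound_ennreal not_integrable_integral_eq)

lemma le_one_plus_powr:
  fixes x p :: real
  assumes "1 \<le> p"
  shows "x \<le> 1 + x powr p"
proof (cases "x \<le> 1")
  case True
  then show ?thesis using powr_ge_zero[of x p] by linarith
next
  case False
  then have "x powr 1 \<le> x powr p" using assms by (intro powr_mono) auto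
  then show ?thesis using False by simp
qed

lemma cauchy_int_lincomb:
  assumes "integrable haar f" "integrable haar g" "cmod x < 1"
  shows "cauchy_int (\<lambda>t. f t + c * g t) x = cauchy_int f x + c * cauchy_int g x"
proof -
  have "cauchy_int (\<lambda>t. f t + c * g t) x =
    (LINT y|haar. f y / (1 - x * cnj (circ y)) + c * (g y / (1 - x * cnj (circ y))))"
    unfolding cauchy_int_def by (intro Bochner_Integration.integral_cong) (auto simp: add_divide_distrib)
  also have "\<dots> = cauchy_int f x + c * cauchy_int g x"
    unfolding cauchy_int_def
    by (subst Bochner_Integration.integral_add[OF integrable_cauchy_kernel[OF assms(1,3)]
          integrable_mult_right[OF integrable_cauchy_kernel[OF assms(2,3)]]])
      (simp only: integral_mult_right_zero)
  finally show ?thesis .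
qed

lemma powr_sum4_le:
  fixes p :: real
  assumes "0 \<le> a" "0 \<le> b" "0 \<le> c" "0 \<le> d" "0 < p"
  shows "(a + b + c + d) powr p \<le> 4 powr p * (a powr p + b powr p + c powr p + d powr p)"
proof -
  define m where "m = max (max a b) (max c d)"
  have "(a + b + c + d) powr p \<le> (4 * m) powr p"
    using assms by (intro powr_mono2) (auto simp: m_def)
  also have "\<dots> = 4 powr p * m powr p" using assms by (simp add: powr_mult m_def)
  also have "m powr p \<le> a powr p + b powr p + c powr p + d powr p"
    by (auto simp: m_def max_def)
  finally show ?thesis by simp
qed

abbreviation cauchy_bound :: "real \<Rightarrow> real \<Rightarrow> bool" where
  "cauchy_bound p C \<equiv> (\<forall>a u. cmod a < 1 \<longrightarrow> integrable haar u \<longrightarrow>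
    Lp_int haar p (\<lambda>t. cauchy_int u (a * circ t)) \<le> ennreal C * Lp_int haar p u)"

text \<open>Positive and negative parts of the real and imaginary parts reduce this to nonnegative
  functions, each dominated by \<open>cmod (u t)\<close>. The constant comes from taking the power
  of a sum of four terms.\<close>

lemma riesz_low:
  fixes p :: real
  assumes p: "1 < p" "p \<le> 2"
  shows "\<exists>C\<ge>0. cauchy_bound p C"
proof -
  obtain C where C: "C \<ge> 0" and bound: "\<And>a u. cmod a < 1 \<Longrightarrow> integrable haar u \<Longrightarrow> (\<And>t. 0 \<le> u t) \<Longrightarrow>
    Lp_int haar p (\<lambda>t. cauchy_int (\<lambda>s. of_real (u s)) (a * circ t))
      \<le> ennreal C * (\<integral>\<^sup>+t. ennreal (u t powr p) \<partial>haar)"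
    using riesz_nonneg[OF p] by metis
  have "Lp_int haar p (\<lambda>t. cauchy_int u (a * circ t))
      \<le> ennreal (4 powr p * (C + C + C + C)) * Lp_int haar p u"
    if a: "cmod a < 1" and u: "integrable haar u" for a u
  proof -
    define I where "I = Lp_int haar p u"
    define u1 where "u1 = (\<lambda>t. max 0 (Re (u t)))"
    define u2 where "u2 = (\<lambda>t. max 0 (- Re (u t)))"
    define u3 where "u3 = (\<lambda>t. max 0 (Im (u t)))"
    define u4 where "u4 = (\<lambda>t. max 0 (- Im (u t)))"
    define S where "S = (\<lambda>v t. cauchy_int (\<lambda>s. of_real (v s)) (a * circ t))"
    have i: "integrable haar u1" "integrable haar u2"
        "integrable haar u3" "integrable haar u4"
      unfolding u1_def u2_def u3_def u4_def using u by auto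
    have [measurable]: "u1 \<in> borel_measurable borel" "u2 \<in> borel_measurable borel"
        "u3 \<in> borel_measurable borel" "u4 \<in> borel_measurable borel"
      using i[THEN borel_measurable_integrable] by auto
    have [measurable]: "v \<in> borel_measurable borel \<Longrightarrow> S v \<in> borel_measurable borel" for v
      unfolding S_def by measurable
    have i': "integrable haar (\<lambda>t. complex_of_real (u1 t))" "integrable haar (\<lambda>t. complex_of_real (u2 t))"
        "integrable haar (\<lambda>t. complex_of_real (u3 t))" "integrable haar (\<lambda>t. complex_of_real (u4 t))"
      using i by auto
    have eq: "cauchy_int u (a * circ t) = S u1 t + (-1) * S u2 t + \<i> * S u3 t + (-\<i>) * S u4 t" for t
    proof -
      have x: "cmod (a * circ t) < 1" using a by (simp add: norm_mult)
      have "u = (\<lambda>t. ((complex_of_real (u1 t) + (-1) * complex_of_real (u2 t)) + \<i> * complex_of_real (u3 t)) + (-\<i>) * complex_of_real (u4 t))"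
        by (auto simp: u1_def u2_def u3_def u4_def complex_eq_iff max_def)
      then have "cauchy_int u (a * circ t) = cauchy_int (\<lambda>t. ((complex_of_real (u1 t) + (-1) * complex_of_real (u2 t)) + \<i> * complex_of_real (u3 t)) + (-\<i>) * complex_of_real (u4 t)) (a * circ t)"
        by simp
      also have "\<dots> = S u1 t + (-1) * S u2 t + \<i> * S u3 t + (-\<i>) * S u4 t"
        unfolding S_def using i' x
        by (simp only: cauchy_int_lincomb Bochner_Integration.integrable_add integrable_mult_right)
      finally show ?thesis .
    qed
    have S: "Lp_int haar p (S v) \<le> ennreal C * I"
      if "integrable haar v" "\<And>t. 0 \<le> v t" "\<And>t. v t \<le> cmod (u t)" for v
    proof -
      have "Lp_int haar p (S v) \<le> ennreal C * (\<integral>\<^sup>+t. ennreal (v t powr p) \<partial>haar)"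
        unfolding S_def by (rule bound[OF a that(1,2)])
      also have "\<dots> \<le> ennreal C * I"
        unfolding I_def using that p by (intro mult_left_mono nn_integral_mono ennreal_leI powr_mono2) auto
      finally show ?thesis .
    qed
    have pt: "cmod (cauchy_int u (a * circ t)) powr p \<le> 4 powr p *
      (cmod (S u1 t) powr p + cmod (S u2 t) powr p + cmod (S u3 t) powr p + cmod (S u4 t) powr p)" for t
    proof -
      have "cmod (cauchy_int u (a * circ t)) \<le> cmod (S u1 t) + cmod (S u2 t) + cmod (S u3 t) + cmod (S u4 t)"
        unfolding eq
        by (intro norm_triangle_le add_mono) (auto simp: norm_mult)
      then have "cmod (cauchy_int u (a * circ t)) powr p \<le> (cmod (S u1 t) + cmod (S u2 t) + cmod (S u3 t) + cmod (S u4 t)) powr p"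
        using p by (intro powr_mono2) auto
      also have "\<dots> \<le> 4 powr p *
        (cmod (S u1 t) powr p + cmod (S u2 t) powr p + cmod (S u3 t) powr p + cmod (S u4 t) powr p)"
        using p by (intro powr_sum4_le) auto
      finally show ?thesis .
    qed
    have "Lp_int haar p (\<lambda>t. cauchy_int u (a * circ t)) \<le>
      (\<integral>\<^sup>+t. ennreal (4 powr p) * (ennreal (cmod (S u1 t) powr p) + ennreal (cmod (S u2 t) powr p) +
        ennreal (cmod (S u3 t) powr p) + ennreal (cmod (S u4 t) powr p)) \<partial>haar)"
      using pt by (intro nn_integral_mono) (simp add: ennreal_plus[symmetric] ennreal_mult'[symmetric] ennreal_leI del: ennreal_plus)
    also have "\<dots> = ennreal (4 powr p) * (Lp_int haar p (S u1)
       + Lp_int haar p (S u2)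
       + Lp_int haar p (S u3)
       + Lp_int haar p (S u4))"
      by (simp add: nn_integral_cmult nn_integral_add)
    also have "\<dots> \<le> ennreal (4 powr p) * (ennreal C * I + ennreal C * I + ennreal C * I + ennreal C * I)"
      using i by (intro mult_left_mono add_mono S)
        (auto simp: u1_def u2_def u3_def u4_def abs_Re_le_cmod[THEN abs_le_D1] abs_Re_le_cmod[THEN abs_le_D2]
          abs_Im_le_cmod[THEN abs_le_D1] abs_Im_le_cmod[THEN abs_le_D2])
    also have "\<dots> = ennreal (4 powr p * (C + C + C + C)) * I"
      using C by (simp only: ennreal_mult' ennreal_plus add_nonneg_nonneg powr_ge_zero distrib_right mult.assoc)
    finally show ?thesis unfolding I_def .
  qed
  then show ?thesis using C by (intro exI[of _ "4 powr p * (C + C + C + C)"]) auto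
qed

lemma continuous_cauchy_int_circle:
  assumes "integrable haar u" "cmod a < 1"
  shows "continuous_on (sphere 0 1) (\<lambda>x. cauchy_int u (a * x))"
  by (rule continuous_on_compose2[OF holomorphic_on_imp_continuous_on[OF holomorphic_cauchy_int[OF assms(1)]]])
    (use assms in \<open>auto intro!: continuous_intros simp: norm_mult\<close>)

text \<open>Duality with the conjugate exponent \<open>q <= 2\<close>: testing the Cauchy integral
  of \<open>u\<close> against its extremal function \<open>v\<close> moves the operator onto
  \<open>v\<close>, where the bound for \<open>q\<close> applies. A scaled Young inequality takes
  the place of Hoelder's, and the unknown quantity is absorbed on the left.\<close>

lemma riesz_high:
  fixes p :: real
  assumes p: "2 < p"
  shows "\<exists>C\<ge>0. cauchy_bound p C"
proof -
  define q where "q = p / (p - 1)"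
  have q: "1 < q" "q \<le> 2" "1 / p + 1 / q = 1" "(p - 1) * q = p"
    using p by (auto simp: q_def field_simps)
  obtain C where C: "C \<ge> 0" and bound: "cauchy_bound q C"
    using riesz_low[OF q(1,2)] by blast
  \<comment> \<open>The scaling in Young's inequality, large enough that the dual term has a factor
    \<open>C / (C + 1)\<close> below one.\<close>
  define s where "s = (C + 1) powr (1 / q)"
  have s: "s > 0" using C by (simp add: s_def)
  have sq: "s powr q = C + 1" using C q by (simp add: s_def powr_powr)
  have "Lp_int haar p (\<lambda>t. cauchy_int u (a * circ t))
      \<le> ennreal (s powr p) * Lp_int haar p u"
    if a: "cmod a < 1" and u: "integrable haar u" for a u
  proof -
    define I where "I = Lp_int haar p u"
    define R where "R = (\<lambda>t. cauchy_int u (a * circ t))"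
    \<comment> \<open>The extremal function of the duality pairing: both \<open>R * v\<close> and
      \<open>cmod v powr q\<close> equal \<open>cmod R powr p\<close>.\<close>
    define v where "v = (\<lambda>t. cnj (R t) * of_real (cmod (R t) powr (p - 2)))"
    define S where "S = (\<lambda>y. LINT t|haar. v t / (1 - a * circ t * cnj (circ y)))"
    define J where "J = (LINT t|haar. cmod (R t) powr p)"
    have [measurable]: "u \<in> borel_measurable borel"
      using borel_measurable_integrable[OF u] by simp
    have [measurable]: "R \<in> borel_measurable borel" unfolding R_def by measurable
    have [measurable]: "v \<in> borel_measurable borel" unfolding v_def by measurable
    have cR: "continuous_on (sphere 0 1) (\<lambda>x. cauchy_int u (a * x))"
      by (rule continuous_cauchy_int_circle[OF u a])
    have Jint: "integrable haar (\<lambda>t. cmod (R t) powr p)"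
      unfolding R_def by (rule integrable_circle_continuous, rule continuous_on_powr')
        (use p cR in \<open>auto intro!: continuous_intros\<close>)
    have vint: "integrable haar v"
      unfolding v_def R_def
      by (rule integrable_circle_continuous[of "\<lambda>x. cnj (cauchy_int u (a * x)) * of_real (cmod (cauchy_int u (a * x)) powr (p - 2))"])
        (intro continuous_intros cR continuous_on_powr', use p in auto)
    have Rv: "R t * v t = of_real (cmod (R t) powr p)" for t
    proof (cases "R t = 0")
      case False
      have "R t * v t = of_real ((cmod (R t))\<^sup>2) * of_real (cmod (R t) powr (p - 2))"
        unfolding v_def complex_norm_square by (simp only: mult.assoc)
      also have "\<dots> = of_real (cmod (R t) powr 2 * cmod (R t) powr (p - 2))"
        using False by simp
      also have "cmod (R t) powr 2 * cmod (R t) powr (p - 2) = cmod (R t) powr p"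
        by (simp only: powr_add[symmetric]) simp
      finally show ?thesis .
    qed (use p in \<open>simp add: v_def\<close>)
    have vq: "cmod (v t) powr q = cmod (R t) powr p" for t
    proof (cases "R t = 0")
      case False
      have "cmod (v t) = cmod (R t) powr 1 * cmod (R t) powr (p - 2)"
        using False by (simp add: v_def norm_mult)
      also have "\<dots> = cmod (R t) powr (p - 1)"
        by (simp only: powr_add[symmetric]) simp
      finally show ?thesis using q by (simp add: powr_powr)
    qed (use p in \<open>simp add: v_def\<close>)
    have kern: "1 - cmod a \<le> cmod (1 - a * circ t * cnj (circ y))" for t y
      using norm_one_minus_ge[of "a * circ t * cnj (circ y)"] by (simp add: norm_mult)
    \<comment> \<open>Up to conjugation the transposed operator is again a Cauchy integral, with
      \<open>cnj a\<close> in place of \<open>a\<close>.\<close>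
    have Scnj: "cnj (S y) = cauchy_int (\<lambda>t. cnj (v t)) (cnj a * circ y)" for y
      unfolding S_def cauchy_int_def by (subst Bochner_Integration.integral_cnj[symmetric]) (simp add: mult_ac)
    have Sq: "Lp_int haar q S \<le> ennreal C * ennreal J"
    proof -
      have "cmod (S y) = cmod (cauchy_int (\<lambda>t. cnj (v t)) (cnj a * circ y))" for y
        unfolding Scnj[symmetric] by simp
      then have "Lp_int haar q S \<le>
          ennreal C * Lp_int haar q (\<lambda>t. cnj (v t))"
        using bound[rule_format, of "cnj a" "\<lambda>t. cnj (v t)"] a vint by simp
      also have "Lp_int haar q (\<lambda>t. cnj (v t)) = ennreal J"
        using Jint by (simp add: vq J_def nn_integral_eq_integral)
      finally show ?thesis .
    qed
    have "of_real J = (LINT t|haar. R t * v t)"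
      unfolding Rv J_def by simp
    also have "\<dots> = (LINT t|haar. (LINT y|haar. u y * v t / (1 - a * circ t * cnj (circ y))))"
      unfolding R_def cauchy_int_def by (simp flip: integral_mult_left_zero)
    also have "\<dots> = (LINT y|haar. (LINT t|haar. u y * v t / (1 - a * circ t * cnj (circ y))))"
    proof (rule circle_pair.Fubini_integral[symmetric], rule circle_pair.Fubini_integrable)
      show "case_prod (\<lambda>t y. u y * v t / (1 - a * circ t * cnj (circ y))) \<in> borel_measurable (haar \<Otimes>\<^sub>M haar)"
        by measurable
      have bd: "norm (u y * v t / (1 - a * circ t * cnj (circ y))) \<le> cmod (v t) / (1 - cmod a) * cmod (u y)" for t y
      proof -
        have "norm (u y * v t / (1 - a * circ t * cnj (circ y))) \<le> norm (u y * v t) / (1 - cmod a)"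
          unfolding norm_divide using kern[of t y] a by (intro divide_left_mono mult_pos_pos) auto
        then show ?thesis by (simp add: norm_mult mult_ac)
      qed
      have ii: "integrable haar (\<lambda>y. u y * v t / (1 - a * circ t * cnj (circ y)))" for t
        by (rule Bochner_Integration.integrable_bound[where f="\<lambda>y. cmod (v t) / (1 - cmod a) * cmod (u y)"])
          (use u a in \<open>auto intro!: AE_I2 order_trans[OF bd]\<close>)
      show "AE x in haar. integrable haar
         (\<lambda>y. case (x, y) of (t, y) \<Rightarrow> u y * v t / (1 - a * circ t * cnj (circ y)))"
        using ii by simp
      show "integrable haar (\<lambda>x. LINT y|haar.
          norm (case (x, y) of (t, y) \<Rightarrow> u y * v t / (1 - a * circ t * cnj (circ y))))"
      proof (rule Bochner_Integration.integrable_bound)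
        show "integrable haar (\<lambda>t. cmod (v t) / (1 - cmod a) * (LINT y|haar. cmod (u y)))"
          using vint by simp
        show "(\<lambda>x. LINT y|haar. norm (case (x, y) of (t, y) \<Rightarrow> u y * v t / (1 - a * circ t * cnj (circ y)))) \<in> borel_measurable haar"
          by measurable
        show "AE x in haar. norm (LINT y|haar. norm (case (x, y) of (t, y) \<Rightarrow> u y * v t / (1 - a * circ t * cnj (circ y))))
           \<le> norm (cmod (v x) / (1 - cmod a) * (LINT y|haar. cmod (u y)))"
        proof (rule AE_I2)
          fix t
          have "(LINT y|haar. norm (u y * v t / (1 - a * circ t * cnj (circ y)))) \<le>
             (LINT y|haar. cmod (v t) / (1 - cmod a) * cmod (u y))"
            using ii u bd by (intro integral_mono) auto
          then show "norm (LINT y|haar. norm (case (t, y) of (t, y) \<Rightarrow> u y * v t / (1 - a * circ t * cnj (circ y))))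
           \<le> norm (cmod (v t) / (1 - cmod a) * (LINT y|haar. cmod (u y)))"
            using a by simp
        qed
      qed
    qed
    also have "\<dots> = (LINT y|haar. u y * S y)"
      unfolding S_def by (simp flip: integral_mult_right_zero times_divide_eq_right)
    finally have JS: "complex_of_real J = (LINT y|haar. u y * S y)" .
    have [measurable]: "S \<in> borel_measurable borel"
    proof -
      have "(\<lambda>y. cnj (cauchy_int (\<lambda>t. cnj (v t)) (cnj a * circ y))) \<in> borel_measurable borel" by measurable
      then show ?thesis unfolding Scnj[symmetric] by simp
    qed
    have J0: "J \<ge> 0" by (simp add: J_def)
    have "ennreal J = ennreal (norm (LINT y|haar. u y * S y))"
      using J0 by (simp add: JS[symmetric])
    also have "\<dots> \<le> (\<integral>\<^sup>+y. ennreal (norm (u y * S y)) \<partial>haar)"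
      by (rule norm_integral_le_nn_integral)
    also have "\<dots> \<le> (\<integral>\<^sup>+y. ennreal (s powr p / p) * ennreal (cmod (u y) powr p) +
        ennreal (1 / (q * s powr q)) * ennreal (cmod (S y) powr q) \<partial>haar)"
    proof (rule nn_integral_mono)
      fix y
      have "norm (u y * S y) = (s * cmod (u y)) * (cmod (S y) / s)"
        using s by (simp add: norm_mult)
      also have "\<dots> \<le> (s * cmod (u y)) powr p / p + (cmod (S y) / s) powr q / q"
        by (rule Youngs_inequality) (use p q s in auto)
      also have "\<dots> = s powr p / p * cmod (u y) powr p + 1 / (q * s powr q) * cmod (S y) powr q"
        using s by (simp add: powr_mult powr_divide)
      finally show "ennreal (norm (u y * S y)) \<le> ennreal (s powr p / p) * ennreal (cmod (u y) powr p) +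
        ennreal (1 / (q * s powr q)) * ennreal (cmod (S y) powr q)"
        using p q by (simp add: ennreal_plus[symmetric] ennreal_mult'[symmetric] ennreal_leI del: ennreal_plus)
    qed
    also have "\<dots> = ennreal (s powr p / p) * I +
        ennreal (1 / (q * s powr q)) * Lp_int haar q S"
      by (simp add: nn_integral_add nn_integral_cmult I_def)
    also have "\<dots> \<le> ennreal (s powr p / p) * I + ennreal (1 / (q * s powr q)) * (ennreal C * ennreal J)"
      by (intro add_mono mult_left_mono Sq) auto
    finally have main: "ennreal J \<le> ennreal (s powr p / p) * I + ennreal (1 / (q * s powr q)) * (ennreal C * ennreal J)" .
    have "ennreal J \<le> ennreal (s powr p) * I"
    proof (cases I)
      case (real i)
      have nn: "0 \<le> s powr p / p" "0 \<le> 1 / (q * s powr q)" "0 \<le> C * J" using p q C J0 by auto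
      have "ennreal (s powr p / p) * ennreal i + ennreal (1 / (q * s powr q)) * (ennreal C * ennreal J) =
          ennreal (s powr p / p * i + 1 / (q * s powr q) * (C * J))"
        using nn real(1) C by (simp only: ennreal_mult' ennreal_plus mult_nonneg_nonneg)
      then have "ennreal J \<le> ennreal (s powr p / p * i + 1 / (q * s powr q) * (C * J))"
        using main unfolding real(2) by (simp only:)
      moreover have "0 \<le> s powr p / p * i + 1 / (q * s powr q) * (C * J)"
        by (intro add_nonneg_nonneg mult_nonneg_nonneg[OF nn(1) real(1)] mult_nonneg_nonneg[OF nn(2,3)])
      ultimately have "J \<le> s powr p / p * i + 1 / (q * s powr q) * (C * J)"
        by (simp only: ennreal_le_iff)
      \<comment> \<open>The dual term may be subtracted because \<open>J\<close> is finite: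
        \<open>R\<close> comes from a function continuous on the circle, as
        \<open>a * circ t\<close> stays inside the disc.\<close>
      also have "1 / (q * s powr q) * (C * J) \<le> J / q"
      proof -
        have "1 / (q * s powr q) * (C * J) = C / (C + 1) * (J / q)" by (simp add: sq)
        also have "\<dots> \<le> 1 * (J / q)"
          using C J0 q by (intro mult_right_mono) auto
        finally show ?thesis by simp
      qed
      finally have "J * (1 - 1 / q) \<le> s powr p / p * i" by (simp add: algebra_simps)
      moreover have "1 - 1 / q = 1 / p" using q(3) by simp
      ultimately have "J \<le> s powr p * i" using p by (simp add: field_simps)
      then show ?thesis using real by (simp add: ennreal_mult'[symmetric] ennreal_leI)
    next
      case top
      then show ?thesis using s by (simp add: ennreal_mult_top)
    qed
    then show ?thesis
      using Jint unfolding I_def J_def R_def by (simp add: nn_integral_eq_integral)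
  qed
  then show ?thesis by (intro exI[of _ "s powr p"]) auto
qed

lemma riesz_bound:
  fixes p :: real
  assumes "1 < p"
  shows "\<exists>C\<ge>0. cauchy_bound p C"
  using riesz_low[OF assms] riesz_high[of p] by (cases "p \<le> 2") auto

lemma norm_suminf_le_ennreal:
  fixes f :: "nat \<Rightarrow> 'b::banach"
  assumes f: "summable f" and fg: "\<And>n. norm (f n) \<le> g n"
  shows "ennreal (norm (\<Sum>n. f n)) \<le> (\<Sum>n. ennreal (g n))"
proof (rule LIMSEQ_le_const2)
  show "(\<lambda>n. ennreal (norm (\<Sum>i<n. f i))) \<longlonglongrightarrow> ennreal (norm (\<Sum>n. f n))"
    by (intro tendsto_ennrealI tendsto_norm summable_LIMSEQ f)
  have "ennreal (norm (\<Sum>i<n. f i)) \<le> (\<Sum>n. ennreal (g n))" for n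
  proof -
    have g0: "0 \<le> g i" for i using fg[of i] norm_ge_zero[of "f i"] by linarith
    have "norm (\<Sum>i<n. f i) \<le> (\<Sum>i<n. g i)" by (rule sum_norm_le) (rule fg)
    then have "ennreal (norm (\<Sum>i<n. f i)) \<le> (\<Sum>i<n. ennreal (g i))"
      using g0 by (simp add: sum_ennreal ennreal_leI)
    also have "\<dots> \<le> (\<Sum>n. ennreal (g n))" by (rule sum_le_suminf) auto
    finally show ?thesis .
  qed
  then show "\<exists>N. \<forall>n\<ge>N. ennreal (norm (\<Sum>i<n. f i)) \<le> (\<Sum>n. ennreal (g n))" by blast
qed

section \<open>Multipliers with monotone coefficients\<close>

definition pker :: "(nat \<Rightarrow> real) \<Rightarrow> complex \<Rightarrow> complex" where
  "pker c w = (\<Sum>n. of_real (c n) * w ^ n)"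

text \<open>
  Abel summation turns the kernel into a superposition of modulated Cauchy kernels; as \<open>c\<close> is
  increasing, the total mass of the coefficients is at most \<open>2 (1 - y) \<Sum>c\<^sub>n y\<^sup>n\<close>.
\<close>
lemma multiplier_bound:
  fixes p :: real
  assumes p: "1 < p"
  shows "\<exists>C\<ge>0. \<forall>c y b u. (\<forall>n. 0 < c n) \<longrightarrow> mono c \<longrightarrow> 0 < y \<longrightarrow> y < 1 \<longrightarrow> summable (\<lambda>n. c n * y ^ n) \<longrightarrow>
    cmod b < 1 \<longrightarrow> integrable haar u \<longrightarrow>
    Lp_int haar p (\<lambda>t. LINT s|haar. u s * pker c (of_real y * b * circ t * cnj (circ s)))
      \<le> ennreal (C * ((1 - y) * (\<Sum>n. c n * y ^ n)) powr p) * Lp_int haar p u"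
proof -
  obtain C where C: "C \<ge> 0" and bound: "cauchy_bound p C"
    using riesz_bound[OF p] by blast
  have "Lp_int haar p (\<lambda>t. LINT s|haar. u s * pker c (of_real y * b * circ t * cnj (circ s)))
      \<le> ennreal ((C * 2 powr p) * ((1 - y) * (\<Sum>n. c n * y ^ n)) powr p) * Lp_int haar p u"
    if c: "\<And>n. 0 < c n" "mono c" and y: "0 < y" "y < 1" and sm: "summable (\<lambda>n. c n * y ^ n)"
      and b: "cmod b < 1" and u: "integrable haar u" for c y b u
  proof -
    let ?M = "\<lambda>t. LINT s|haar. u s * pker c (of_real y * b * circ t * cnj (circ s))"
    define I where "I = Lp_int haar p u"
    define S where "S = (\<Sum>n. c n * y ^ n)"
    \<comment> \<open>The Taylor coefficients in \<open>x\<close> of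
      \<open>(1 - x) * pker c (y * x)\<close>.\<close>
    define d where "d = (\<lambda>j. c j * y ^ j - (if j = 0 then 0 else c (j - 1) * y ^ (j - 1)))"
    \<comment> \<open>A difference \<open>d j\<close> is the growth of \<open>c\<close> minus the
      decay of \<open>y ^ j\<close>; here the two are added instead. The sum telescopes to
      \<open>2 * (1 - y) * S\<close>. Positivity of \<open>c\<close> makes every \<open>v j\<close>
      positive, as Jensen's inequality demands.\<close>
    define v where "v = (\<lambda>j. if j = 0 then c 0 else (c j - c (j - 1)) * y ^ j + c (j - 1) * (1 - y) * y ^ (j - 1))"
    have [measurable]: "u \<in> borel_measurable borel"
      using borel_measurable_integrable[OF u] by simp
    have vpos: "v j > 0" for j
    proof (cases j)
      case (Suc i)
      have "c i \<le> c (Suc i)" using c(2) by (simp add: monoD)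
      then show ?thesis using c(1)[of i] y by (simp add: v_def Suc add_nonneg_pos)
    qed (use c in \<open>simp add: v_def\<close>)
    have dv: "\<bar>d j\<bar> \<le> v j" for j
    proof (cases j)
      case (Suc i)
      have "c i \<le> c (Suc i)" using c(2) by (simp add: monoD)
      then have 1: "0 \<le> (c (Suc i) - c i) * y ^ Suc i" using y by simp
      have 2: "0 \<le> c i * (1 - y) * y ^ i" using c(1)[of i] y by simp
      have "d j = (c (Suc i) - c i) * y ^ Suc i - c i * (1 - y) * y ^ i"
        by (simp add: d_def Suc algebra_simps)
      then show ?thesis using 1 2 by (simp add: v_def Suc abs_if)
    qed (use c(1)[of 0] in \<open>simp add: d_def v_def\<close>)
    have Ssums: "(\<lambda>n. c n * y ^ n) sums S" using sm by (simp add: S_def summable_sums)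
    have vsums: "v sums (2 * ((1 - y) * S))"
    proof -
      have 1: "(\<lambda>i. c (Suc i) * y ^ Suc i) sums (S - c 0)"
        using Ssums by (subst sums_Suc_iff) simp
      have 2: "(\<lambda>i. (1 - 2 * y) * (c i * y ^ i)) sums ((1 - 2 * y) * S)"
        by (rule sums_mult[OF Ssums])
      have "(\<lambda>i. v (Suc i)) sums (S - c 0 + (1 - 2 * y) * S)"
        using sums_add[OF 1 2] by (rule sums_cong[THEN iffD1, rotated]) (auto simp: v_def algebra_simps)
      then have "v sums (S - c 0 + (1 - 2 * y) * S + v 0)" by (rule sums_Suc)
      then show ?thesis by (simp add: v_def algebra_simps)
    qed
    have vsummable: "summable v" using vsums by (rule sums_summable)
    have Spos: "S > 0" unfolding S_def using c y by (intro suminf_pos sm) auto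
    define V where "V = 2 * ((1 - y) * S)"
    have Vpos: "V > 0" using Spos y by (simp add: V_def)
    \<comment> \<open>Of the factor \<open>x ^ j\<close>, the power of \<open>cnj (circ s)\<close>
      joins \<open>u\<close> without changing its modulus, so every \<open>G j\<close> has the same
      norm bound; the rest has modulus at most one and leaves the integral.\<close>
    define G where "G = (\<lambda>j t. cauchy_int (\<lambda>s. u s * cnj (circ s) ^ j) (b * circ t))"
    have ui: "integrable haar (\<lambda>s. u s * cnj (circ s) ^ j)" for j
      by (rule Bochner_Integration.integrable_bound[OF u]) (auto simp: norm_mult norm_power)
    have [measurable]: "G j \<in> borel_measurable borel" for j
      unfolding G_def by measurable
    have GI: "Lp_int haar p (G j) \<le> ennreal C * I" for j
      using bound[rule_format, OF b ui[of j]] by (simp add: G_def I_def norm_mult norm_power)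
    have pk: "(\<lambda>j. of_real (d j) * x ^ j) sums ((1 - x) * pker c (of_real y * x))"
      if x: "cmod x < 1" for x
    proof -
      have sm1: "summable (\<lambda>n. complex_of_real (c n) * (of_real y * x) ^ n)"
      proof (rule summable_comparison_test'[OF sm])
        show "norm (complex_of_real (c n) * (of_real y * x) ^ n) \<le> c n * y ^ n" for n
          using c(1)[of n] y x power_le_one[of "cmod x" n]
          by (simp add: norm_mult norm_power power_mult_distrib mult_left_le)
      qed
      then have 1: "(\<lambda>n. complex_of_real (c n) * (of_real y * x) ^ n) sums pker c (of_real y * x)"
        unfolding pker_def by (rule summable_sums)
      have "(\<lambda>n. x * (complex_of_real (c n) * (of_real y * x) ^ n)) sums (x * pker c (of_real y * x))"
        by (rule sums_mult[OF 1])
      then have 2: "(\<lambda>j. case j of 0 \<Rightarrow> 0 | Suc n \<Rightarrow> x * (complex_of_real (c n) * (of_real y * x) ^ n)) sums (x * pker c (of_real y * x))"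
        using sums_Suc[of "\<lambda>j. case j of 0 \<Rightarrow> 0 | Suc n \<Rightarrow> x * (complex_of_real (c n) * (of_real y * x) ^ n)"] by simp
      have "complex_of_real (c j) * (of_real y * x) ^ j -
          (case j of 0 \<Rightarrow> 0 | Suc n \<Rightarrow> x * (complex_of_real (c n) * (of_real y * x) ^ n)) = of_real (d j) * x ^ j" for j
        by (auto simp: d_def algebra_simps power_mult_distrib split: nat.split)
      then show ?thesis using sums_diff[OF 1 2] by (simp add: algebra_simps)
    qed
    have X: "ennreal (cmod (?M t))
        \<le> (\<integral>\<^sup>+j. ennreal (v j * cmod (G j t)) \<partial>count_space UNIV)" for t
    proof -
      define x where "x = (\<lambda>s. b * circ t * cnj (circ s))"
      have x: "cmod (x s) = cmod b" for s by (simp add: x_def norm_mult)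
      have x1: "cmod (x s) < 1" for s using b by (simp add: x)
      have x2: "1 - cmod b \<le> cmod (1 - x s)" for s using norm_one_minus_ge[of "x s"] by (simp add: x)
      have x3: "1 - x s \<noteq> 0" for s using x2[of s] b by auto
      have xm[measurable]: "x \<in> borel_measurable borel" unfolding x_def by measurable
      define f where "f = (\<lambda>j s. u s * (of_real (d j) * x s ^ j) / (1 - x s))"
      have fb: "norm (f j s) \<le> v j / (1 - cmod b) * cmod (u s)" for j s
      proof -
        have "norm (f j s) = cmod (u s) * (\<bar>d j\<bar> * cmod b ^ j) / cmod (1 - x s)"
          by (simp add: f_def norm_mult norm_divide norm_power x)
        also have "\<dots> \<le> cmod (u s) * (v j * 1) / (1 - cmod b)"
          using b x2[of s] dv[of j] vpos[of j]
          by (intro frac_le mult_mono mult_nonneg_nonneg power_le_one) auto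
        finally show ?thesis by (simp add: mult_ac)
      qed
      have fi: "integrable haar (f j)" for j
      proof (rule Bochner_Integration.integrable_bound)
        show "integrable haar (\<lambda>s. v j / (1 - cmod b) * cmod (u s))" using u by simp
        show "f j \<in> borel_measurable haar" unfolding f_def by measurable
        show "AE s in haar. norm (f j s) \<le> norm (v j / (1 - cmod b) * cmod (u s))"
          using b vpos[of j] by (intro AE_I2 order_trans[OF fb]) simp
      qed
      have fsum: "(\<lambda>j. f j s) sums (u s * pker c (of_real y * b * circ t * cnj (circ s)))" for s
      proof -
        have "(\<lambda>j. (u s / (1 - x s)) * (of_real (d j) * x s ^ j)) sums
            ((u s / (1 - x s)) * ((1 - x s) * pker c (of_real y * x s)))"
          by (rule sums_mult[OF pk[OF x1]])
        then show ?thesis using x3[of s] by (simp add: f_def x_def mult_ac)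
      qed
      have "(\<lambda>j. LINT s|haar. f j s) sums (LINT s|haar. (\<Sum>j. f j s))"
      proof (rule sums_integral[OF fi])
        show "AE s in haar. summable (\<lambda>j. norm (f j s))"
        proof (rule AE_I2)
          show "summable (\<lambda>j. norm (f j s))" for s
            by (rule summable_comparison_test'[where g="\<lambda>j. v j / (1 - cmod b) * cmod (u s)"])
              (use fb vsummable in \<open>auto intro!: summable_mult2 summable_divide\<close>)
        qed
        show "summable (\<lambda>j. LINT s|haar. norm (f j s))"
        proof (rule summable_comparison_test')
          show "summable (\<lambda>j. v j / (1 - cmod b) * (LINT s|haar. cmod (u s)))"
            using vsummable by (intro summable_mult2 summable_divide)
          show "norm (LINT s|haar. norm (f j s)) \<le> v j / (1 - cmod b) * (LINT s|haar. cmod (u s))" for j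
          proof -
            have "(LINT s|haar. norm (f j s)) \<le> (LINT s|haar. v j / (1 - cmod b) * cmod (u s))"
              using fi u fb by (intro integral_mono) auto
            then show ?thesis by simp
          qed
        qed
      qed
      moreover have "(\<Sum>j. f j s) = u s * pker c (of_real y * b * circ t * cnj (circ s))" for s
        using fsum by (simp add: sums_iff)
      moreover have "(LINT s|haar. f j s) = of_real (d j) * (b * circ t) ^ j * G j t" for j
        unfolding G_def cauchy_int_def integral_mult_right_zero[symmetric]
        by (intro Bochner_Integration.integral_cong) (auto simp: f_def x_def power_mult_distrib mult_ac)
      ultimately have s: "(\<lambda>j. of_real (d j) * (b * circ t) ^ j * G j t) sums
          (?M t)"
        by simp
      have nb: "norm (of_real (d j) * (b * circ t) ^ j * G j t) \<le> v j * cmod (G j t)" for j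
      proof -
        have "\<bar>d j\<bar> * cmod b ^ j \<le> v j * 1"
          using b dv[of j] by (intro mult_mono power_le_one) auto
        then show ?thesis by (simp add: norm_mult norm_power mult_right_mono)
      qed
      have "ennreal (norm (\<Sum>j. of_real (d j) * (b * circ t) ^ j * G j t)) \<le> (\<Sum>j. ennreal (v j * cmod (G j t)))"
        by (rule norm_suminf_le_ennreal[OF sums_summable[OF s] nb])
      then show ?thesis using s by (simp add: sums_iff nn_integral_count_space_nat)
    qed
    have pt: "ennreal (cmod (?M t) powr p)
        \<le> ennreal (V powr (p - 1)) * (\<Sum>j. ennreal (v j) * ennreal (cmod (G j t) powr p))" for t
    proof -
      have "ennreal (cmod (?M t) powr p)
        \<le> ennreal (V powr (p - 1)) * (\<integral>\<^sup>+j. ennreal ((v j * cmod (G j t)) powr p * v j powr (1 - p)) \<partial>count_space UNIV)"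
      proof (rule Jensen_weighted[OF p])
        show "(\<integral>\<^sup>+j. ennreal (v j) \<partial>count_space UNIV) \<le> ennreal V"
          using vsums vpos
          by (simp add: nn_integral_count_space_nat suminf_ennreal_eq[OF less_imp_le] V_def)
      qed (use X vpos Vpos in \<open>auto simp: less_imp_le\<close>)
      also have "(\<integral>\<^sup>+j. ennreal ((v j * cmod (G j t)) powr p * v j powr (1 - p)) \<partial>count_space UNIV) =
          (\<Sum>j. ennreal (v j) * ennreal (cmod (G j t) powr p))"
      proof -
        have "(v j * cmod (G j t)) powr p * v j powr (1 - p) = v j * cmod (G j t) powr p" for j
          using vpos[of j] by (simp add: powr_mult powr_diff)
        then show ?thesis
          using vpos by (simp add: nn_integral_count_space_nat ennreal_mult' less_imp_le)
      qed
      finally show ?thesis .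
    qed
    have "Lp_int haar p ?M
      \<le> (\<integral>\<^sup>+t. ennreal (V powr (p - 1)) * (\<Sum>j. ennreal (v j) * ennreal (cmod (G j t) powr p)) \<partial>haar)"
      by (intro nn_integral_mono pt)
    also have "\<dots> = ennreal (V powr (p - 1)) * (\<Sum>j. ennreal (v j) * Lp_int haar p (G j))"
      by (simp add: nn_integral_cmult nn_integral_suminf)
    also have "\<dots> \<le> ennreal (V powr (p - 1)) * (\<Sum>j. ennreal (v j) * (ennreal C * I))"
      by (intro mult_left_mono suminf_le GI) auto
    also have "(\<Sum>j. ennreal (v j) * (ennreal C * I)) = ennreal V * (ennreal C * I)"
      using vsums vpos by (simp add: suminf_ennreal_eq[OF less_imp_le] V_def)
    also have "ennreal (V powr (p - 1)) * (ennreal V * (ennreal C * I)) = ennreal (C * V powr p) * I"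
    proof -
      have "V powr p = V powr (p - 1) * V" using Vpos by (simp add: powr_diff)
      then show ?thesis using Vpos C by (simp add: ennreal_mult' mult_ac)
    qed
    also have "C * V powr p = (C * 2 powr p) * ((1 - y) * S) powr p"
      using y Spos by (simp add: V_def powr_mult)
    finally show ?thesis unfolding I_def S_def .
  qed
  then show ?thesis using C by (intro exI[of _ "C * 2 powr p"]) (auto simp: less_imp_le)
qed

section \<open>Doubling weights\<close>

text \<open>Summation by parts lowers the exponent by one at the cost of a factor
  \<open>Suc N / (1 - y)\<close>; the boundary term has a favourable sign. Partial sums are used so
  that summability can later be deduced from the bound.\<close>

lemma sum_power_geometric_le:
  fixes y :: real
  assumes y: "0 \<le> y" "y < 1"
  shows "(\<Sum>j<n. (real j + 1) ^ N * y ^ j) \<le> fact N / (1 - y) ^ (N + 1)"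
proof (induction N)
  case 0
  have "(\<Sum>j<n. y ^ j) = (1 - y ^ n) / (1 - y)"
    using y by (simp add: sum_gp_strict)
  also have "\<dots> \<le> 1 / (1 - y)" using y by (intro divide_right_mono) auto
  finally show ?case by simp
next
  case (Suc N)
  have step: "(1 - y) * (\<Sum>j<n. (real j + 1) ^ Suc N * y ^ j) =
      (\<Sum>j<n. ((real j + 1) ^ Suc N - real j ^ Suc N) * y ^ j) - real n ^ Suc N * y ^ n" for n
    by (induction n) (auto simp: algebra_simps)
  have diff: "(real j + 1) ^ Suc N - real j ^ Suc N \<le> real (Suc N) * (real j + 1) ^ N" for j
  proof -
    have "(real j + 1) ^ Suc N - real j ^ Suc N = (\<Sum>i<Suc N. (real j + 1) ^ i * real j ^ (N - i))"
      using power_diff_sumr2[of "real j + 1" "Suc N" "real j"] by (simp add: mult.commute)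
    also have "\<dots> \<le> (\<Sum>i<Suc N. (real j + 1) ^ i * (real j + 1) ^ (N - i))"
      by (intro sum_mono mult_left_mono power_mono) auto
    also have "\<dots> = (\<Sum>i<Suc N. (real j + 1) ^ N)"
      by (intro sum.cong) (auto simp flip: power_add)
    finally show ?thesis by simp
  qed
  have "(1 - y) * (\<Sum>j<n. (real j + 1) ^ Suc N * y ^ j) \<le>
      (\<Sum>j<n. ((real j + 1) ^ Suc N - real j ^ Suc N) * y ^ j)"
    unfolding step using y by simp
  also have "\<dots> \<le> (\<Sum>j<n. real (Suc N) * (real j + 1) ^ N * y ^ j)"
    using y by (intro sum_mono mult_right_mono diff) auto
  also have "\<dots> = real (Suc N) * (\<Sum>j<n. (real j + 1) ^ N * y ^ j)"
    by (simp add: sum_distrib_left mult.assoc)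
  also have "\<dots> \<le> real (Suc N) * (fact N / (1 - y) ^ (N + 1))"
    by (intro mult_left_mono Suc) auto
  finally have "(\<Sum>j<n. (real j + 1) ^ Suc N * y ^ j) \<le> real (Suc N) * (fact N / (1 - y) ^ (N + 1)) / (1 - y)"
    using y by (subst pos_le_divide_eq) (auto simp only: mult.commute diff_gt_0_iff_gt)
  also have "\<dots> = fact (Suc N) / (1 - y) ^ (Suc N + 1)"
    using y by (simp add: field_simps)
  finally show ?case .
qed

lemma power_mult_exp_minus_le:
  fixes T :: real
  assumes "0 \<le> T" "0 < M"
  shows "T ^ M * exp (- T) \<le> real M ^ M"
proof -
  have "T / real M \<le> exp (T / real M)" using exp_ge_add_one_self[of "T / real M"] by linarith
  then have "(T / real M) ^ M \<le> exp (T / real M) ^ M" using assms by (intro power_mono) auto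
  also have "\<dots> = exp T" using assms by (simp flip: exp_of_nat_mult)
  finally have "T ^ M \<le> real M ^ M * exp T" using assms by (simp add: power_divide field_simps)
  then show ?thesis by (simp add: exp_minus field_simps)
qed

section \<open>The tail integral of a Borel weight as a change of variable\<close>

locale borel_weight =
  fixes w :: "real \<Rightarrow> real"
  assumes w_borel [measurable]: "w \<in> borel_measurable borel"
    and w_nonneg: "0 \<le> w s"
    and w_outside: "s \<notin> {0..<1} \<Longrightarrow> w s = 0"
    and w_integrable: "integrable lborel w"
begin

text \<open>Because \<open>w\<close> vanishes off \<open>[0,1)\<close>, the half-line integral is
  the tail on \<open>[0,1)\<close>, constant to the left and zero to the right; it is thus monotone
  on the whole real line.\<close>

definition W :: "real \<Rightarrow> real" where "W r = (LINT s:{r..}|lborel. w s)"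

lemma W_integrable: "set_integrable lborel {r..} w"
  by (rule set_integrable_subset[of lborel UNIV]) (use w_integrable in \<open>auto simp: set_integrable_def\<close>)

lemma nn_integral_W: "(\<integral>\<^sup>+s. ennreal (w s) * indicator {r..} s \<partial>lborel) = ennreal (W r)"
proof -
  have "(\<integral>\<^sup>+s. ennreal (w s) * indicator {r..} s \<partial>lborel) = (\<integral>\<^sup>+s. ennreal (indicator {r..} s *\<^sub>R w s) \<partial>lborel)"
    by (intro nn_integral_cong) (auto split: split_indicator)
  also have "\<dots> = ennreal (W r)"
    unfolding W_def set_lebesgue_integral_def
    by (rule nn_integral_eq_integral) (use W_integrable w_nonneg in \<open>auto simp: set_integrable_def\<close>)
  finally show ?thesis .
qed

lemma W_nonneg: "0 \<le> W r"
  unfolding W_def set_lebesgue_integral_def by (rule integral_nonneg_AE) (auto simp: w_nonneg)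

lemma W_antimono: "r \<le> s \<Longrightarrow> W s \<le> W r"
  unfolding W_def set_lebesgue_integral_def
  using W_integrable w_nonneg
  by (intro integral_mono) (auto simp: set_integrable_def split: split_indicator)

lemma W_ge_1: "1 \<le> r \<Longrightarrow> W r = 0"
  unfolding W_def set_lebesgue_integral_def
  by (rule integral_eq_zero_AE) (auto simp: w_outside split: split_indicator)

lemma W_neg: "r \<le> 0 \<Longrightarrow> W r = W 0"
  unfolding W_def set_lebesgue_integral_def
  by (intro Bochner_Integration.integral_cong) (auto simp: w_outside split: split_indicator)

lemma W_le_W0: "W r \<le> W 0"
  using W_antimono[of 0 r] W_neg[of r] by (cases "r \<le> 0") auto

lemma W_measurable [measurable]: "W \<in> borel_measurable borel"
proof -
  have "(\<lambda>x. - W x) \<in> borel_measurable borel"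
    by (rule borel_measurable_mono) (auto simp: mono_def W_antimono)
  then have "(\<lambda>x. - (- W x)) \<in> borel_measurable borel" by measurable
  then show ?thesis by simp
qed

lemma W_continuous: "continuous_on {0..1} W"
proof -
  have i: "set_integrable lborel {r..1} w" for r
    by (rule set_integrable_subset[OF W_integrable[of r]]) auto
  have "W r = integral {r..1} w" if "r \<in> {0..1}" for r
  proof -
    have "W r = (LINT s:{r..1}|lborel. w s)"
      unfolding W_def set_lebesgue_integral_def
      by (intro Bochner_Integration.integral_cong) (auto simp: w_outside split: split_indicator)
    also have "\<dots> = integral {r..1} w" by (rule set_borel_integral_eq_integral(2)[OF i])
    finally show ?thesis .
  qed
  moreover have "continuous_on {0..1} (\<lambda>r. integral {r..1} w)"
    by (rule indefinite_integral_continuous_1') (rule set_borel_integral_eq_integral(1)[OF i])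
  ultimately show ?thesis by (subst continuous_on_cong[OF refl]) auto
qed

text \<open>The substitution \<open>u = W s\<close> without differentiating \<open>W\<close>, which
  may have flat pieces: for \<open>0 <= a < W 0\<close> the set \<open>W <= a\<close> is the
  half-line from the first \<open>r\<close> with \<open>W r = a\<close>, and its mass is
  \<open>W r = a\<close> by definition.\<close>

lemma distr_W: "distr (density lborel (\<lambda>s. ennreal (w s))) borel W = density lborel (indicator {0..W 0})"
  (is "?M = ?N")
proof -
  define \<nu> where "\<nu> = density lborel (\<lambda>s. ennreal (w s))"
  have \<nu>: "emeasure \<nu> {r..} = ennreal (W r)" for r
    unfolding \<nu>_def by (subst emeasure_density) (auto simp: nn_integral_W)
  have N: "emeasure ?N {..a} = ennreal (min a (W 0))" if "0 \<le> a" for a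
  proof -
    have "indicator {0..W 0} s * indicator {..a} s = (indicator {0..min a (W 0)} s :: ennreal)" for s
      by (auto split: split_indicator)
    then have "emeasure ?N {..a} = emeasure lborel {0..min a (W 0)}"
      by (subst emeasure_density) simp_all
    then show ?thesis using that W_nonneg by simp
  qed
  have M: "emeasure ?M {..a} = emeasure ?N {..a}" for a
  proof -
    have M1: "emeasure ?M {..a} = emeasure \<nu> {s. W s \<le> a}"
      unfolding \<nu>_def by (subst emeasure_distr) (auto simp: vimage_def)
    consider "a < 0" | "a \<ge> W 0" "a \<ge> 0" | "0 \<le> a" "a < W 0" by linarith
    then show ?thesis
    proof cases
      case 1
      then have "{s. W s \<le> a} = {}" using W_nonneg by (auto simp: not_le intro: less_le_trans)
      moreover have eq0: "(indicator {0..W 0} s :: ennreal) * indicator {..a} s = 0" for s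
        using 1 by (auto split: split_indicator)
      have "emeasure ?N {..a} = (\<integral>\<^sup>+s. indicator {0..W 0} s * indicator {..a} s \<partial>lborel)"
        by (rule emeasure_density) auto
      then have "emeasure ?N {..a} = 0" by (simp only: eq0 nn_integral_const mult_zero_left)
      ultimately show ?thesis using M1 by simp
    next
      case 2
      then have "{s. W s \<le> a} = UNIV" using W_le_W0 by (auto intro: order_trans)
      moreover have "emeasure \<nu> UNIV = emeasure \<nu> {0..}"
        unfolding \<nu>_def by (subst (1 2) emeasure_density)
          (auto intro!: nn_integral_cong simp: w_outside split: split_indicator)
      ultimately show ?thesis using M1 \<nu> N 2 by simp
    next
      case 3
      \<comment> \<open>Its infimum is attained by continuity of \<open>W\<close>, and the
        intermediate value theorem shows that \<open>W\<close> equals \<open>a\<close>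
        there.\<close>
      define A where "A = {s \<in> {0..1}. W s \<le> a}"
      define r where "r = Inf A"
      have A1: "1 \<in> A" using 3 by (simp add: A_def W_ge_1)
      have clA: "closed A"
      proof -
        have "closed ({0..1} \<inter> W -` {..a})" by (rule continuous_closed_preimage[OF W_continuous]) auto
        moreover have "A = {0..1} \<inter> W -` {..a}" by (auto simp: A_def)
        ultimately show ?thesis by simp
      qed
      have bA: "bdd_below A" by (rule bdd_belowI[of _ 0]) (simp add: A_def)
      have rA: "r \<in> A" unfolding r_def using clA A1 bA by (intro closed_contains_Inf) auto
      have rmin: "r \<le> s" if "s \<in> A" for s unfolding r_def using that bA by (rule cInf_lower)
      have Wr: "W r = a"
      proof (rule ccontr)
        assume "W r \<noteq> a"
        then have lt: "W r < a" using rA by (simp add: A_def)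
        have "continuous_on {0..r} W" by (rule continuous_on_subset[OF W_continuous]) (use rA in \<open>auto simp: A_def\<close>)
        then obtain s where s: "0 \<le> s" "s \<le> r" "W s = a"
          using IVT2'[of W r a 0] lt 3 rA by (auto simp: A_def)
        then have "s \<in> A" using rA by (simp add: A_def)
        then have "s = r" using rmin s by force
        then show False using s lt by simp
      qed
      have "{s. W s \<le> a} = {r..}"
      proof (intro set_eqI iffI)
        fix s assume "s \<in> {s. W s \<le> a}"
        then have s: "W s \<le> a" by simp
        show "s \<in> {r..}"
        proof (rule ccontr)
          assume "s \<notin> {r..}"
          then have sr: "s < r" by simp
          have "s \<ge> 0" using s 3 W_neg[of s] by (cases "s \<ge> 0") auto
          then have "s \<in> A" using s sr rA by (auto simp: A_def)
          then show False using rmin sr by force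
        qed
      next
        fix s assume "s \<in> {r..}"
        then show "s \<in> {s. W s \<le> a}" using W_antimono[of r s] Wr by simp
      qed
      then show ?thesis using M1 \<nu> N 3 Wr by simp
    qed
  qed
  have fin: "emeasure ?N {..a} \<noteq> \<infinity>" for a
    using N[of "max a 0"] emeasure_mono[of "{..a}" "{..max a 0}" ?N] by (auto simp: top_unique)
  show ?thesis by (rule measure_eqI_atMost) (use M fin in auto)
qed

lemma nn_integral_W_subst:
  assumes [measurable]: "h \<in> borel_measurable borel"
  shows "(\<integral>\<^sup>+s. ennreal (w s) * h (W s) \<partial>lborel) = (\<integral>\<^sup>+u. indicator {0..W 0} u * h u \<partial>lborel)"
proof -
  have "(\<integral>\<^sup>+s. ennreal (w s) * h (W s) \<partial>lborel) = (\<integral>\<^sup>+u. h u \<partial>(distr (density lborel (\<lambda>s. ennreal (w s))) borel W))"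
    by (subst nn_integral_distr) (auto simp: nn_integral_density)
  also have "\<dots> = (\<integral>\<^sup>+u. indicator {0..W 0} u * h u \<partial>lborel)"
    unfolding distr_W by (subst nn_integral_density) auto
  finally show ?thesis .
qed

end

text \<open>The integral is split at \<open>u = v\<close>: below, the maximum is \<open>v\<close>
  and \<open>b < 1\<close> gives convergence at 0; above, it is \<open>u\<close> and
  \<open>b > 0\<close> gives decay. The two pieces yield the two reciprocals.\<close>

lemma nn_integral_Schur_kernel:
  fixes b v B :: real
  assumes b: "0 < b" "b < 1" and v: "0 < v"
  shows "(\<integral>\<^sup>+u. indicator {0..B} u * ennreal (u powr (-b) / max v u) \<partial>lborel)
    \<le> ennreal ((1 / (1 - b) + 1 / b) * v powr (-b))"
proof -
  have 1: "(\<integral>\<^sup>+u. ennreal (u powr (-b)) * indicator {0..v} u \<partial>lborel) = ennreal (v powr (-b + 1) / (-b + 1))"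
    by (rule nn_integral_has_integral_lebesgue'[OF _ has_integral_powr_from_0]) (use b v in auto)
  have 2: "(\<integral>\<^sup>+u. ennreal (u powr (-b - 1)) * indicator {v..B} u \<partial>lborel) \<le> ennreal (v powr (-b) / b)"
  proof (cases "v \<le> B")
    case True
    have "(\<integral>\<^sup>+u. ennreal (u powr (-b - 1)) * indicator {v..B} u \<partial>lborel) =
        ennreal (- (B powr (-b)) / b - (- (v powr (-b)) / b))"
    proof (rule nn_integral_FTC_Icc[where F="\<lambda>u. - (u powr (-b)) / b"])
      show "DERIV (\<lambda>u. - (u powr (-b)) / b) x :> x powr (-b - 1)" if "x \<in> {v..B}" for x
        using that v b by (auto intro!: derivative_eq_intros)
    qed (use True in auto)
    also have "\<dots> \<le> ennreal (v powr (-b) / b)"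
      using b by (intro ennreal_leI) simp
    finally show ?thesis .
  qed simp
  have "(\<integral>\<^sup>+u. indicator {0..B} u * ennreal (u powr (-b) / max v u) \<partial>lborel) \<le>
     (\<integral>\<^sup>+u. ennreal (1 / v) * (ennreal (u powr (-b)) * indicator {0..v} u) +
        ennreal (u powr (-b - 1)) * indicator {v..B} u \<partial>lborel)"
  proof (rule nn_integral_mono)
    fix u :: real
    show "indicator {0..B} u * ennreal (u powr (-b) / max v u) \<le>
      ennreal (1 / v) * (ennreal (u powr (-b)) * indicator {0..v} u) + ennreal (u powr (-b - 1)) * indicator {v..B} u"
    proof (cases "u \<in> {0..B}")
      case True
      show ?thesis
      proof (cases "u \<le> v")
        case True
        then have "indicator {0..B} u * ennreal (u powr (-b) / max v u) = ennreal (1 / v) * (ennreal (u powr (-b)) * indicator {0..v} u)"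
          using v \<open>u \<in> _\<close> by (simp add: ennreal_mult'[symmetric] max_def)
        then show ?thesis by simp
      next
        case False
        then have "indicator {0..B} u * ennreal (u powr (-b) / max v u) = ennreal (u powr (-b - 1)) * indicator {v..B} u"
          using v \<open>u \<in> _\<close> by (simp add: max_def powr_diff)
        then show ?thesis by simp
      qed
    qed simp
  qed
  also have "\<dots> = ennreal (1 / v) * ennreal (v powr (-b + 1) / (-b + 1)) +
      (\<integral>\<^sup>+u. ennreal (u powr (-b - 1)) * indicator {v..B} u \<partial>lborel)"
    by (subst nn_integral_add) (auto simp: nn_integral_cmult 1)
  also have "\<dots> \<le> ennreal (1 / v) * ennreal (v powr (-b + 1) / (-b + 1)) + ennreal (v powr (-b) / b)"
    by (intro add_left_mono 2)
  also have "\<dots> = ennreal ((1 / (1 - b) + 1 / b) * v powr (-b))"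
  proof -
    have "1 / v * (v powr (-b + 1) / (-b + 1)) = 1 / (1 - b) * v powr (-b)"
      using v b by (simp add: powr_diff powr_minus field_simps)
    moreover have "ennreal (1 / v) * ennreal (v powr (-b + 1) / (-b + 1)) = ennreal (1 / v * (v powr (-b + 1) / (-b + 1)))"
      using v by (subst ennreal_mult') auto
    ultimately show ?thesis
      using b by (simp only: ennreal_plus[symmetric] distrib_right divide_nonneg_pos zero_le_mult_iff powr_ge_zero zero_le_divide_1_iff diff_ge_0_iff_ge less_imp_le simp_thms)
        (simp add: algebra_simps)
  qed
  finally show ?thesis .
qed

section \<open>Consequences of doubling for the tail, the moments and the kernel sums\<close>

locale doubling_weight = borel_weight +
  fixes C :: real
  assumes W_pos: "r < 1 \<Longrightarrow> 0 < W r"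
    and C_ge: "1 \<le> C"
    and doubling: "0 \<le> r \<Longrightarrow> r < 1 \<Longrightarrow> W r \<le> C * W ((1 + r) / 2)"
begin

lemma W_iterate:
  assumes "0 \<le> s" "s < 1"
  shows "W s \<le> C ^ n * W (1 - (1 - s) / 2 ^ n)"
proof (induction n)
  case (Suc n)
  define r where "r = 1 - (1 - s) / 2 ^ n"
  have "(1::real) \<le> 2 ^ n" by simp
  then have "1 - s \<le> 2 ^ n" using assms by linarith
  then have r: "0 \<le> r" "r < 1" using assms by (simp_all add: r_def)
  have half: "(1 + r) / 2 = 1 - (1 - s) / 2 ^ Suc n" by (simp add: r_def field_simps)
  have "W r \<le> C * W (1 - (1 - s) / 2 ^ Suc n)" by (rule doubling[OF r, unfolded half])
  then have "C ^ n * W r \<le> C ^ n * (C * W (1 - (1 - s) / 2 ^ Suc n))"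
    using C_ge by (intro mult_left_mono) auto
  then show ?case using Suc by (simp add: r_def algebra_simps)
qed simp

text \<open>Doubling is iterated about \<open>log2 ((1 - s) / (1 - r))\<close> times; with
  \<open>C < 2 ^ N\<close> the accumulated constants are bounded by a power of the ratio.\<close>

lemma growth:
  obtains N :: nat where "N > 0"
    "\<And>s r. 0 \<le> s \<Longrightarrow> s \<le> r \<Longrightarrow> r < 1 \<Longrightarrow> W s \<le> C * ((1 - s) / (1 - r)) ^ N * W r"
proof -
  obtain N where N: "C < 2 ^ N" using real_arch_pow[of 2 C] by auto
  have N0: "N > 0" using N C_ge by (cases N) auto
  have "W s \<le> C * ((1 - s) / (1 - r)) ^ N * W r" if s: "0 \<le> s" "s \<le> r" and r: "r < 1" for s r
  proof -
    define R where "R = (1 - s) / (1 - r)"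
    have R: "1 \<le> R" using s r by (simp add: R_def)
    \<comment> \<open>The least number of halvings of the distance to 1 that leads from
      \<open>s\<close> to \<open>r\<close> or beyond. Minimality gives
      \<open>2 ^ (n - 1) <= R\<close>, so all factors \<open>C\<close> but one are absorbed into
      \<open>R ^ N\<close>.\<close>
    define n where "n = (LEAST n. R < 2 ^ n)"
    have ex: "\<exists>n. R < 2 ^ n" using real_arch_pow[of 2 R] by auto
    have n: "R < 2 ^ n" unfolding n_def by (rule LeastI_ex[OF ex])
    then obtain k where k: "n = Suc k" using R by (cases n) auto
    have Rk: "2 ^ k \<le> R"
      using not_less_Least[of k "\<lambda>n. R < 2 ^ n"] unfolding n_def[symmetric] k by simp
    have "(1 - s) / 2 ^ n \<le> 1 - r" using n r by (simp add: R_def field_simps)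
    then have "W (1 - (1 - s) / 2 ^ n) \<le> W r" by (intro W_antimono) simp
    then have "C ^ n * W (1 - (1 - s) / 2 ^ n) \<le> C ^ n * W r" using C_ge by (intro mult_left_mono) auto
    then have "W s \<le> C ^ n * W r" using W_iterate[of s n] s r by simp
    also have "C ^ n \<le> C * R ^ N"
    proof -
      have "C ^ k \<le> (2 ^ N) ^ k" using N C_ge by (intro power_mono) auto
      also have "\<dots> = (2 ^ k) ^ N" by (simp flip: power_mult add: mult.commute)
      also have "\<dots> \<le> R ^ N" using Rk by (intro power_mono) auto
      finally show ?thesis using C_ge by (simp add: k)
    qed
    finally show ?thesis using W_nonneg[of r] by (simp add: R_def mult_right_mono)
  qed
  then show ?thesis using that N0 by blast
qed

definition mom :: "nat \<Rightarrow> real" where "mom j = (LINT s|lborel. s ^ (2 * j + 1) * w s)"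

text \<open>The Taylor coefficients of the Bergman kernel as a function of
  \<open>cnj z * y\<close>.\<close>

definition coef :: "nat \<Rightarrow> real" where "coef j = 1 / (2 * mom j)"

lemma power_w_le: "s ^ n * w s \<le> w s" "0 \<le> s ^ n * w s"
  by (cases "s \<in> {0..<1}"; simp add: w_nonneg w_outside mult_left_le_one_le power_le_one)+

lemma power_w_integrable: "integrable lborel (\<lambda>s. s ^ n * w s)"
proof (rule Bochner_Integration.integrable_bound[OF w_integrable])
  show "AE s in lborel. norm (s ^ n * w s) \<le> norm (w s)"
    using power_w_le[of _ n] w_nonneg by (intro AE_I2) (simp only: real_norm_def abs_of_nonneg)
qed measurable

lemma mom_ge:
  assumes "0 \<le> r"
  shows "r ^ (2 * j + 1) * W r \<le> mom j"
proof -
  have "r ^ (2 * j + 1) * W r = (LINT s|lborel. r ^ (2 * j + 1) * (indicator {r..} s *\<^sub>R w s))"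
    unfolding W_def set_lebesgue_integral_def by simp
  also have "\<dots> \<le> mom j"
    unfolding mom_def
  proof (rule integral_mono)
    show "integrable lborel (\<lambda>s. r ^ (2 * j + 1) * (indicator {r..} s *\<^sub>R w s))"
      using W_integrable[of r] unfolding set_integrable_def by simp
    show "r ^ (2 * j + 1) * (indicator {r..} s *\<^sub>R w s) \<le> s ^ (2 * j + 1) * w s" for s
    proof (cases "r \<le> s")
      case True
      then have "r ^ (2 * j + 1) \<le> s ^ (2 * j + 1)" using assms by (intro power_mono)
      then show ?thesis using True w_nonneg by (simp add: mult_right_mono)
    next
      case False
      then show ?thesis using power_w_le(2)[of s "2 * j + 1"] by simp
    qed
  qed (rule power_w_integrable)
  finally show ?thesis .
qed

lemma mom_pos: "0 < mom j"
proof -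
  have "0 < (1/2) ^ (2 * j + 1) * W (1/2)" using W_pos[of "1/2"] by simp
  then show ?thesis using mom_ge[of "1/2" j] by linarith
qed

lemma coef_pos: "0 < coef j"
  using mom_pos by (simp add: coef_def)

lemma coef_mono: "mono coef"
proof (rule monoI)
  fix i j :: nat assume ij: "i \<le> j"
  have "mom j \<le> mom i"
    unfolding mom_def
  proof (intro integral_mono power_w_integrable)
    show "s ^ (2 * j + 1) * w s \<le> s ^ (2 * i + 1) * w s" for s
      using ij mult_right_mono[OF power_decreasing[of "2 * i + 1" "2 * j + 1" s] w_nonneg[of s]]
      by (cases "s \<in> {0..<1}") (auto simp: w_outside)
  qed
  then show "coef i \<le> coef j" using mom_pos by (simp add: coef_def frac_le)
qed

text \<open>With \<open>n = 2 * j + 1\<close> and \<open>r = n / (n + 1)\<close> the power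
  \<open>r ^ n\<close> is the inverse of \<open>(1 + 1 / n) ^ n\<close>, which is at most
  \<open>exp 1 <= 3\<close>.\<close>

lemma mom_lower: "W (1 - 1 / (2 * real j + 2)) \<le> 3 * mom j"
proof -
  define n where "n = 2 * real j + 1"
  have n: "n \<ge> 1" by (simp add: n_def)
  define r where "r = 1 - 1 / (n + 1)"
  have r: "r = n / (n + 1)" "0 \<le> r" using n by (auto simp: r_def field_simps)
  have "(1 + 1 / n) ^ (2 * j + 1) \<le> exp (1 / n) ^ (2 * j + 1)"
    using n by (intro power_mono exp_ge_add_one_self) auto
  also have "\<dots> = exp (real (2 * j + 1) * (1 / n))" by (rule exp_of_nat_mult[symmetric])
  also have "real (2 * j + 1) * (1 / n) = 1" using n by (simp add: n_def)
  also have "exp (1::real) \<le> 3" by (rule exp_le)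
  finally have 1: "(1 + 1 / n) ^ (2 * j + 1) \<le> 3" .
  have "1 + 1 / n = (n + 1) / n" using n by (simp add: field_simps)
  then have "r * (1 + 1 / n) = 1" using n by (simp add: r)
  then have "r ^ (2 * j + 1) * (1 + 1 / n) ^ (2 * j + 1) = 1" by (metis power_mult_distrib power_one)
  then have "1 \<le> r ^ (2 * j + 1) * 3" using 1 r(2) by (metis mult_left_mono zero_le_power)
  then have "1 * W r \<le> (r ^ (2 * j + 1) * 3) * W r" using W_nonneg by (rule mult_right_mono)
  also have "\<dots> \<le> 3 * mom j" using mom_ge[OF r(2), of j] by simp
  finally show ?thesis by (simp add: r_def n_def add.assoc)
qed

text \<open>The lower moment bound gives \<open>coef j <= (3 / 2) / W r\<close> with
  \<open>r = 1 - 1 / (2 * j + 2)\<close>. For \<open>r <= y\<close> monotonicity replaces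
  \<open>W r\<close> by \<open>W y\<close>; for \<open>r > y\<close> the growth estimate does so at
  the cost of a polynomial factor in \<open>(1 - y) * (j + 1)\<close>. Summed against
  \<open>y ^ j\<close>, such a factor contributes only a constant.\<close>

lemma kernel_sum_bound:
  obtains K where "K > 0"
    "\<And>y. 0 \<le> y \<Longrightarrow> y < 1 \<Longrightarrow> summable (\<lambda>j. coef j * y ^ j) \<and> (1 - y) * (\<Sum>j. coef j * y ^ j) \<le> K / W y"
proof -
  obtain N where N: "\<And>s r. 0 \<le> s \<Longrightarrow> s \<le> r \<Longrightarrow> r < 1 \<Longrightarrow> W s \<le> C * ((1 - s) / (1 - r)) ^ N * W r"
    using growth by metis
  define K where "K = 3/2 * (1 + C * 2 ^ N * fact N)"
  have K: "K > 0" using C_ge by (simp add: K_def add_pos_nonneg)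
  have "summable (\<lambda>j. coef j * y ^ j) \<and> (1 - y) * (\<Sum>j. coef j * y ^ j) \<le> K / W y"
    if y: "0 \<le> y" "y < 1" for y
  proof -
    have Wy: "W y > 0" using W_pos y by simp
    have cj: "coef j \<le> 3/2 / W y * (1 + C * (1 - y) ^ N * 2 ^ N * (real j + 1) ^ N)" for j
    proof -
      define r where "r = 1 - 1 / (2 * real j + 2)"
      have r: "0 \<le> r" "r < 1" by (auto simp: r_def field_simps)
      have Wr: "W r > 0" using W_pos r by simp
      have 1: "coef j \<le> 3/2 / W r"
        using mom_lower[of j] mom_pos[of j] Wr unfolding coef_def r_def[symmetric] by (simp add: field_simps)
      have "W y \<le> (1 + C * (1 - y) ^ N * 2 ^ N * (real j + 1) ^ N) * W r"
      proof (cases "r \<le> y")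
        case True
        have "W y \<le> 1 * W r" using W_antimono[OF True] by simp
        also have "\<dots> \<le> (1 + C * (1 - y) ^ N * 2 ^ N * (real j + 1) ^ N) * W r"
          using Wr C_ge y by (intro mult_right_mono) auto
        finally show ?thesis .
      next
        case False
        have "(1 - y) / (1 - r) = (1 - y) * 2 * (real j + 1)" by (simp add: r_def field_simps)
        then have "W y \<le> C * ((1 - y) * 2 * (real j + 1)) ^ N * W r"
          using N[of y r] False y r by simp
        also have "\<dots> \<le> (1 + C * (1 - y) ^ N * 2 ^ N * (real j + 1) ^ N) * W r"
        proof (rule mult_right_mono)
          have "C * ((1 - y) * 2 * (real j + 1)) ^ N = C * (1 - y) ^ N * 2 ^ N * (real j + 1) ^ N"
            by (simp only: power_mult_distrib mult.assoc)
          then show "C * ((1 - y) * 2 * (real j + 1)) ^ N \<le> 1 + C * (1 - y) ^ N * 2 ^ N * (real j + 1) ^ N"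
            by linarith
        qed (use Wr in simp)
        finally show ?thesis .
      qed
      then have "1 / W r \<le> (1 + C * (1 - y) ^ N * 2 ^ N * (real j + 1) ^ N) / W y"
        using Wr Wy by (simp add: field_simps)
      then have "3/2 * (1 / W r) \<le> 3/2 * ((1 + C * (1 - y) ^ N * 2 ^ N * (real j + 1) ^ N) / W y)"
        by (intro mult_left_mono) auto
      then show ?thesis using 1 by simp
    qed
    have part: "(\<Sum>j<n. coef j * y ^ j) \<le> K / W y / (1 - y)" for n
    proof -
      have "(\<Sum>j<n. coef j * y ^ j) \<le> (\<Sum>j<n. 3/2 / W y * (1 + C * (1 - y) ^ N * 2 ^ N * (real j + 1) ^ N) * y ^ j)"
        using y by (intro sum_mono mult_right_mono cj) auto
      \<comment> \<open>The zeroth power is written out so that one geometric estimate covers both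
        sums; the factor \<open>(1 - y) ^ N\<close> then cancels all but one power of the
        denominator.\<close>
      also have "\<dots> = 3/2 / W y * ((\<Sum>j<n. (real j + 1) ^ 0 * y ^ j) + C * (1 - y) ^ N * 2 ^ N * (\<Sum>j<n. (real j + 1) ^ N * y ^ j))"
      proof -
        have "3/2 / W y * (1 + C * (1 - y) ^ N * 2 ^ N * (real j + 1) ^ N) * y ^ j =
          3/2 / W y * ((real j + 1) ^ 0 * y ^ j + C * (1 - y) ^ N * 2 ^ N * ((real j + 1) ^ N * y ^ j))" for j
          by (simp add: algebra_simps)
        then show ?thesis by (simp only: sum_distrib_left[symmetric] sum.distrib)
      qed
      also have "\<dots> \<le> 3/2 / W y * (fact 0 / (1 - y) ^ (0 + 1) + C * (1 - y) ^ N * 2 ^ N * (fact N / (1 - y) ^ (N + 1)))"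
        using Wy C_ge y by (intro mult_left_mono add_mono sum_power_geometric_le) auto
      also have "\<dots> = K / W y / (1 - y)"
      proof -
        have "3/2 / a * (fact 0 / z ^ (0 + 1) + C * z ^ N * 2 ^ N * (fact N / z ^ (N + 1))) = K / a / z"
          if "z > 0" "a > 0" for z a :: real
          using that by (simp add: K_def field_simps)
        then show ?thesis using y Wy by simp
      qed
      finally show ?thesis .
    qed
    have nn: "0 \<le> coef j * y ^ j" for j using coef_pos[of j] y by simp
    have sm: "summable (\<lambda>j. coef j * y ^ j)"
      by (rule summableI_nonneg_bounded[OF nn part])
    moreover have "(\<Sum>j. coef j * y ^ j) \<le> K / W y / (1 - y)"
      by (rule suminf_le_const[OF sm part])
    then have "(1 - y) * (\<Sum>j. coef j * y ^ j) \<le> (1 - y) * (K / W y / (1 - y))"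
      using y by (intro mult_left_mono) auto
    then have "(1 - y) * (\<Sum>j. coef j * y ^ j) \<le> K / W y" using y by simp
    ultimately show ?thesis by blast
  qed
  then show ?thesis using that K by blast
qed

text \<open>The part \<open>s >= r\<close> contributes at most \<open>W r\<close>. For
  \<open>s < r\<close> put \<open>T = (1 - s) / (1 - r)\<close>: the power in the moment is at most
  \<open>exp (- T)\<close>, hence at most a constant times \<open>T^(-2N)\<close>, and the growth
  estimate turns this into a multiple of \<open>(W r / W s)^2\<close>. The exponent is doubled
  because the substitution \<open>u = W s\<close> needs the integrable tail \<open>1 / u^2\<close>,
  whose integral from \<open>W r\<close> on is at most \<open>1 / W r\<close>.\<close>

lemma mom_upper:
  obtains K where "K > 0"
    "\<And>j r. 0 \<le> r \<Longrightarrow> r < 1 \<Longrightarrow> 1 \<le> (2 * real j + 1) * (1 - r) \<Longrightarrow> mom j \<le> K * W r"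
proof -
  obtain N where N0: "N > 0" and N: "\<And>s r. 0 \<le> s \<Longrightarrow> s \<le> r \<Longrightarrow> r < 1 \<Longrightarrow> W s \<le> C * ((1 - s) / (1 - r)) ^ N * W r"
    using growth by metis
  define Q where "Q = real (2 * N) ^ (2 * N) * C ^ 2"
  have Q: "Q > 0" using N0 C_ge by (simp add: Q_def)
  have "mom j \<le> (Q + 1) * W r" if r: "0 \<le> r" "r < 1" and j: "1 \<le> (2 * real j + 1) * (1 - r)" for j r
  proof -
    define n where "n = 2 * j + 1"
    \<comment> \<open>The majorant for \<open>s < r\<close> depends on \<open>s\<close> only through
      \<open>W s\<close>; the cut-off at \<open>W r\<close> keeps it away from the singularity at
      0.\<close>
    define h where "h = (\<lambda>u. ennreal (Q * (W r)\<^sup>2 / u\<^sup>2) * indicator {W r..} u)"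
    have Wr: "W r > 0" using r W_pos by simp
    have [measurable]: "h \<in> borel_measurable borel" unfolding h_def by measurable
    have pt: "ennreal (s ^ n * w s) \<le> ennreal (w s) * h (W s) + ennreal (w s) * indicator {r..} s" for s
    proof (cases "s \<in> {0..<1}")
      case True
      show ?thesis
      proof (cases "r \<le> s")
        case True
        have "ennreal (s ^ n * w s) \<le> ennreal (w s)" by (intro ennreal_leI power_w_le)
        then show ?thesis using True by (simp add: add_increasing)
      next
        case False
        define T where "T = (1 - s) / (1 - r)"
        have s: "0 \<le> s" "s < r" "s < 1" using True False by auto
        have Ws: "W s > 0" using W_pos s by simp
        have T: "T > 0" using s r by (simp add: T_def)
        have "s ^ n \<le> exp (s - 1) ^ n"
          using s exp_ge_add_one_self[of "s - 1"] by (intro power_mono) auto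
        also have "\<dots> = exp (real n * (s - 1))" by (rule exp_of_nat_mult[symmetric])
        also have "\<dots> \<le> exp (- T)"
        proof -
          have "1 * (1 - s) \<le> ((2 * real j + 1) * (1 - r)) * (1 - s)" using j s by (intro mult_right_mono) auto
          then have "T \<le> real n * (1 - s)" using r by (simp add: T_def n_def field_simps)
          then show ?thesis by (simp add: algebra_simps)
        qed
        also have "exp (- T) \<le> real (2 * N) ^ (2 * N) / T ^ (2 * N)"
          using power_mult_exp_minus_le[of T "2 * N"] T N0 by (simp add: field_simps)
        also have "\<dots> = real (2 * N) ^ (2 * N) * (1 / T ^ N)\<^sup>2"
          by (simp add: power_divide power_mult[symmetric] mult.commute)
        also have "1 / T ^ N \<le> C * W r / W s"
          using N[of s r] s r Ws T by (simp add: T_def[symmetric] field_simps)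
        then have "real (2 * N) ^ (2 * N) * (1 / T ^ N)\<^sup>2 \<le> real (2 * N) ^ (2 * N) * (C * W r / W s)\<^sup>2"
          using T by (intro mult_left_mono power_mono) auto
        also have "\<dots> = Q * (W r)\<^sup>2 / (W s)\<^sup>2" by (simp add: Q_def power_mult_distrib power_divide)
        finally have "s ^ n \<le> Q * (W r)\<^sup>2 / (W s)\<^sup>2" .
        then have "s ^ n * w s \<le> w s * (Q * (W r)\<^sup>2 / (W s)\<^sup>2)"
          using w_nonneg[of s] by (simp only: mult.commute[of "w s"] mult_right_mono)
        then have "ennreal (s ^ n * w s) \<le> ennreal (w s) * ennreal (Q * (W r)\<^sup>2 / (W s)\<^sup>2)"
          using w_nonneg[of s] by (simp only: ennreal_mult'[symmetric] ennreal_leI)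
        also have "\<dots> = ennreal (w s) * h (W s)"
          using W_antimono[of s r] s by (simp add: h_def)
        finally show ?thesis by (simp add: add_increasing2)
      qed
    qed (simp add: w_outside)
    have "ennreal (mom j) = (\<integral>\<^sup>+s. ennreal (s ^ n * w s) \<partial>lborel)"
      unfolding mom_def n_def[symmetric]
      by (rule nn_integral_eq_integral[symmetric]) (use power_w_integrable power_w_le in auto)
    also have "\<dots> \<le> (\<integral>\<^sup>+s. ennreal (w s) * h (W s) + ennreal (w s) * indicator {r..} s \<partial>lborel)"
      by (intro nn_integral_mono pt)
    also have "\<dots> = (\<integral>\<^sup>+s. ennreal (w s) * h (W s) \<partial>lborel) + ennreal (W r)"
      by (subst nn_integral_add) (auto simp: nn_integral_W)
    also have "(\<integral>\<^sup>+s. ennreal (w s) * h (W s) \<partial>lborel) = (\<integral>\<^sup>+u. indicator {0..W 0} u * h u \<partial>lborel)"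
      by (rule nn_integral_W_subst) measurable
    also have "\<dots> = (\<integral>\<^sup>+u. ennreal (Q * (W r)\<^sup>2 / u\<^sup>2) * indicator {W r..W 0} u \<partial>lborel)"
      using Wr by (intro nn_integral_cong) (auto simp: h_def split: split_indicator)
    also have "\<dots> = ennreal (- (Q * (W r)\<^sup>2 / W 0) - (- (Q * (W r)\<^sup>2 / W r)))"
    proof (rule nn_integral_FTC_Icc[where F="\<lambda>u. - (Q * (W r)\<^sup>2 / u)"])
      show "DERIV (\<lambda>u. - (Q * (W r)\<^sup>2 / u)) x :> Q * (W r)\<^sup>2 / x\<^sup>2" if "x \<in> {W r..W 0}" for x
        using that Wr by (auto intro!: derivative_eq_intros simp: power2_eq_square)
    qed (use W_le_W0 Q in auto)
    also have "\<dots> \<le> ennreal (Q * W r)"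
      using Q Wr W_nonneg[of 0] by (intro ennreal_leI) (simp add: power2_eq_square)
    finally have "ennreal (mom j) \<le> ennreal (Q * W r) + ennreal (W r)"
      by (simp add: add_right_mono)
    also have "\<dots> = ennreal ((Q + 1) * W r)" using Q Wr by (simp add: distrib_right)
    finally show ?thesis using Q Wr by (subst (asm) ennreal_le_iff) auto
  qed
  then show ?thesis using that[of "Q + 1"] Q by auto
qed

lemma Schur_bound:
  assumes "0 < b" "b < 1" "0 < v"
  shows "(\<integral>\<^sup>+s. ennreal (w s) * ennreal (W s powr (-b) / max v (W s)) \<partial>lborel)
    \<le> ennreal ((1 / (1 - b) + 1 / b) * v powr (-b))"
proof -
  have "(\<integral>\<^sup>+s. ennreal (w s) * ennreal (W s powr (-b) / max v (W s)) \<partial>lborel) =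
    (\<integral>\<^sup>+u. indicator {0..W 0} u * ennreal (u powr (-b) / max v u) \<partial>lborel)"
    by (rule nn_integral_W_subst) measurable
  then show ?thesis using nn_integral_Schur_kernel[OF assms] by simp
qed

end

lemma borel_measurable_pker [measurable]: "pker c \<in> borel_measurable borel"
  unfolding pker_def by measurable

lemma norm_pker_le:
  assumes c: "\<And>n. 0 \<le> c n" and w: "cmod w \<le> r" and s: "summable (\<lambda>n. c n * r ^ n)"
  shows "cmod (pker c w) \<le> (\<Sum>n. c n * r ^ n)"
  unfolding pker_def
proof (rule norm_suminf_le[OF _ s])
  show "norm (of_real (c n) * w ^ n) \<le> c n * r ^ n" for n
    using c[of n] w by (auto simp: norm_mult norm_power intro!: mult_left_mono power_mono)
qed

section \<open>The weighted area measure and averaging over rotations\<close>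

context borel_weight
begin

text \<open>The measure \<open>omega dA\<close>, on the whole plane: the disc enters only because
  \<open>w\<close> vanishes from 1 on, so rotations act without domain conditions.\<close>

definition E :: "complex measure" where "E = density lborel (\<lambda>z. ennreal (w (cmod z) / pi))"

lemma sets_E [simp, measurable_cong]: "sets E = sets borel" by (simp add: E_def)

lemma space_E [simp]: "space E = UNIV" by (simp add: E_def)

lemma measurable_E [simp]: "measurable E N = measurable borel N"
  by (rule measurable_cong_sets) simp_all

lemma nn_integral_E:
  assumes [measurable]: "f \<in> borel_measurable borel"
  shows "(\<integral>\<^sup>+z. f z \<partial>E) = (\<integral>\<^sup>+z. ennreal (w (cmod z) / pi) * f z \<partial>lborel)"
  unfolding E_def by (subst nn_integral_density) auto

lemma nn_integral_E_rotate:
  assumes [measurable]: "f \<in> borel_measurable borel" and e: "cmod e = 1"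
  shows "(\<integral>\<^sup>+z. f (e * z) \<partial>E) = (\<integral>\<^sup>+z. f z \<partial>E)"
proof -
  have "(\<integral>\<^sup>+z. f (e * z) \<partial>E) = (\<integral>\<^sup>+z. ennreal (w (cmod (e * z)) / pi) * f (e * z) \<partial>lborel)"
    by (simp add: nn_integral_E norm_mult e)
  also have "\<dots> = (\<integral>\<^sup>+z. ennreal (w (cmod z) / pi) * f z \<partial>lborel)"
    by (rule nn_integral_lborel_rotation[OF e]) measurable
  finally show ?thesis by (simp add: nn_integral_E)
qed

lemma distr_E_rotate:
  assumes e: "cmod e = 1"
  shows "distr E borel ((*) e) = E"
proof (rule measure_eqI)
  fix A assume "A \<in> sets (distr E borel ((*) e))"
  then have [measurable]: "A \<in> sets borel" by simp
  have "emeasure (distr E borel ((*) e)) A = (\<integral>\<^sup>+z. indicator A z \<partial>(distr E borel ((*) e)))"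
    by simp
  also have "\<dots> = (\<integral>\<^sup>+z. indicator A (e * z) \<partial>E)"
    by (rule nn_integral_distr) auto
  also have "\<dots> = (\<integral>\<^sup>+z. indicator A z \<partial>E)"
    by (rule nn_integral_E_rotate[OF _ e]) measurable
  also have "\<dots> = emeasure E A" by simp
  finally show "emeasure (distr E borel ((*) e)) A = emeasure E A" .
qed simp

lemma integral_E_rotate:
  fixes h :: "complex \<Rightarrow> 'b::{banach, second_countable_topology}"
  assumes [measurable]: "h \<in> borel_measurable borel" and e: "cmod e = 1"
  shows "(LINT z|E. h (e * z)) = (LINT z|E. h z)"
    and "integrable E (\<lambda>z. h (e * z)) \<longleftrightarrow> integrable E h"
proof -
  have "(LINT z|E. h z) = (LINT z|distr E borel ((*) e). h z)" by (simp add: distr_E_rotate[OF e])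
  also have "\<dots> = (LINT z|E. h (e * z))" by (rule integral_distr) auto
  finally show "(LINT z|E. h (e * z)) = (LINT z|E. h z)" by simp
  have "integrable E h \<longleftrightarrow> integrable (distr E borel ((*) e)) h" by (simp add: distr_E_rotate[OF e])
  also have "\<dots> \<longleftrightarrow> integrable E (\<lambda>z. h (e * z))" by (rule integrable_distr_eq) auto
  finally show "integrable E (\<lambda>z. h (e * z)) \<longleftrightarrow> integrable E h" by simp
qed

lemma nn_integral_E_radial:
  assumes [measurable]: "g \<in> borel_measurable borel"
  shows "(\<integral>\<^sup>+z. g (cmod z) \<partial>E) = (\<integral>\<^sup>+s. ennreal (2 * s) * ennreal (w s) * g s \<partial>lborel)"
proof -
  have "(\<integral>\<^sup>+z. g (cmod z) \<partial>E) = (\<integral>\<^sup>+s. ennreal (2 * pi * s) * indicator {0..} s * (ennreal (w s / pi) * g s) \<partial>lborel)"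
    by (subst nn_integral_E, measurable, subst nn_integral_radial) auto
  also have "\<dots> = (\<integral>\<^sup>+s. ennreal (2 * s) * ennreal (w s) * g s \<partial>lborel)"
  proof (rule nn_integral_cong)
    fix s
    show "ennreal (2 * pi * s) * indicator {0..} s * (ennreal (w s / pi) * g s) = ennreal (2 * s) * ennreal (w s) * g s"
    proof (cases "s \<in> {0..<1}")
      case True
      have "ennreal (2 * pi * s) * ennreal (w s / pi) = ennreal (2 * s) * ennreal (w s)"
        using True w_nonneg[of s] by (simp add: ennreal_mult'[symmetric] ennreal_mult[symmetric])
      then show ?thesis using True by (simp add: mult.assoc[symmetric])
    qed (simp add: w_outside)
  qed
  finally show ?thesis .
qed

lemma nn_integral_E_radial_le:
  assumes [measurable]: "g \<in> borel_measurable borel"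
  shows "(\<integral>\<^sup>+z. g (cmod z) \<partial>E) \<le> ennreal 2 * (\<integral>\<^sup>+s. ennreal (w s) * g s \<partial>lborel)"
proof -
  have "(\<integral>\<^sup>+z. g (cmod z) \<partial>E) \<le> (\<integral>\<^sup>+s. ennreal 2 * (ennreal (w s) * g s) \<partial>lborel)"
    unfolding nn_integral_E_radial[OF assms]
  proof (rule nn_integral_mono)
    show "ennreal (2 * s) * ennreal (w s) * g s \<le> ennreal 2 * (ennreal (w s) * g s)" for s
    proof (cases "s \<in> {0..<1}")
      case True
      then have "ennreal (2 * s) \<le> ennreal 2" by (intro ennreal_leI) auto
      then show ?thesis unfolding mult.assoc by (rule mult_right_mono) simp
    qed (simp add: w_outside)
  qed
  also have "\<dots> = ennreal 2 * (\<integral>\<^sup>+s. ennreal (w s) * g s \<partial>lborel)"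
    by (rule nn_integral_cmult) measurable
  finally show ?thesis .
qed

lemma AE_E_disc: "AE z in E. cmod z < 1"
proof -
  have "w (cmod z) = 0" if "\<not> cmod z < 1" for z :: complex using that by (intro w_outside) auto
  then show ?thesis unfolding E_def by (subst AE_density, measurable) (intro AE_I2 impI, rule ccontr, simp)
qed

lemma finite_measure_E: "finite_measure E"
proof
  have "emeasure E (space E) = (\<integral>\<^sup>+z. 1 \<partial>E)" by simp
  also have "\<dots> \<le> ennreal 2 * (\<integral>\<^sup>+s. ennreal (w s) * 1 \<partial>lborel)"
    by (rule nn_integral_E_radial_le) simp
  also have "(\<integral>\<^sup>+s. ennreal (w s) * 1 \<partial>lborel) = ennreal (LINT s|lborel. w s)"
    using w_integrable w_nonneg by (simp add: nn_integral_eq_integral)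
  finally show "emeasure E (space E) \<noteq> \<infinity>"
    by (auto simp: ennreal_mult_eq_top_iff top_unique)
qed

end

sublocale borel_weight \<subseteq> E: finite_measure E
  by (rule finite_measure_E)

sublocale borel_weight \<subseteq> CE: pair_sigma_finite haar E
  by standard

sublocale borel_weight \<subseteq> EE: pair_sigma_finite E E
  by standard

context borel_weight
begin

lemma nn_integral_E_average:
  assumes [measurable]: "f \<in> borel_measurable borel"
  shows "(\<integral>\<^sup>+z. (\<integral>\<^sup>+t. f (circ t * z) \<partial>haar) \<partial>E) = (\<integral>\<^sup>+z. f z \<partial>E)"
proof -
  have "(\<integral>\<^sup>+z. (\<integral>\<^sup>+t. f (circ t * z) \<partial>haar) \<partial>E) = (\<integral>\<^sup>+t. (\<integral>\<^sup>+z. f (circ t * z) \<partial>E) \<partial>haar)"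
    by (rule CE.Fubini') measurable
  also have "\<dots> = (\<integral>\<^sup>+z. f z \<partial>E)" by (simp add: nn_integral_E_rotate)
  finally show ?thesis .
qed

text \<open>Rotation invariance lets every integral over the disc be replaced by one of circle
  means; this is how Fourier multipliers on circles enter.\<close>

lemma integral_E_average:
  fixes h :: "complex \<Rightarrow> complex"
  assumes h: "integrable E h"
  shows "(LINT z|E. h z) = (LINT z|E. (LINT t|haar. h (circ t * z)))"
proof -
  have [measurable]: "h \<in> borel_measurable borel" using borel_measurable_integrable[OF h] by simp
  have "(LINT z|E. h z) = (LINT t|haar. (LINT z|E. h (circ t * z)))"
    by (simp add: integral_E_rotate)
  also have "\<dots> = (LINT z|E. (LINT t|haar. h (circ t * z)))"
  proof (rule CE.Fubini_integral[symmetric], rule CE.Fubini_integrable)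
    show "(\<lambda>(t, z). h (circ t * z)) \<in> borel_measurable (haar \<Otimes>\<^sub>M E)" by measurable
    show "integrable haar (\<lambda>t. LINT z|E. norm (case (t, z) of (t, z) \<Rightarrow> h (circ t * z)))"
      using integral_E_rotate(1)[of "\<lambda>z. norm (h z)"] by simp
    show "AE t in haar. integrable E (\<lambda>z. case (t, z) of (t, z) \<Rightarrow> h (circ t * z))"
      using h by (simp add: integral_E_rotate)
  qed
  finally show ?thesis .
qed

lemma integrable_E_of_powr:
  fixes f :: "complex \<Rightarrow> complex"
  assumes p: "1 < p" and [measurable]: "f \<in> borel_measurable borel"
    and fin: "Lp_int E p f < \<infinity>"
  shows "integrable E f"
proof (rule Bochner_Integration.integrable_bound)
  have "integrable E (\<lambda>z. cmod (f z) powr p)"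
    by (rule integrableI_bounded) (use fin in auto)
  then show "integrable E (\<lambda>z. 1 + cmod (f z) powr p)" by simp
  show "AE z in E. norm (f z) \<le> norm (1 + cmod (f z) powr p)"
    using le_one_plus_powr[of p "cmod (f _)"] p by (intro AE_I2) simp
qed simp

end

section \<open>The projection as an integral operator and its norm on circles\<close>

context doubling_weight
begin

text \<open>The Bergman projection in terms of \<open>E\<close>. Since the coefficients are real,
  conjugating the kernel amounts to conjugating its argument.\<close>

definition T :: "(complex \<Rightarrow> complex) \<Rightarrow> complex \<Rightarrow> complex" where
  "T f z = (LINT y|E. f y * pker coef (z * cnj y))"

lemma borel_measurable_T [measurable]:
  assumes [measurable]: "f \<in> borel_measurable borel"
  shows "T f \<in> borel_measurable borel"
  unfolding T_def by (rule E.borel_measurable_lebesgue_integral[of _ borel]) measurable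

lemma coef_summable: "0 \<le> y \<Longrightarrow> y < 1 \<Longrightarrow> summable (\<lambda>j. coef j * y ^ j)"
  by (rule kernel_sum_bound) blast

lemma integrable_T:
  assumes f: "integrable E f" and z: "cmod z < 1"
  shows "integrable E (\<lambda>y. f y * pker coef (z * cnj y))"
proof (rule Bochner_Integration.integrable_bound)
  define B where "B = (\<Sum>j. coef j * cmod z ^ j)"
  show "integrable E (\<lambda>y. B *\<^sub>R f y)" using f by simp
  have [measurable]: "f \<in> borel_measurable borel" using borel_measurable_integrable[OF f] by simp
  show "(\<lambda>y. f y * pker coef (z * cnj y)) \<in> borel_measurable E" by measurable
  show "AE y in E. norm (f y * pker coef (z * cnj y)) \<le> norm (B *\<^sub>R f y)"
    using AE_E_disc
  proof eventually_elim
    case (elim y)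
    have "cmod (pker coef (z * cnj y)) \<le> B"
      unfolding B_def
      by (rule norm_pker_le) (use elim z coef_pos in \<open>auto simp: norm_mult less_imp_le mult_left_le intro!: coef_summable\<close>)
    then show ?case by (auto simp: norm_mult mult.commute[of "cmod (f _)"] intro!: mult_right_mono)
  qed
qed

lemma multiplier_bound_kernel:
  assumes p: "1 < p"
  obtains A where "A > 0"
    "\<And>x m u. cmod x \<le> m \<Longrightarrow> 0 \<le> m \<Longrightarrow> m < 1 \<Longrightarrow> u \<in> borel_measurable borel \<Longrightarrow>
      Lp_int haar p (\<lambda>t. LINT s|haar. u s * pker coef (x * circ t * cnj (circ s)))
      \<le> ennreal (A * (1 / W m) powr p) * Lp_int haar p u"
proof -
  obtain C1 where C1: "C1 \<ge> 0" and mult: "\<forall>c y b u. (\<forall>n. 0 < c n) \<longrightarrow> mono c \<longrightarrow> 0 < y \<longrightarrow> y < 1 \<longrightarrow> summable (\<lambda>n. c n * y ^ n) \<longrightarrow>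
    cmod b < 1 \<longrightarrow> integrable haar u \<longrightarrow>
    Lp_int haar p (\<lambda>t. LINT s|haar. u s * pker c (of_real y * b * circ t * cnj (circ s)))
      \<le> ennreal (C1 * ((1 - y) * (\<Sum>n. c n * y ^ n)) powr p) * Lp_int haar p u"
    using multiplier_bound[OF p] by blast
  obtain K where K: "K > 0"
    "\<And>y. 0 \<le> y \<Longrightarrow> y < 1 \<Longrightarrow> summable (\<lambda>j. coef j * y ^ j) \<and> (1 - y) * (\<Sum>j. coef j * y ^ j) \<le> K / W y"
    using kernel_sum_bound by metis
  define A where "A = C1 * (K * C) powr p + 1"
  have A: "A > 0" using C1 by (simp add: A_def add_nonneg_pos)
  have "Lp_int haar p (\<lambda>t. LINT s|haar. u s * pker coef (x * circ t * cnj (circ s)))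
      \<le> ennreal (A * (1 / W m) powr p) * Lp_int haar p u"
    if x: "cmod x \<le> m" and m: "0 \<le> m" "m < 1" and [measurable]: "u \<in> borel_measurable borel" for x m u
  \<comment> \<open>In the infinite case the right side is infinite, which requires a positive
    constant; this is the origin of the summand 1 in \<open>A\<close>.\<close>
  proof (cases "Lp_int haar p u = \<infinity>")
    case True
    have "W m > 0" using W_pos m by simp
    then show ?thesis using True A by (simp add: ennreal_mult_top)
  next
    case False
    have Wm: "W m > 0" using W_pos m by simp
    have "integrable haar u"
    proof (rule Bochner_Integration.integrable_bound)
      have "integrable haar (\<lambda>z. cmod (u z) powr p)"
        by (rule integrableI_bounded) (use False in \<open>auto simp: top.not_eq_extremum\<close>)
      then show "integrable haar (\<lambda>z. 1 + cmod (u z) powr p)" by simp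
      show "AE z in haar. norm (u z) \<le> norm (1 + cmod (u z) powr p)"
        using le_one_plus_powr[of p "cmod (u _)"] p by (intro AE_I2) simp
    qed simp
    \<comment> \<open>Halfway to 1, so that \<open>x = y * b\<close> with \<open>cmod b < 1\<close>,
      while doubling bounds \<open>1 / W y\<close> by \<open>C / W m\<close>.\<close>
    define y where "y = (1 + m) / 2"
    have y: "0 < y" "y < 1" "m < y" "0 \<le> y" using m by (auto simp: y_def)
    define b where "b = x / of_real y"
    have b: "cmod b < 1" "x = of_real y * b" using x y by (auto simp: b_def norm_divide)
    have Wy: "W y > 0" using W_pos y by simp
    have "(1 - y) * (\<Sum>j. coef j * y ^ j) \<le> K / W y" using K(2)[of y] y by simp
    also have "\<dots> \<le> K * C * (1 / W m)"
      using doubling[OF m] K(1) Wm Wy by (simp add: y_def[symmetric] field_simps)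
    finally have "((1 - y) * (\<Sum>j. coef j * y ^ j)) powr p \<le> (K * C * (1 / W m)) powr p"
      using p y by (intro powr_mono2 mult_nonneg_nonneg suminf_nonneg coef_summable) (auto simp: coef_pos less_imp_le)
    also have "\<dots> = (K * C) powr p * (1 / W m) powr p"
      by (rule powr_mult)
    finally have "C1 * ((1 - y) * (\<Sum>j. coef j * y ^ j)) powr p \<le> C1 * ((K * C) powr p * (1 / W m) powr p)"
      using C1 by (rule mult_left_mono)
    also have "\<dots> \<le> A * (1 / W m) powr p" by (simp add: A_def distrib_right)
    finally have le: "C1 * ((1 - y) * (\<Sum>j. coef j * y ^ j)) powr p \<le> A * (1 / W m) powr p" .
    have "Lp_int haar p (\<lambda>t. LINT s|haar. u s * pker coef (x * circ t * cnj (circ s)))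
      \<le> ennreal (C1 * ((1 - y) * (\<Sum>j. coef j * y ^ j)) powr p) * Lp_int haar p u"
      unfolding b(2) by (rule mult[rule_format, OF coef_pos coef_mono y(1,2) coef_summable[OF y(4,2)] b(1)]) fact
    also have "\<dots> \<le> ennreal (A * (1 / W m) powr p) * Lp_int haar p u"
      by (intro mult_right_mono ennreal_leI le) simp
    finally show ?thesis .
  qed
  then show ?thesis using that A by blast
qed

end

section \<open>Schur's test and the boundedness of the projection\<close>

context doubling_weight
begin

lemma Schur_bound_E:
  assumes "0 < b" "b < 1" "0 < v"
  shows "(\<integral>\<^sup>+z. ennreal (W (cmod z) powr (-b) / max v (W (cmod z))) \<partial>E)
    \<le> ennreal (2 * (1 / (1 - b) + 1 / b) * v powr (-b))"
proof -
  have "(\<integral>\<^sup>+z. ennreal (W (cmod z) powr (-b) / max v (W (cmod z))) \<partial>E) \<le>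
    ennreal 2 * (\<integral>\<^sup>+s. ennreal (w s) * ennreal (W s powr (-b) / max v (W s)) \<partial>lborel)"
    by (rule nn_integral_E_radial_le[of "\<lambda>s. ennreal (W s powr (-b) / max v (W s))"]) measurable
  also have "\<dots> \<le> ennreal 2 * ennreal ((1 / (1 - b) + 1 / b) * v powr (-b))"
    by (intro mult_left_mono Schur_bound assms) simp
  also have "\<dots> = ennreal (2 * (1 / (1 - b) + 1 / b) * v powr (-b))"
    by (simp only: ennreal_mult'[symmetric] mult.assoc zero_le_numeral)
  finally show ?thesis .
qed

text \<open>
  Schur's test with the weight \<open>W\<^sup>-\<^sup>1\<^sup>/\<^sup>p\<close>, applied after averaging over rotations: on each pair of
  circles the kernel acts as a Fourier multiplier of norm \<open>O(1 / max (W |z|) (W |y|))\<close>.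
\<close>
theorem T_bounded:
  assumes p: "1 < p"
  obtains K where "0 \<le> K"
    "\<And>f. f \<in> borel_measurable borel \<Longrightarrow> Lp_int E p f < \<infinity> \<Longrightarrow>
      Lp_int E p (T f) \<le> ennreal K * Lp_int E p f"
proof -
  obtain A where A: "A > 0" and mult: "\<And>x m u. cmod x \<le> m \<Longrightarrow> 0 \<le> m \<Longrightarrow> m < 1 \<Longrightarrow> u \<in> borel_measurable borel \<Longrightarrow>
      Lp_int haar p (\<lambda>t. LINT s|haar. u s * pker coef (x * circ t * cnj (circ s)))
      \<le> ennreal (A * (1 / W m) powr p) * Lp_int haar p u"
    using multiplier_bound_kernel[OF p] by blast
  \<comment> \<open>The Schur weight is \<open>W\<close> to the power \<open>-b\<close>. Raised to
    \<open>p - 1\<close>, its integral produces the exponent \<open>c = 1 - 1 / p\<close>, which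
    governs the second integration.\<close>
  define b where "b = 1 / p"
  define c where "c = 1 - b"
  have b: "0 < b" "b < 1" "0 < c" "c < 1" using p by (auto simp: b_def c_def)
  have bc: "b * (p - 1) = c" using p by (simp add: b_def c_def field_simps)
  define S where "S = 2 * (1 / (1 - b) + 1 / b)"
  \<comment> \<open>The Schur constant is symmetric in \<open>b\<close> and \<open>c\<close>, so one
    constant serves both integrations.\<close>
  have Sc: "S = 2 * (1 / (1 - c) + 1 / c)" by (simp add: S_def c_def)
  have S: "S > 0" using b by (simp add: S_def add_pos_pos)
  define H where "H = (\<lambda>z y :: complex. 1 / max (W (cmod z)) (W (cmod y)))"
  have Hm[measurable]: "(\<lambda>x. H (g x) (h x)) \<in> borel_measurable M"
    if [measurable]: "g \<in> borel_measurable M" "h \<in> borel_measurable M" for g h and M :: "'c measure"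
    unfolding H_def by measurable
  have Hpos: "H z y > 0" if "cmod z < 1" for z y
    using W_pos[OF that] by (simp add: H_def less_max_iff_disj)
  have main: "Lp_int E p (T f) \<le> ennreal (A * S powr p) * Lp_int E p f"
    if fm[measurable]: "f \<in> borel_measurable borel" and fin: "Lp_int E p f < \<infinity>" for f
  proof -
    have fint: "integrable E f" by (rule integrable_E_of_powr[OF p fm fin])
    define I where "I = (\<lambda>y. \<integral>\<^sup>+t. ennreal (cmod (f (circ t * y)) powr p) \<partial>haar)"
    have [measurable]: "I \<in> borel_measurable borel" unfolding I_def by measurable
    \<comment> \<open>The part of \<open>T f (circ t * z)\<close> coming from the circle through
      \<open>y\<close>: angular cancellation is used here, before any absolute value.\<close>
    define G where "G = (\<lambda>t z y. LINT s|haar. f (circ s * y) * pker coef (circ t * z * cnj (circ s * y)))"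
    have Gm[measurable]: "(\<lambda>x. G (r x) z (h x)) \<in> borel_measurable M"
      if [measurable]: "r \<in> borel_measurable M" "h \<in> borel_measurable M" for r h z and M :: "'d measure"
      unfolding G_def by measurable
    have GB: "Lp_int haar p (\<lambda>t. G t z y) \<le> ennreal (A * H z y powr p) * I y"
      if z: "cmod z < 1" "cmod y < 1" for z y
    proof -
      \<comment> \<open>The product of two numbers in \<open>[0,1)\<close> is at most the smaller
        one, and since \<open>W\<close> decreases, \<open>W m\<close> is the larger of the two
        tails.\<close>
      define m where "m = min (cmod z) (cmod y)"
      have m: "0 \<le> m" "m < 1" using z by (auto simp: m_def)
      have "cmod z * cmod y \<le> m"
        using z by (auto simp: m_def min_def mult_left_le mult_left_le_one_le)
      then have x: "cmod (z * cnj y) \<le> m" by (simp add: norm_mult)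
      have Wm: "1 / W m = H z y"
        using W_antimono[of "cmod z" "cmod y"] W_antimono[of "cmod y" "cmod z"]
        by (auto simp: H_def m_def min_def max_def)
      have "Lp_int haar p (\<lambda>t. LINT s|haar. f (circ s * y) * pker coef (z * cnj y * circ t * cnj (circ s)))
        \<le> ennreal (A * (1 / W m) powr p) * Lp_int haar p (\<lambda>t. f (circ t * y))"
        by (rule mult[OF x m]) measurable
      moreover have "z * cnj y * circ t * cnj (circ s) = circ t * z * cnj (circ s * y)" for t s
        by (simp add: mult_ac)
      ultimately show ?thesis unfolding Wm G_def I_def by simp
    qed
    \<comment> \<open>Off the disc the Schur weight would degenerate since \<open>W\<close> vanishes
      there; the value 1 keeps \<open>v\<close> positive everywhere and concerns only an
      \<open>E\<close>-null set.\<close>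
    define v where "v = (\<lambda>z y :: complex. if cmod y < 1 then H z y * W (cmod y) powr (-b) else 1)"
    have [measurable]: "v z \<in> borel_measurable borel" for z unfolding v_def by measurable
    define V where "V = (\<lambda>z :: complex. S * W (cmod z) powr (-b))"
    have pt: "ennreal (cmod (T f (circ t * z)) powr p) \<le>
        ennreal (V z powr (p - 1)) * (\<integral>\<^sup>+y. ennreal (cmod (G t z y) powr p * v z y powr (1 - p)) \<partial>E)"
      if z: "cmod z < 1" for t z
    proof (rule Jensen_weighted[OF p])
      have Wz: "W (cmod z) > 0" using W_pos z by simp
      have int: "integrable E (\<lambda>y. f y * pker coef (circ t * z * cnj y))"
        by (rule integrable_T[OF fint]) (use z in \<open>simp add: norm_mult\<close>)
      have "T f (circ t * z) = (LINT y|E. G t z y)"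
        unfolding T_def G_def by (rule integral_E_average[OF int])
      then show "ennreal (cmod (T f (circ t * z))) \<le> (\<integral>\<^sup>+y. ennreal (cmod (G t z y)) \<partial>E)"
        using norm_integral_le_nn_integral[of E "G t z"] by simp
      have "(\<integral>\<^sup>+y. ennreal (v z y) \<partial>E) = (\<integral>\<^sup>+y. ennreal (W (cmod y) powr (-b) / max (W (cmod z)) (W (cmod y))) \<partial>E)"
        by (rule nn_integral_cong_AE, use AE_E_disc in eventually_elim) (simp add: v_def H_def)
      also have "\<dots> \<le> ennreal (V z)"
        unfolding V_def S_def by (rule Schur_bound_E[OF b(1,2) Wz])
      finally show "(\<integral>\<^sup>+y. ennreal (v z y) \<partial>E) \<le> ennreal (V z)" .
      show "0 < V z" using S Wz by (simp add: V_def)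
      show "0 < v z y" for y
        using Hpos[OF z] W_pos[of "cmod y"] by (cases "cmod y < 1") (simp_all add: v_def)
      show "(\<lambda>y. cmod (G t z y)) \<in> borel_measurable E" by measurable
      show "v z \<in> borel_measurable E" by simp
    qed auto
    have J: "Lp_int haar p (\<lambda>t. T f (circ t * z)) \<le>
        ennreal (A * S powr (p - 1)) * (\<integral>\<^sup>+y. ennreal (W (cmod z) powr (-c) * H z y) * (ennreal (W (cmod y) powr c) * I y) \<partial>E)"
      if z: "cmod z < 1" for z
    proof -
      have Wz: "W (cmod z) > 0" using W_pos z by simp
      have Vp: "V z powr (p - 1) = S powr (p - 1) * W (cmod z) powr (-c)"
        using S Wz by (simp add: V_def powr_mult powr_powr bc[symmetric])
      have "Lp_int haar p (\<lambda>t. T f (circ t * z)) \<le>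
        (\<integral>\<^sup>+t. ennreal (V z powr (p - 1)) * (\<integral>\<^sup>+y. ennreal (cmod (G t z y) powr p * v z y powr (1 - p)) \<partial>E) \<partial>haar)"
        by (intro nn_integral_mono pt z)
      also have "\<dots> = ennreal (V z powr (p - 1)) * (\<integral>\<^sup>+t. (\<integral>\<^sup>+y. ennreal (cmod (G t z y) powr p * v z y powr (1 - p)) \<partial>E) \<partial>haar)"
        by (rule nn_integral_cmult) measurable
      also have "(\<integral>\<^sup>+t. (\<integral>\<^sup>+y. ennreal (cmod (G t z y) powr p * v z y powr (1 - p)) \<partial>E) \<partial>haar) =
          (\<integral>\<^sup>+y. (\<integral>\<^sup>+t. ennreal (cmod (G t z y) powr p * v z y powr (1 - p)) \<partial>haar) \<partial>E)"
        by (rule CE.Fubini'[symmetric]) measurable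
      also have "\<dots> = (\<integral>\<^sup>+y. Lp_int haar p (\<lambda>t. G t z y) * ennreal (v z y powr (1 - p)) \<partial>E)"
        by (simp add: ennreal_mult nn_integral_multc)
      also have "\<dots> \<le> (\<integral>\<^sup>+y. ennreal A * (ennreal (H z y) * (ennreal (W (cmod y) powr c) * I y)) \<partial>E)"
      proof (rule nn_integral_mono_AE, use AE_E_disc in eventually_elim)
        fix y :: complex assume y: "cmod y < 1"
        have Wy: "W (cmod y) > 0" using W_pos y by simp
        have Hz: "H z y > 0" by (rule Hpos[OF z])
        \<comment> \<open>Of the \<open>p\<close> factors \<open>H\<close> from the multiplier bound
          exactly one survives, as the kernel for the integration over \<open>z\<close>.\<close>
        have "H z y powr p * v z y powr (1 - p) = H z y * W (cmod y) powr c"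
        proof -
          have "v z y powr (1 - p) = H z y powr (1 - p) * W (cmod y) powr c"
            using y Hz Wy by (simp add: v_def powr_mult powr_powr bc[symmetric] algebra_simps)
          moreover have "H z y powr p * H z y powr (1 - p) = H z y"
            using Hz by (simp flip: powr_add)
          ultimately show ?thesis by (metis mult.assoc)
        qed
        then have eq: "(A * H z y powr p) * v z y powr (1 - p) = A * (H z y * W (cmod y) powr c)"
          by (simp add: mult.assoc)
        have "Lp_int haar p (\<lambda>t. G t z y) * ennreal (v z y powr (1 - p)) \<le>
            (ennreal (A * H z y powr p) * I y) * ennreal (v z y powr (1 - p))"
          by (intro mult_right_mono GB z y) simp
        also have "\<dots> = ennreal ((A * H z y powr p) * v z y powr (1 - p)) * I y"
          using A by (simp only: ennreal_mult powr_ge_zero mult_nonneg_nonneg less_imp_le mult_ac)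
        also have "\<dots> = ennreal A * (ennreal (H z y) * (ennreal (W (cmod y) powr c) * I y))"
          unfolding eq using A Hz by (simp add: ennreal_mult' mult.assoc)
        finally show "Lp_int haar p (\<lambda>t. G t z y) * ennreal (v z y powr (1 - p)) \<le>
            ennreal A * (ennreal (H z y) * (ennreal (W (cmod y) powr c) * I y))" .
      qed
      also have "\<dots> = ennreal A * (\<integral>\<^sup>+y. ennreal (H z y) * (ennreal (W (cmod y) powr c) * I y) \<partial>E)"
        by (rule nn_integral_cmult) measurable
      finally have "Lp_int haar p (\<lambda>t. T f (circ t * z)) \<le>
          ennreal (V z powr (p - 1)) * (ennreal A * (\<integral>\<^sup>+y. ennreal (H z y) * (ennreal (W (cmod y) powr c) * I y) \<partial>E))"
        by (simp add: mult_left_mono)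
      also have "\<dots> = ennreal (A * S powr (p - 1)) * (ennreal (W (cmod z) powr (-c)) *
          (\<integral>\<^sup>+y. ennreal (H z y) * (ennreal (W (cmod y) powr c) * I y) \<partial>E))"
        unfolding Vp using A by (simp add: ennreal_mult mult_ac)
      also have "ennreal (W (cmod z) powr (-c)) * (\<integral>\<^sup>+y. ennreal (H z y) * (ennreal (W (cmod y) powr c) * I y) \<partial>E) =
          (\<integral>\<^sup>+y. ennreal (W (cmod z) powr (-c)) * (ennreal (H z y) * (ennreal (W (cmod y) powr c) * I y)) \<partial>E)"
        by (rule nn_integral_cmult[symmetric]) measurable
      also have "\<dots> = (\<integral>\<^sup>+y. ennreal (W (cmod z) powr (-c) * H z y) * (ennreal (W (cmod y) powr c) * I y) \<partial>E)"
        using Hpos[OF z] by (simp add: ennreal_mult less_imp_le mult.assoc)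
      finally show ?thesis .
    qed
    have "Lp_int E p (T f) =
        (\<integral>\<^sup>+z. Lp_int haar p (\<lambda>t. T f (circ t * z)) \<partial>E)"
      by (rule nn_integral_E_average[symmetric]) measurable
    also have "\<dots> \<le> (\<integral>\<^sup>+z. ennreal (A * S powr (p - 1)) *
        (\<integral>\<^sup>+y. ennreal (W (cmod z) powr (-c) * H z y) * (ennreal (W (cmod y) powr c) * I y) \<partial>E) \<partial>E)"
      by (rule nn_integral_mono_AE, use AE_E_disc in eventually_elim) (rule J)
    also have "\<dots> = ennreal (A * S powr (p - 1)) *
        (\<integral>\<^sup>+z. (\<integral>\<^sup>+y. ennreal (W (cmod z) powr (-c) * H z y) * (ennreal (W (cmod y) powr c) * I y) \<partial>E) \<partial>E)"
      by (rule nn_integral_cmult) measurable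
    also have "(\<integral>\<^sup>+z. (\<integral>\<^sup>+y. ennreal (W (cmod z) powr (-c) * H z y) * (ennreal (W (cmod y) powr c) * I y) \<partial>E) \<partial>E) =
        (\<integral>\<^sup>+y. (\<integral>\<^sup>+z. ennreal (W (cmod z) powr (-c) * H z y) * (ennreal (W (cmod y) powr c) * I y) \<partial>E) \<partial>E)"
      by (rule EE.Fubini') measurable
    also have "\<dots> = (\<integral>\<^sup>+y. (\<integral>\<^sup>+z. ennreal (W (cmod z) powr (-c) * H z y) \<partial>E) * (ennreal (W (cmod y) powr c) * I y) \<partial>E)"
      by (intro nn_integral_cong nn_integral_multc) measurable
    also have "\<dots> \<le> (\<integral>\<^sup>+y. ennreal S * I y \<partial>E)"
    \<comment> \<open>The second Schur integral, now in \<open>z\<close>, gives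
      \<open>W (cmod y) powr (-c)\<close>, which cancels the weight left by the first.\<close>
    proof (rule nn_integral_mono_AE, use AE_E_disc in eventually_elim)
      fix y :: complex assume y: "cmod y < 1"
      have Wy: "W (cmod y) > 0" using W_pos y by simp
      have "(\<integral>\<^sup>+z. ennreal (W (cmod z) powr (-c) * H z y) \<partial>E) \<le> ennreal (S * W (cmod y) powr (-c))"
        using Schur_bound_E[OF b(3,4) Wy] unfolding Sc H_def by (simp add: max.commute)
      then have "(\<integral>\<^sup>+z. ennreal (W (cmod z) powr (-c) * H z y) \<partial>E) * (ennreal (W (cmod y) powr c) * I y) \<le>
          ennreal (S * W (cmod y) powr (-c)) * (ennreal (W (cmod y) powr c) * I y)"
        by (rule mult_right_mono) simp
      also have "\<dots> = ennreal (S * W (cmod y) powr (-c) * W (cmod y) powr c) * I y"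
        using S by (simp add: ennreal_mult mult.assoc)
      also have "S * W (cmod y) powr (-c) * W (cmod y) powr c = S"
        using Wy by (simp add: powr_minus field_simps)
      finally show "(\<integral>\<^sup>+z. ennreal (W (cmod z) powr (-c) * H z y) \<partial>E) * (ennreal (W (cmod y) powr c) * I y) \<le> ennreal S * I y" .
    qed
    also have "\<dots> = ennreal S * Lp_int E p f"
      by (subst nn_integral_cmult) (auto simp: I_def nn_integral_E_average[of "\<lambda>z. ennreal (cmod (f z) powr p)"])
    finally have "Lp_int E p (T f) \<le>
        ennreal (A * S powr (p - 1)) * (ennreal S * Lp_int E p f)"
      by (simp add: mult_left_mono)
    also have "\<dots> = ennreal (A * S powr p) * Lp_int E p f"
    proof -
      have "A * S powr p = A * S powr (p - 1) * S" using S by (simp add: powr_diff)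
      then show ?thesis using A S by (simp add: ennreal_mult mult.assoc)
    qed
    finally show ?thesis .
  qed
  show ?thesis by (rule that[OF _ main]) (use A in auto)
qed

end

section \<open>Lower bounds for the modulus of the kernel\<close>

lemma nn_integral_haar:
  assumes [measurable]: "h \<in> borel_measurable borel"
  shows "(\<integral>\<^sup>+t. h t \<partial>haar) = (\<integral>\<^sup>+t. indicator {0..1} t * h t \<partial>lborel)"
  unfolding haar_def by (subst nn_integral_density) auto

lemma circ_add: "circ (s + t) = circ s * circ t"
  by (simp add: circ_def cis_mult distrib_left)

lemma circ_1 [simp]: "circ 1 = 1"
  by (simp add: circ_def)

lemma AE_haar: "AE t in haar. t \<in> {0..1}"
  unfolding haar_def by (subst AE_density) (auto simp: indicator_def)

text \<open>A rotation is a translation of the parameter; the piece pushed beyond 1 is brought back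
  by periodicity.\<close>

lemma nn_integral_circle_rotate:
  fixes g :: "complex \<Rightarrow> ennreal"
  assumes [measurable]: "g \<in> borel_measurable borel" and e: "cmod e = 1"
  shows "(\<integral>\<^sup>+t. g (e * circ t) \<partial>haar) = (\<integral>\<^sup>+t. g (circ t) \<partial>haar)"
proof -
  define s where "s = Arg2pi e / (2 * pi)"
  have s: "0 \<le> s" "s < 1" using Arg2pi[of e] by (auto simp: s_def)
  have es: "e = circ s"
    using Arg2pi[of e] e by (simp add: circ_def s_def cis_conv_exp is_Arg_def)
  define h where "h = (\<lambda>t. g (circ t))"
  have [measurable]: "h \<in> borel_measurable borel" unfolding h_def by measurable
  have h1: "h (1 + t) = h t" for t by (simp add: h_def circ_add)
  have "(\<integral>\<^sup>+t. g (e * circ t) \<partial>haar) = (\<integral>\<^sup>+t. indicator {0..1} t * h (s + t) \<partial>lborel)"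
    by (simp add: nn_integral_haar h_def es circ_add)
  also have "\<dots> = (\<integral>\<^sup>+t. indicator {0..1} ((s + t) - s) * h (s + t) \<partial>lborel)" by simp
  also have "\<dots> = (\<integral>\<^sup>+u. indicator {0..1} (u - s) * h u \<partial>lborel)"
    by (rule nn_integral_lborel_shift[of "\<lambda>u. indicator {0..1} (u - s) * h u"]) measurable
  also have "\<dots> = (\<integral>\<^sup>+u. indicator {s..1} u * h u + indicator {1<..1 + s} u * h u \<partial>lborel)"
    using s by (intro nn_integral_cong) (auto split: split_indicator)
  also have "\<dots> = (\<integral>\<^sup>+u. indicator {s..1} u * h u \<partial>lborel) + (\<integral>\<^sup>+u. indicator {1<..1 + s} u * h u \<partial>lborel)"
    by (rule nn_integral_add) measurable
  also have "(\<integral>\<^sup>+u. indicator {1<..1 + s} u * h u \<partial>lborel) = (\<integral>\<^sup>+u. indicator {1<..1 + s} (1 + u) * h (1 + u) \<partial>lborel)"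
    by (rule nn_integral_lborel_shift[symmetric]) measurable
  also have "\<dots> = (\<integral>\<^sup>+u. indicator {0<..s} u * h u \<partial>lborel)"
    by (intro nn_integral_cong) (auto simp: h1 split: split_indicator)
  also have "(\<integral>\<^sup>+u. indicator {s..1} u * h u \<partial>lborel) + (\<integral>\<^sup>+u. indicator {0<..s} u * h u \<partial>lborel) =
      (\<integral>\<^sup>+u. indicator {s..1} u * h u + indicator {0<..s} u * h u \<partial>lborel)"
    by (rule nn_integral_add[symmetric]) measurable
  also have "\<dots> = (\<integral>\<^sup>+u. indicator {0..1} u * h u \<partial>lborel)"
  \<comment> \<open>The two pieces reproduce the unit interval except possibly at the points 0 and
    \<open>s\<close>.\<close>
  proof (rule nn_integral_cong_AE)
    have "AE u in lborel. u \<noteq> 0" "AE u in lborel. u \<noteq> s" by (rule AE_lborel_singleton)+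
    then show "AE u in lborel. indicator {s..1} u * h u + indicator {0<..s} u * h u = indicator {0..1} u * h u"
      by eventually_elim (use s in \<open>auto split: split_indicator\<close>)
  qed
  also have "\<dots> = (\<integral>\<^sup>+t. g (circ t) \<partial>haar)"
    by (simp add: nn_integral_haar h_def)
  finally show ?thesis .
qed

lemma circ_power: "circ t ^ n = exp (2 * of_real pi * \<i> * of_nat n * of_real t)"
  by (simp add: circ_def cis_conv_exp exp_of_nat_mult[symmetric] mult_ac)

text \<open>The Fourier coefficients of the sawtooth, from the antiderivative \<open>F\<close> found
  by integration by parts; periodicity of the exponential leaves only the jump of the
  sawtooth.\<close>

lemma integral_circ_power_sawtooth:
  assumes n: "n > 0"
  shows "(LINT t|haar. circ t ^ n * of_real (1/2 - t)) = - 1 / (2 * of_real pi * \<i> * of_nat n)"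
proof -
  define a where "a = 2 * of_real pi * \<i> * complex_of_nat n"
  have a: "a \<noteq> 0" using n by (simp add: a_def)
  have ct: "circ t ^ n = exp (a * of_real t)" for t by (simp add: circ_power a_def)
  have ea: "exp a = 1" using ct[of 1] by simp
  define F where "F = (\<lambda>z. exp (a * z) * ((1/2 - z) / a + 1 / a\<^sup>2))"
  have "((\<lambda>t. circ t ^ n * of_real (1/2 - t)) has_integral (F (of_real 1) - F (of_real 0))) {0..1}"
  proof (rule fundamental_theorem_of_calculus)
    fix t :: real assume "t \<in> {0..1}"
    have "(F has_field_derivative exp (a * z) * (1/2 - z)) (at z)" for z
      unfolding F_def using a
      by (auto intro!: derivative_eq_intros simp: field_simps power2_eq_square)
    then have "((\<lambda>t. F (of_real t)) has_vector_derivative exp (a * of_real t) * (1/2 - of_real t)) (at t within {0..1})"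
      by (intro has_vector_derivative_real_field)
    then show "((\<lambda>t. F (of_real t)) has_vector_derivative circ t ^ n * of_real (1/2 - t)) (at t within {0..1})"
      by (simp add: ct)
  qed simp
  moreover have "F (of_real 1) - F (of_real 0) = - 1 / a"
    using a by (simp add: F_def ea field_simps power2_eq_square)
  ultimately have "integral {0..1} (\<lambda>t. circ t ^ n * of_real (1/2 - t)) = - 1 / a"
    by (simp add: integral_unique)
  moreover have "(LINT t|haar. circ t ^ n * of_real (1/2 - t)) = integral {0..1} (\<lambda>t. circ t ^ n * of_real (1/2 - t))"
    by (rule integral_circle_eq) (intro continuous_intros)
  ultimately show ?thesis by (simp add: a_def)
qed

text \<open>
  Hardy's inequality, by duality with the bounded function \<open>e\<^sup>i\<^sup>\<theta> (\<pi> - \<theta>)\<close>,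
  whose Fourier coefficients are \<open>i / (j + 1)\<close>.
\<close>
lemma Hardy_mean_lower:
  assumes c: "\<And>n. 0 \<le> c n" and b: "cmod b < 1" and s: "summable (\<lambda>n. c n * cmod b ^ n)"
  shows "summable (\<lambda>j. c j * cmod b ^ j / (real j + 1))"
    and "ennreal ((\<Sum>j. c j * cmod b ^ j / (real j + 1)) / pi) \<le> (\<integral>\<^sup>+t. ennreal (cmod (pker c (b * circ t))) \<partial>haar)"
proof -
  define r where "r = cmod b"
  have r: "0 \<le> r" "r < 1" using b by (auto simp: r_def)
  note s = s[folded r_def]
  have sj: "summable (\<lambda>j. c j * r ^ j / (real j + 1))"
  proof (rule summable_comparison_test'[OF s])
    show "norm (c j * r ^ j / (real j + 1)) \<le> c j * r ^ j" for j
    proof -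
      have "c j * r ^ j / (real j + 1) \<le> c j * r ^ j / 1"
        using c[of j] r by (intro divide_left_mono) auto
      then show ?thesis using c[of j] r by simp
    qed
  qed
  then show "summable (\<lambda>j. c j * cmod b ^ j / (real j + 1))" by (simp add: r_def)
  define S where "S = (\<Sum>j. c j * r ^ j / (real j + 1))"
  \<comment> \<open>The sawtooth is cut off because the measure lives on the whole line and a bound
    at every real \<open>t\<close> is wanted.\<close>
  define \<psi> where "\<psi> = (\<lambda>t::real. if t \<in> {0..1} then 1/2 - t else 0)"
  have [measurable]: "\<psi> \<in> borel_measurable borel" unfolding \<psi>_def by measurable
  have \<psi>: "\<bar>\<psi> t\<bar> \<le> 1/2" for t
  proof -
    have "- (1/2) \<le> \<psi> t \<and> \<psi> t \<le> 1/2" by (simp add: \<psi>_def)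
    then show ?thesis by linarith
  qed
  \<comment> \<open>The index is raised by one because the sawtooth has mean zero and would lose the
    term \<open>j = 0\<close>. The coefficient modulus \<open>1 / (2 * pi * (j + 1))\<close> and the
    bound 1/2 for the sawtooth combine to the final factor \<open>1 / pi\<close>.\<close>
  define f where "f = (\<lambda>j t. of_real (c j * r ^ j) * (circ t ^ Suc j * complex_of_real (\<psi> t)))"
  have fb: "norm (f j t) \<le> c j * r ^ j" for j t
  proof -
    have "norm (f j t) = c j * r ^ j * \<bar>\<psi> t\<bar>"
      using c[of j] r by (simp add: f_def norm_mult norm_power abs_mult)
    also have "\<dots> \<le> c j * r ^ j * 1"
      using c[of j] r \<psi>[of t] by (intro mult_left_mono) auto
    finally show ?thesis by simp
  qed
  have fi: "integrable haar (f j)" for j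
    by (rule integrable_circle_bounded[OF _ fb]) (simp add: f_def)
  have sk: "(\<lambda>n. complex_of_real (c n) * (of_real r * circ t) ^ n) sums pker c (of_real r * circ t)" for t
    unfolding pker_def
    by (rule summable_sums, rule summable_comparison_test'[OF s]) (use c r in \<open>auto simp: norm_mult norm_power\<close>)
  have "(\<lambda>j. LINT t|haar. f j t) sums (LINT t|haar. (\<Sum>j. f j t))"
  proof (rule sums_integral[OF fi])
    show "AE t in haar. summable (\<lambda>j. norm (f j t))"
      by (intro AE_I2 summable_comparison_test'[OF s]) (use fb in auto)
    show "summable (\<lambda>j. LINT t|haar. norm (f j t))"
    proof (rule summable_comparison_test'[OF s])
      show "norm (LINT t|haar. norm (f j t)) \<le> c j * r ^ j" for j
      proof -
        have "(LINT t|haar. norm (f j t)) \<le> (LINT t|haar. c j * r ^ j)"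
          using fi fb by (intro integral_mono) (auto intro: circle.integrable_const)
        then show ?thesis by simp
      qed
    qed
  qed
  moreover have "(\<Sum>j. f j t) = pker c (of_real r * circ t) * (circ t * of_real (\<psi> t))" for t
  proof -
    have "(\<lambda>j. complex_of_real (c j) * (of_real r * circ t) ^ j * (circ t * of_real (\<psi> t))) sums
        (pker c (of_real r * circ t) * (circ t * of_real (\<psi> t)))"
      by (rule sums_mult2[OF sk])
    then have "(\<lambda>j. f j t) sums (pker c (of_real r * circ t) * (circ t * of_real (\<psi> t)))"
      by (simp add: f_def power_mult_distrib mult_ac)
    then show ?thesis by (simp add: sums_iff)
  qed
  moreover have "(LINT t|haar. f j t) = - 1 / (2 * of_real pi * \<i>) * of_real (c j * r ^ j / (real j + 1))" for j
  proof -
    have "(LINT t|haar. circ t ^ Suc j * complex_of_real (\<psi> t)) = (LINT t|haar. circ t ^ Suc j * of_real (1/2 - t))"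
    proof (rule integral_cong_AE)
      show "(\<lambda>t. circ t ^ Suc j * complex_of_real (\<psi> t)) \<in> borel_measurable haar"
        "(\<lambda>t. circ t ^ Suc j * complex_of_real (1/2 - t)) \<in> borel_measurable haar"
        by measurable
      show "AE t in haar. circ t ^ Suc j * complex_of_real (\<psi> t) = circ t ^ Suc j * complex_of_real (1/2 - t)"
        using AE_haar by eventually_elim (simp add: \<psi>_def)
    qed
    also have "\<dots> = - 1 / (2 * of_real pi * \<i> * of_nat (Suc j))"
      by (rule integral_circ_power_sawtooth) simp
    finally have "(LINT t|haar. f j t) = of_real (c j * r ^ j) * (- 1 / (2 * of_real pi * \<i> * of_nat (Suc j)))"
      unfolding f_def by (simp only: integral_mult_right_zero)
    then show ?thesis by (simp add: add.commute)
  qed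
  ultimately have "(\<lambda>j. - 1 / (2 * of_real pi * \<i>) * complex_of_real (c j * r ^ j / (real j + 1))) sums
      (LINT t|haar. pker c (of_real r * circ t) * (circ t * of_real (\<psi> t)))"
    by simp
  moreover have "(\<lambda>j. - 1 / (2 * of_real pi * \<i>) * complex_of_real (c j * r ^ j / (real j + 1))) sums
      (- 1 / (2 * of_real pi * \<i>) * of_real S)"
    unfolding S_def using sj by (intro sums_mult sums_of_real summable_sums)
  ultimately have X: "(LINT t|haar. pker c (of_real r * circ t) * (circ t * of_real (\<psi> t))) =
      - 1 / (2 * of_real pi * \<i>) * of_real S"
    by (rule sums_unique2)
  have S0: "S \<ge> 0" unfolding S_def using sj c r by (intro suminf_nonneg) auto
  have "ennreal (S / (2 * pi)) = ennreal (norm (LINT t|haar. pker c (of_real r * circ t) * (circ t * of_real (\<psi> t))))"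
    unfolding X using S0 by (simp add: norm_mult norm_divide)
  also have "\<dots> \<le> (\<integral>\<^sup>+t. ennreal (norm (pker c (of_real r * circ t) * (circ t * of_real (\<psi> t)))) \<partial>haar)"
    by (rule norm_integral_le_nn_integral)
  also have "\<dots> \<le> (\<integral>\<^sup>+t. ennreal (1/2) * ennreal (cmod (pker c (of_real r * circ t))) \<partial>haar)"
  proof (rule nn_integral_mono)
    fix t
    have "norm (pker c (of_real r * circ t) * (circ t * of_real (\<psi> t))) \<le> cmod (pker c (of_real r * circ t)) * (1/2)"
      using \<psi>[of t] by (simp only: norm_mult cmod_circ norm_of_real mult_1) (rule mult_left_mono, auto)
    then show "ennreal (norm (pker c (of_real r * circ t) * (circ t * of_real (\<psi> t)))) \<le> ennreal (1/2) * ennreal (cmod (pker c (of_real r * circ t)))"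
      by (subst ennreal_mult'[symmetric]) (auto intro!: ennreal_leI simp: mult.commute)
  qed
  also have "\<dots> = ennreal (1/2) * (\<integral>\<^sup>+t. ennreal (cmod (pker c (of_real r * circ t))) \<partial>haar)"
    by (rule nn_integral_cmult) measurable
  finally have "ennreal 2 * ennreal (S / (2 * pi)) \<le> ennreal 2 * (ennreal (1/2) * (\<integral>\<^sup>+t. ennreal (cmod (pker c (of_real r * circ t))) \<partial>haar))"
    by (rule mult_left_mono) simp
  also have "\<dots> = (ennreal 2 * ennreal (1/2)) * (\<integral>\<^sup>+t. ennreal (cmod (pker c (of_real r * circ t))) \<partial>haar)"
    by (simp only: mult.assoc)
  also have "ennreal 2 * ennreal (1/2) = 1" by (subst ennreal_mult'[symmetric]) auto
  also have "ennreal 2 * ennreal (S / (2 * pi)) = ennreal (S / pi)" by (subst ennreal_mult'[symmetric]) auto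
  finally have "ennreal (S / pi) \<le> (\<integral>\<^sup>+t. ennreal (cmod (pker c (of_real r * circ t))) \<partial>haar)"
    by simp
  also have "\<dots> = (\<integral>\<^sup>+t. ennreal (cmod (pker c (b * circ t))) \<partial>haar)"
  \<comment> \<open>Rotation by \<open>b / cmod b\<close> passes from the positive radius to general
    \<open>b\<close>.\<close>
  proof (cases "b = 0")
    case False
    have "cmod (b / of_real r) = 1" using False by (simp add: norm_divide r_def)
    then have "(\<integral>\<^sup>+t. ennreal (cmod (pker c (of_real r * (b / of_real r * circ t)))) \<partial>haar) =
        (\<integral>\<^sup>+t. ennreal (cmod (pker c (of_real r * circ t))) \<partial>haar)"
      by (intro nn_integral_circle_rotate[of "\<lambda>w. ennreal (cmod (pker c (of_real r * w)))"]) measurable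
    then show ?thesis using False by (simp add: r_def)
  qed (simp add: r_def)
  finally show "ennreal ((\<Sum>j. c j * cmod b ^ j / (real j + 1)) / pi) \<le> (\<integral>\<^sup>+t. ennreal (cmod (pker c (b * circ t))) \<partial>haar)"
    by (simp add: S_def r_def)
qed

text \<open>Each dyadic block from \<open>n * 2 ^ m\<close> to \<open>n * 2 ^ Suc m\<close> has
  \<open>n * 2 ^ m\<close> terms, none below \<open>1 / (n * 2 ^ Suc m)\<close>, and so contributes
  at least 1/2.\<close>

lemma sum_inverse_dyadic_ge:
  assumes n: "n > 0"
  shows "real m / 2 \<le> (\<Sum>j\<in>{n..<n * 2 ^ m}. 1 / (real j + 1))"
proof (induction m)
  case (Suc m)
  have sub: "n * 2 ^ m \<le> n * 2 ^ Suc m" "n \<le> n * 2 ^ m" by auto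
  have "1 / 2 = (\<Sum>j\<in>{n * 2 ^ m..<n * 2 ^ Suc m}. 1 / (real n * 2 ^ Suc m))"
    using n by simp
  also have "\<dots> \<le> (\<Sum>j\<in>{n * 2 ^ m..<n * 2 ^ Suc m}. 1 / (real j + 1))"
  proof (rule sum_mono)
    fix j assume "j \<in> {n * 2 ^ m..<n * 2 ^ Suc m}"
    then have "real (j + 1) \<le> real (n * 2 ^ Suc m)" by (intro of_nat_mono) auto
    then show "1 / (real n * 2 ^ Suc m) \<le> 1 / (real j + 1)" by (intro divide_left_mono) auto
  qed
  finally have "real (Suc m) / 2 \<le> (\<Sum>j\<in>{n..<n * 2 ^ m}. 1 / (real j + 1)) + (\<Sum>j\<in>{n * 2 ^ m..<n * 2 ^ Suc m}. 1 / (real j + 1))"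
    using Suc by simp
  also have "\<dots> = (\<Sum>j\<in>{n..<n * 2 ^ Suc m}. 1 / (real j + 1))"
    by (rule sum.atLeastLessThan_concat) (use sub in auto)
  finally show ?case .
qed simp

lemma cmod_pker_cnj:
  assumes "summable (\<lambda>n. of_real (c n) * x ^ n)"
  shows "cmod (pker c (cnj x)) = cmod (pker c x)"
proof -
  have "(\<lambda>n. cnj (of_real (c n) * x ^ n)) sums cnj (pker c x)"
    unfolding pker_def by (subst sums_cnj) (rule summable_sums[OF assms])
  then have "pker c (cnj x) = cnj (pker c x)"
    by (simp add: pker_def sums_iff)
  then show ?thesis by simp
qed

section \<open>Growth of the maximal projection of an annulus\<close>

context doubling_weight
begin

lemma kernel_cnj:
  assumes "cmod x < 1"
  shows "cmod (pker coef (cnj x)) = cmod (pker coef x)"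
proof (rule cmod_pker_cnj)
  show "summable (\<lambda>n. complex_of_real (coef n) * x ^ n)"
    by (rule summable_comparison_test'[OF coef_summable[of "cmod x"]])
      (use assms coef_pos in \<open>auto simp: norm_mult norm_power less_imp_le\<close>)
qed

text \<open>Polar coordinates carry the factor \<open>2 * s\<close>, which is at least 1 from radius
  1/2 on.\<close>

lemma emeasure_E_annulus:
  assumes "1/2 \<le> r"
  shows "ennreal (W r) \<le> (\<integral>\<^sup>+z. indicator {z. r \<le> cmod z} z \<partial>E)"
proof -
  have "ennreal (W r) = (\<integral>\<^sup>+s. ennreal (w s) * indicator {r..} s \<partial>lborel)" by (rule nn_integral_W[symmetric])
  also have "\<dots> \<le> (\<integral>\<^sup>+s. ennreal (2 * s) * ennreal (w s) * indicator {r..} s \<partial>lborel)"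
  proof (rule nn_integral_mono)
    show "ennreal (w s) * indicator {r..} s \<le> ennreal (2 * s) * ennreal (w s) * indicator {r..} s" for s
    proof (cases "r \<le> s")
      case True
      then have "ennreal (1 * w s) \<le> ennreal ((2 * s) * w s)"
        using assms w_nonneg[of s] by (intro ennreal_leI mult_right_mono) auto
      then show ?thesis using True assms by (simp add: ennreal_mult')
    qed simp
  qed
  also have "\<dots> = (\<integral>\<^sup>+z. indicator {r..} (cmod z) \<partial>E)"
    by (rule nn_integral_E_radial[symmetric]) measurable
  also have "\<dots> = (\<integral>\<^sup>+z. indicator {z. r \<le> cmod z} z \<partial>E)"
    by (intro nn_integral_cong) (simp add: indicator_def)
  finally show ?thesis .
qed

text \<open>For \<open>z\<close> and \<open>y\<close> in the annulus Hardy's inequality bounds the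
  mean of the kernel modulus over the circle of \<open>y\<close> below by
  \<open>d * m / W t\<close>. The annulus has mass at least \<open>W t\<close>, so
  \<open>W t\<close> cancels. The radius \<open>t\<close> depends on \<open>m\<close>, the constant
  \<open>d\<close> does not.\<close>

lemma max_kernel_lower:
  assumes not_check: "\<And>K c. 1 < K \<Longrightarrow> 1 < c \<Longrightarrow> \<exists>r\<in>{0..<1}. W r < c * W (1 - (1 - r) / K)"
  obtains d where "d > 0"
    "\<And>m::nat. \<exists>t. 1/2 \<le> t \<and> t < 1 \<and> (\<forall>z. t \<le> cmod z \<longrightarrow> cmod z < 1 \<longrightarrow>
      ennreal (d * real m) \<le> (\<integral>\<^sup>+y. indicator {y. t \<le> cmod y} y * ennreal (cmod (pker coef (z * cnj y))) \<partial>E))"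
proof -
  obtain K where K: "K > 0" "\<And>j r. 0 \<le> r \<Longrightarrow> r < 1 \<Longrightarrow> 1 \<le> (2 * real j + 1) * (1 - r) \<Longrightarrow> mom j \<le> K * W r"
    using mom_upper by metis
  \<comment> \<open>Collected from the damping \<open>exp (- 4)\<close>, the coefficient bound
    \<open>1 / (4 * K * W t)\<close>, the harmonic sum \<open>m / 2\<close> and Hardy's
    \<open>1 / pi\<close>.\<close>
  define d where "d = exp (- 4) / (8 * pi * K)"
  have d: "d > 0" using K by (simp add: d_def)
  have "\<exists>t. 1/2 \<le> t \<and> t < 1 \<and> (\<forall>z. t \<le> cmod z \<longrightarrow> cmod z < 1 \<longrightarrow>
      ennreal (d * real m) \<le> (\<integral>\<^sup>+y. indicator {y. t \<le> cmod y} y * ennreal (cmod (pker coef (z * cnj y))) \<partial>E))" for m :: nat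
  proof -
    \<comment> \<open>One halving more than the \<open>m\<close> dyadic blocks need: it yields
      \<open>t >= 1/2\<close> and later \<open>real j * x <= 1\<close>.\<close>
    obtain r where r: "0 \<le> r" "r < 1" and Wr: "W r < 2 * W (1 - (1 - r) / 2 ^ Suc m)"
      using not_check[of "2 ^ Suc m" 2] by (auto simp: one_less_power simp del: power_Suc)
    define x where "x = (1 - r) / 2 ^ Suc m"
    define t where "t = 1 - x"
    have "(1::real) \<le> 2 ^ m" by simp
    then have "1 - r \<le> 2 ^ m" using r by linarith
    then have "x \<le> 2 ^ m / 2 ^ Suc m" unfolding x_def by (intro divide_right_mono) auto
    then have x: "0 < x" "x \<le> 1/2" using r by (simp_all add: x_def)
    have t: "1/2 \<le> t" "t < 1" "0 < t" using x by (auto simp: t_def)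
    have Wt: "W t > 0" "W r < 2 * W t" using W_pos t Wr by (auto simp: t_def x_def)
    \<comment> \<open>From index \<open>n\<close> on the moments are controlled by
      \<open>W r\<close>; up to \<open>n * 2 ^ m\<close> the powers of \<open>t * t\<close> have not
      yet decayed. Rounding up keeps \<open>n * (1 - r)\<close> between 1 and 2.\<close>
    define n where "n = nat \<lceil>1 / (1 - r)\<rceil>"
    have ge1: "1 \<le> 1 / (1 - r)" using r by simp
    then have "0 \<le> \<lceil>1 / (1 - r)\<rceil>" by linarith
    then have "real n = of_int \<lceil>1 / (1 - r)\<rceil>" by (simp add: n_def)
    then have n: "1 / (1 - r) \<le> real n" "real n \<le> 1 / (1 - r) + 1"
      using ceiling_correct[of "1 / (1 - r)"] by linarith+
    have "real n \<ge> 1" using n(1) ge1 by linarith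
    then have "n > 0" by simp
    note n = n this
    have n1: "1 \<le> real n * (1 - r)" using n(1) r by (simp add: field_simps)
    have "real n \<le> 2 * (1 / (1 - r))" using n(2) \<open>1 \<le> 1 / (1 - r)\<close> by linarith
    then have n2: "real n * (1 - r) \<le> 2" using r by (simp add: field_simps)
    have summand: "exp (- 4) / (4 * K * W t) * (1 / (real j + 1)) \<le> coef j * (t * t) ^ j / (real j + 1)"
      if j: "j \<in> {n..<n * 2 ^ m}" for j
    proof -
      have "real n \<le> 2 * real j + 1" using j by simp
      then have "real n * (1 - r) \<le> (2 * real j + 1) * (1 - r)" using r by (intro mult_right_mono) auto
      then have "mom j \<le> K * W r" using K(2)[OF r] n1 by simp
      also have "\<dots> \<le> K * (2 * W t)" using Wt K by (intro mult_left_mono) auto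
      finally have cj: "1 / (4 * K * W t) \<le> coef j"
        using mom_pos[of j] K Wt unfolding coef_def by (intro divide_left_mono) auto
      have "real j \<le> real (n * 2 ^ m)" using j by (intro of_nat_mono) auto
      then have "real j * x \<le> real n * 2 ^ m * x" using x by (intro mult_right_mono) auto
      also have "\<dots> = real n * (1 - r) / 2" by (simp add: x_def)
      also have "\<dots> \<le> 1" using n2 by simp
      finally have jx: "real j * x \<le> 1" .
      \<comment> \<open>The quadratic lower bound for \<open>ln (1 - x)\<close> becomes linear
        because \<open>x <= 1/2\<close>; with \<open>real j * x <= 1\<close> it gives the factor
        \<open>exp (- 4)\<close> for the power of \<open>t * t\<close>.\<close>
      have "- 2 * x \<le> ln t"
      proof -
        have "x\<^sup>2 \<le> x * (1/2)" unfolding power2_eq_square using x by (intro mult_left_mono) auto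
        then show ?thesis using ln_one_minus_pos_lower_bound[of x] x by (simp add: t_def)
      qed
      then have "exp (- 2 * x) \<le> t" using t by (simp add: ln_ge_iff)
      then have "exp (- 2 * x) * exp (- 2 * x) \<le> t * t" using t by (intro mult_mono) auto
      then have "(exp (- 2 * x) * exp (- 2 * x)) ^ j \<le> (t * t) ^ j" by (intro power_mono) auto
      moreover have "(exp (- 2 * x) * exp (- 2 * x)) ^ j = exp (- 4 * (real j * x))"
        by (simp add: exp_of_nat_mult[symmetric] exp_add[symmetric] mult_ac)
      moreover have "exp (- 4) \<le> exp (- 4 * (real j * x))" using jx by simp
      ultimately have "exp (- 4) \<le> (t * t) ^ j" by linarith
      then have "1 / (4 * K * W t) * exp (- 4) \<le> coef j * (t * t) ^ j"
        using cj coef_pos[of j] by (intro mult_mono) (auto simp: less_imp_le)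
      then have "1 / (4 * K * W t) * exp (- 4) / (real j + 1) \<le> coef j * (t * t) ^ j / (real j + 1)"
        by (intro divide_right_mono) auto
      then show ?thesis by (simp add: field_simps)
    qed
    have lower: "d * real m / W t \<le> (\<Sum>j. coef j * a ^ j / (real j + 1)) / pi"
      if a: "t * t \<le> a" "a < 1" and sm: "summable (\<lambda>j. coef j * a ^ j / (real j + 1))" for a
    proof -
      have a0: "0 \<le> a" using a t by (meson mult_nonneg_nonneg less_imp_le order_trans)
      have "exp (- 4) / (4 * K * W t) * (real m / 2) \<le> exp (- 4) / (4 * K * W t) * (\<Sum>j\<in>{n..<n * 2 ^ m}. 1 / (real j + 1))"
        using K Wt by (intro mult_left_mono sum_inverse_dyadic_ge n) auto
      also have "\<dots> = (\<Sum>j\<in>{n..<n * 2 ^ m}. exp (- 4) / (4 * K * W t) * (1 / (real j + 1)))"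
        by (rule sum_distrib_left)
      also have "\<dots> \<le> (\<Sum>j\<in>{n..<n * 2 ^ m}. coef j * (t * t) ^ j / (real j + 1))"
        by (intro sum_mono summand)
      also have "\<dots> \<le> (\<Sum>j\<in>{n..<n * 2 ^ m}. coef j * a ^ j / (real j + 1))"
        using a t coef_pos by (intro sum_mono divide_right_mono mult_left_mono power_mono) (auto simp: less_imp_le)
      also have "\<dots> \<le> (\<Sum>j. coef j * a ^ j / (real j + 1))"
        by (rule sum_le_suminf[OF sm]) (use coef_pos a0 in \<open>auto simp: less_imp_le\<close>)
      finally have "exp (- 4) / (4 * K * W t) * (real m / 2) / pi \<le> (\<Sum>j. coef j * a ^ j / (real j + 1)) / pi"
        by (intro divide_right_mono) auto
      then show ?thesis by (simp add: d_def field_simps)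
    qed
    have "ennreal (d * real m) \<le> (\<integral>\<^sup>+y. indicator {y. t \<le> cmod y} y * ennreal (cmod (pker coef (z * cnj y))) \<partial>E)"
      if z: "t \<le> cmod z" "cmod z < 1" for z
    proof -
      define F where "F = (\<lambda>y. indicator {y. t \<le> cmod y} y * ennreal (cmod (pker coef (z * cnj y))))"
      have [measurable]: "F \<in> borel_measurable borel" unfolding F_def by measurable
      have inner: "ennreal (d * real m / W t) * indicator {y. t \<le> cmod y} y \<le> (\<integral>\<^sup>+s. F (circ s * y) \<partial>haar)"
        if y: "cmod y < 1" for y
      proof (cases "t \<le> cmod y")
        case True
        define b where "b = cnj z * y"
        have cb: "cmod b = cmod z * cmod y" by (simp add: b_def norm_mult)
        have b: "t * t \<le> cmod b" "cmod b < 1"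
        proof -
          show "t * t \<le> cmod b" unfolding cb using z True t by (intro mult_mono) auto
          have "cmod z * cmod y \<le> cmod z * 1" using y by (intro mult_left_mono) auto
          then show "cmod b < 1" unfolding cb using z by simp
        qed
        have kb: "cmod (pker coef (z * cnj (circ s * y))) = cmod (pker coef (b * circ s))" for s
        proof -
          have "z * cnj (circ s * y) = cnj (b * circ s)" by (simp add: b_def mult_ac)
          moreover have "cmod (b * circ s) < 1" using b by (simp add: norm_mult)
          ultimately show ?thesis by (simp only: kernel_cnj)
        qed
        note Hardy = Hardy_mean_lower[of coef b, OF less_imp_le[OF coef_pos] b(2) coef_summable[OF norm_ge_zero b(2)]]
        have "ennreal (d * real m / W t) \<le> ennreal ((\<Sum>j. coef j * cmod b ^ j / (real j + 1)) / pi)"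
          by (intro ennreal_leI lower b Hardy(1))
        also have "\<dots> \<le> (\<integral>\<^sup>+s. ennreal (cmod (pker coef (b * circ s))) \<partial>haar)" by (rule Hardy(2))
        also have "\<dots> = (\<integral>\<^sup>+s. F (circ s * y) \<partial>haar)"
          unfolding F_def kb using True by (simp add: norm_mult)
        finally show ?thesis using True by simp
      qed simp
      have "ennreal (d * real m) = ennreal (d * real m / W t) * ennreal (W t)"
        using Wt d by (subst ennreal_mult[symmetric]) auto
      also have "\<dots> \<le> ennreal (d * real m / W t) * (\<integral>\<^sup>+y. indicator {y. t \<le> cmod y} y \<partial>E)"
        by (intro mult_left_mono emeasure_E_annulus t) simp
      also have "\<dots> = (\<integral>\<^sup>+y. ennreal (d * real m / W t) * indicator {y. t \<le> cmod y} y \<partial>E)"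
        by (rule nn_integral_cmult[symmetric]) measurable
      also have "\<dots> \<le> (\<integral>\<^sup>+y. (\<integral>\<^sup>+s. F (circ s * y) \<partial>haar) \<partial>E)"
        by (rule nn_integral_mono_AE, use AE_E_disc in eventually_elim) (rule inner)
      also have "\<dots> = (\<integral>\<^sup>+y. F y \<partial>E)" by (rule nn_integral_E_average) measurable
      finally show ?thesis by (simp add: F_def)
    qed
    then show ?thesis using t by blast
  qed
  then show ?thesis using that d by blast
qed

end

section \<open>Lebesgue measurable weights and functions\<close>

lemma disc_area_measurable_iff:
  fixes h :: "complex \<Rightarrow> 'b::euclidean_space"
  shows "h \<in> borel_measurable disc_area \<longleftrightarrow> (\<lambda>z. indicator (ball 0 1) z *\<^sub>R h z) \<in> borel_measurable lebesgue"
proof -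
  have "h \<in> borel_measurable disc_area \<longleftrightarrow> h \<in> borel_measurable (lebesgue_on (ball 0 1))"
    unfolding disc_area_def by simp
  also have "\<dots> \<longleftrightarrow> (\<lambda>z. indicator (ball 0 1) z *\<^sub>R h z) \<in> borel_measurable lebesgue"
    by (rule borel_measurable_restrict_space_iff) simp
  finally show ?thesis .
qed

text \<open>The link between the definitions, which use the completed measure, and the estimates,
  which use Borel functions so that Fubini applies.\<close>

lemma integral_lebesgue_version:
  fixes h g :: "'a::euclidean_space \<Rightarrow> 'b::euclidean_space"
  assumes g: "g \<in> borel_measurable borel" and ae: "AE x in lborel. g x = h x"
  shows "h \<in> borel_measurable lebesgue"
    and "(LINT x|lebesgue. h x) = (LINT x|lborel. g x)"
    and "integrable lebesgue h \<longleftrightarrow> integrable lborel g"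
proof -
  have gb: "g \<in> borel_measurable lborel" using g by simp
  note gl = measurable_completion[OF gb]
  note ae' = AE_completion[OF ae]
  show hl: "h \<in> borel_measurable lebesgue" by (rule borel_measurable_AE[OF gl ae'])
  show "(LINT x|lebesgue. h x) = (LINT x|lborel. g x)"
    using integral_cong_AE[OF gl hl ae'] integral_completion[OF gb] by simp
  show "integrable lebesgue h \<longleftrightarrow> integrable lborel g"
    using integrable_cong_AE[OF gl hl ae'] integrable_completion[OF gb] by simp
qed

lemma disc_area_transfer:
  fixes h g :: "complex \<Rightarrow> 'b::euclidean_space"
  assumes [measurable]: "g \<in> borel_measurable borel"
    and ae: "AE z in lborel. cmod z < 1 \<longrightarrow> h z = g z"
  shows "h \<in> borel_measurable disc_area"
    and "(LINT z|disc_area. h z) = (LINT z|lborel. (indicator (ball 0 1) z / pi) *\<^sub>R g z)"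
    and "integrable disc_area h \<longleftrightarrow> integrable lborel (\<lambda>z. (indicator (ball 0 1) z / pi) *\<^sub>R g z)"
proof -
  define Bi where "Bi = (indicator (ball 0 1) :: complex \<Rightarrow> real)"
  have [measurable]: "Bi \<in> borel_measurable borel"
    unfolding Bi_def by (rule borel_measurable_indicator) simp
  have bm: "(\<lambda>z. Bi z *\<^sub>R g z) \<in> borel_measurable borel" "(\<lambda>z. (Bi z / pi) *\<^sub>R g z) \<in> borel_measurable borel"
    by measurable
  have ae1: "AE z in lborel. Bi z *\<^sub>R g z = Bi z *\<^sub>R h z"
    using ae by eventually_elim (auto simp: Bi_def indicator_def)
  have ae2: "AE z in lborel. (Bi z / pi) *\<^sub>R g z = (Bi z / pi) *\<^sub>R h z"
    using ae by eventually_elim (auto simp: Bi_def indicator_def)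
  note hm = integral_lebesgue_version(1)[OF bm(1) ae1]
  note version = integral_lebesgue_version(2,3)[OF bm(2) ae2]
  show hd: "h \<in> borel_measurable disc_area"
    using hm unfolding disc_area_measurable_iff Bi_def .
  then have hl: "h \<in> borel_measurable (lebesgue_on (ball 0 1))"
    unfolding disc_area_def by simp
  have sc: "Bi z *\<^sub>R (1 / pi) *\<^sub>R h z = (Bi z / pi) *\<^sub>R h z" for z by simp
  have "(LINT z|disc_area. h z) = (LINT z|lebesgue_on (ball 0 1). (1 / pi) *\<^sub>R h z)"
    unfolding disc_area_def by (rule integral_density) (use hl in auto)
  also have "\<dots> = (LINT z|lebesgue. (Bi z / pi) *\<^sub>R h z)"
    unfolding sc[symmetric] unfolding Bi_def by (rule integral_restrict_space) simp
  also have "\<dots> = (LINT z|lborel. (Bi z / pi) *\<^sub>R g z)" by (rule version(1))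
  finally show "(LINT z|disc_area. h z) = (LINT z|lborel. (indicator (ball 0 1) z / pi) *\<^sub>R g z)"
    unfolding Bi_def .
  have "integrable disc_area h \<longleftrightarrow> integrable (lebesgue_on (ball 0 1)) (\<lambda>z. (1 / pi) *\<^sub>R h z)"
    unfolding disc_area_def by (rule integrable_density) (use hl in auto)
  also have "\<dots> \<longleftrightarrow> integrable lebesgue (\<lambda>z. (Bi z / pi) *\<^sub>R h z)"
    unfolding sc[symmetric] unfolding Bi_def by (rule integrable_restrict_space) simp
  also have "\<dots> \<longleftrightarrow> integrable lborel (\<lambda>z. (Bi z / pi) *\<^sub>R g z)" by (rule version(2))
  finally show "integrable disc_area h \<longleftrightarrow> integrable lborel (\<lambda>z. (indicator (ball 0 1) z / pi) *\<^sub>R g z)"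
    unfolding Bi_def .
qed

lemma disc_area_Borel_version:
  fixes f :: "complex \<Rightarrow> complex"
  assumes "f \<in> borel_measurable disc_area"
  obtains g where "g \<in> borel_measurable borel" "AE z in lborel. cmod z < 1 \<longrightarrow> f z = g z"
proof -
  define F where "F = (\<lambda>z. indicator (ball 0 1) z *\<^sub>R f z)"
  have F: "F \<in> borel_measurable lebesgue"
    using assms unfolding disc_area_measurable_iff F_def .
  have "(\<lambda>z. Re (F z)) \<in> borel_measurable lebesgue" "(\<lambda>z. Im (F z)) \<in> borel_measurable lebesgue"
    using F by measurable
  from this[THEN completion_ex_borel_measurable_real]
  obtain r i where ri: "r \<in> borel_measurable lborel" "AE z in lborel. Re (F z) = r z"
    "i \<in> borel_measurable lborel" "AE z in lborel. Im (F z) = i z" by blast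
  have [measurable]: "r \<in> borel_measurable borel" "i \<in> borel_measurable borel" using ri by simp_all
  show ?thesis
  proof (rule that)
    show "(\<lambda>z. of_real (r z) + \<i> * of_real (i z)) \<in> borel_measurable borel" by measurable
    show "AE z in lborel. cmod z < 1 \<longrightarrow> f z = of_real (r z) + \<i> * of_real (i z)"
      using ri(2,4) by eventually_elim (auto simp: F_def complex_eq_iff)
  qed
qed

text \<open>By polar coordinates a null set of radii sweeps out a null set in the plane; hence
  profiles that agree almost everywhere define almost everywhere equal weights on the disc.\<close>

lemma AE_cmod:
  assumes "AE s in lborel. P s"
  shows "AE z::complex in lborel. P (cmod z)"
proof -
  from assms obtain N where N: "{s. \<not> P s} \<subseteq> N" "N \<in> sets lborel" "emeasure lborel N = 0"
    by (auto elim!: AE_E)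
  have [measurable]: "N \<in> sets borel" using N by simp
  have "(\<integral>\<^sup>+z. indicator N (cmod (z::complex)) \<partial>lborel) = (\<integral>\<^sup>+s. ennreal (2 * pi * s) * indicator {0..} s * indicator N s \<partial>lborel)"
    by (rule nn_integral_radial) measurable
  also have "\<dots> = 0"
  proof (subst nn_integral_0_iff_AE)
    have "AE s in lborel. s \<notin> N" using N by (intro AE_not_in) auto
    then show "AE s in lborel. ennreal (2 * pi * s) * indicator {0..} s * indicator N s = 0"
      by eventually_elim simp
  qed measurable
  finally have "AE z in lborel. indicator N (cmod (z::complex)) = (0::ennreal)"
    by (subst (asm) nn_integral_0_iff_AE) auto
  then show ?thesis using N(1) by (auto elim!: eventually_mono simp: indicator_def split: if_splits)
qed

section \<open>Transfer from the Borel version to the original weight and operators\<close>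

locale weight_version = doubling_weight w C for w C +
  fixes \<omega> :: "real \<Rightarrow> real"
  assumes version: "AE s in lborel. s \<in> {0..<1} \<longrightarrow> \<omega> s = w s"
    and \<omega>_nonneg: "s \<in> {0..<1} \<Longrightarrow> 0 \<le> \<omega> s"
begin

lemma version_cmod: "AE z::complex in lborel. cmod z < 1 \<longrightarrow> \<omega> (cmod z) = w (cmod z)"
  using AE_cmod[OF version] by eventually_elim simp

lemma \<omega>_transfer:
  fixes h :: "real \<Rightarrow> real"
  assumes [measurable]: "A \<in> sets borel" "h \<in> borel_measurable borel" and A: "A \<subseteq> {0..<1}"
  shows "(LINT s:A|lebesgue. h s * \<omega> s) = (LINT s:A|lborel. h s * w s)"
proof -
  have ae: "AE s in lborel. indicator A s *\<^sub>R (h s * w s) = indicator A s *\<^sub>R (h s * \<omega> s)"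
    using version by eventually_elim (use A in \<open>auto simp: indicator_def\<close>)
  show ?thesis
    unfolding set_lebesgue_integral_def by (rule integral_lebesgue_version(2)[OF _ ae]) measurable
qed

lemma weight_hat_eq:
  assumes "0 \<le> r"
  shows "weight_hat \<omega> r = W r"
proof -
  have "weight_hat \<omega> r = (LINT s:{r..<1}|lborel. w s)"
    using \<omega>_transfer[of "{r..<1}" "\<lambda>_. 1"] assms by (simp add: weight_hat_def)
  also have "\<dots> = W r"
    unfolding W_def set_lebesgue_integral_def
    by (intro Bochner_Integration.integral_cong) (auto simp: w_outside split: split_indicator)
  finally show ?thesis .
qed

lemma weight_moment_eq: "weight_moment \<omega> (2 * real n + 1) = mom n"
proof -
  \<comment> \<open>At \<open>s = 0\<close> both sides vanish, the natural exponent being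
    positive.\<close>
  have pw: "s powr (2 * real n + 1) = s ^ (2 * n + 1)" if "0 \<le> s" for s
    using that powr_realpow[of s "2 * n + 1"] by (cases "s = 0") (auto simp: add.commute)
  have "weight_moment \<omega> (2 * real n + 1) = (LINT s:{0..<1}|lborel. s powr (2 * real n + 1) * w s)"
    unfolding weight_moment_def by (rule \<omega>_transfer) auto
  also have "\<dots> = mom n"
    unfolding mom_def set_lebesgue_integral_def
    by (intro Bochner_Integration.integral_cong) (auto simp: w_outside pw split: split_indicator)
  finally show ?thesis .
qed

lemma bergman_kernel_eq: "bergman_kernel \<omega> z y = pker coef (cnj z * y)"
  unfolding bergman_kernel_def pker_def coef_def
  using weight_moment_eq by (simp add: algebra_simps)

lemma disc_area_E:
  fixes h g :: "complex \<Rightarrow> 'b::euclidean_space"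
  assumes [measurable]: "g \<in> borel_measurable borel"
    and ae: "AE z in lborel. cmod z < 1 \<longrightarrow> h z = w (cmod z) *\<^sub>R g z"
  shows "h \<in> borel_measurable disc_area"
    and "(LINT z|disc_area. h z) = (LINT z|E. g z)"
    and "integrable disc_area h \<longleftrightarrow> integrable E g"
proof -
  have m: "(\<lambda>z. w (cmod z) *\<^sub>R g z) \<in> borel_measurable borel" by measurable
  note tr = disc_area_transfer[OF m ae]
  show "h \<in> borel_measurable disc_area" by (rule tr(1))
  have eq: "(indicator (ball 0 1) z / pi) *\<^sub>R w (cmod z) *\<^sub>R g z = (w (cmod z) / pi) *\<^sub>R g z" for z
    by (cases "cmod z < 1") (auto simp: w_outside)
  show "(LINT z|disc_area. h z) = (LINT z|E. g z)"
    unfolding tr(2) eq E_def by (rule integral_density[symmetric]) (use w_nonneg in auto)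
  show "integrable disc_area h \<longleftrightarrow> integrable E g"
    unfolding tr(3) eq E_def by (rule integrable_density[symmetric]) (use w_nonneg in auto)
qed

lemma weighted_Lp_transfer:
  assumes [measurable]: "g \<in> borel_measurable borel"
    and ae: "AE z in lborel. cmod z < 1 \<longrightarrow> f z = g z"
  shows "f \<in> weighted_Lp p \<omega> \<longleftrightarrow> integrable E (\<lambda>z. cmod (g z) powr p)"
    and "weighted_Lp_norm p \<omega> f = (LINT z|E. cmod (g z) powr p) powr (1 / p)"
proof -
  have ae': "AE z in lborel. cmod z < 1 \<longrightarrow> cmod (f z) powr p * \<omega> (cmod z) = w (cmod z) *\<^sub>R (cmod (g z) powr p)"
    using ae version_cmod by eventually_elim simp
  have m: "(\<lambda>z. cmod (g z) powr p) \<in> borel_measurable borel" by measurable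
  note tr = disc_area_E[OF m ae']
  show "f \<in> weighted_Lp p \<omega> \<longleftrightarrow> integrable E (\<lambda>z. cmod (g z) powr p)"
    using disc_area_transfer(1)[OF _ ae] tr(3) by (simp add: weighted_Lp_def)
  show "weighted_Lp_norm p \<omega> f = (LINT z|E. cmod (g z) powr p) powr (1 / p)"
    by (simp add: weighted_Lp_norm_def tr(2))
qed

text \<open>The equality holds at every point of the disc although \<open>f\<close> and
  \<open>g\<close> agree only almost everywhere, so \<open>T g\<close> is a Borel version of the
  projection of \<open>f\<close>.\<close>

lemma bergman_proj_eq:
  assumes [measurable]: "g \<in> borel_measurable borel"
    and ae: "AE z in lborel. cmod z < 1 \<longrightarrow> f z = g z" and z: "cmod z < 1"
  shows "bergman_proj \<omega> f z = T g z"
proof -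
  have k: "cnj (pker coef (cnj z * y)) = pker coef (z * cnj y)" if "cmod y < 1" for y
  proof -
    have "cmod (cnj z * y) < 1" using z that mult_strict_mono'[of "cmod z" 1 "cmod y" 1] by (simp add: norm_mult)
    then have "summable (\<lambda>n. complex_of_real (coef n) * (cnj z * y) ^ n)"
      by (intro summable_comparison_test'[OF coef_summable[of "cmod (cnj z * y)"]])
        (use coef_pos in \<open>auto simp: norm_mult norm_power less_imp_le\<close>)
    then have "(\<lambda>n. cnj (of_real (coef n) * (cnj z * y) ^ n)) sums cnj (pker coef (cnj z * y))"
      unfolding pker_def by (subst sums_cnj) (rule summable_sums)
    then show ?thesis by (simp add: pker_def sums_iff)
  qed
  have ae': "AE y in lborel. cmod y < 1 \<longrightarrow> f y * cnj (bergman_kernel \<omega> z y) * of_real (\<omega> (cmod y)) =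
      w (cmod y) *\<^sub>R (g y * pker coef (z * cnj y))"
    using ae version_cmod
  proof eventually_elim
    case (elim y)
    show ?case
    proof
      assume "cmod y < 1"
      with elim k[of y] show "f y * cnj (bergman_kernel \<omega> z y) * of_real (\<omega> (cmod y)) =
          w (cmod y) *\<^sub>R (g y * pker coef (z * cnj y))"
        unfolding bergman_kernel_eq scaleR_conv_of_real by (simp only: mult.commute simp_thms)
    qed
  qed
  have m: "(\<lambda>y. g y * pker coef (z * cnj y)) \<in> borel_measurable borel" by measurable
  show ?thesis
    unfolding bergman_proj_def T_def by (rule disc_area_E(2)[OF m ae'])
qed

lemma bounded_bergman_proj:
  assumes p: "1 < p"
  shows "bounded_on_weighted_Lp p \<omega> (bergman_proj \<omega>)"
proof -
  obtain K where K: "0 \<le> K" and bound: "\<And>f. f \<in> borel_measurable borel \<Longrightarrow> Lp_int E p f < \<infinity> \<Longrightarrow>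
      Lp_int E p (T f) \<le> ennreal K * Lp_int E p f"
    using T_bounded[OF p] by blast
  have "bergman_proj \<omega> f \<in> weighted_Lp p \<omega> \<and>
      weighted_Lp_norm p \<omega> (bergman_proj \<omega> f) \<le> K powr (1 / p) * weighted_Lp_norm p \<omega> f"
    if f: "f \<in> weighted_Lp p \<omega>" for f
  proof -
    have "f \<in> borel_measurable disc_area" using f by (simp add: weighted_Lp_def)
    then obtain g where g[measurable]: "g \<in> borel_measurable borel" and ae: "AE z in lborel. cmod z < 1 \<longrightarrow> f z = g z"
      by (rule disc_area_Borel_version)
    have gi: "integrable E (\<lambda>z. cmod (g z) powr p)" using f weighted_Lp_transfer(1)[OF g ae] by simp
    have geq: "Lp_int E p g = ennreal (LINT z|E. cmod (g z) powr p)"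
      using gi by (simp add: nn_integral_eq_integral)
    have Tb: "Lp_int E p (T g) \<le> ennreal (K * (LINT z|E. cmod (g z) powr p))"
      using bound[OF g] K by (simp add: geq ennreal_mult')
    have Tm: "T g \<in> borel_measurable borel" by measurable
    have Ti: "integrable E (\<lambda>z. cmod (T g z) powr p)"
      by (rule integrableI_bounded) (use le_less_trans[OF Tb] in auto)
    have "ennreal (LINT z|E. cmod (T g z) powr p) \<le> ennreal (K * (LINT z|E. cmod (g z) powr p))"
      using Tb Ti by (simp add: nn_integral_eq_integral)
    then have le: "(LINT z|E. cmod (T g z) powr p) \<le> K * (LINT z|E. cmod (g z) powr p)"
      using K by (subst (asm) ennreal_le_iff) auto
    have ae': "AE z in lborel. cmod z < 1 \<longrightarrow> bergman_proj \<omega> f z = T g z"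
      using bergman_proj_eq[OF g ae] by simp
    have "(LINT z|E. cmod (T g z) powr p) powr (1 / p) \<le> (K * (LINT z|E. cmod (g z) powr p)) powr (1 / p)"
      using le p by (intro powr_mono2) auto
    also have "\<dots> = K powr (1 / p) * (LINT z|E. cmod (g z) powr p) powr (1 / p)" by (rule powr_mult)
    finally show ?thesis
      using Ti weighted_Lp_transfer[OF Tm ae'] weighted_Lp_transfer(2)[OF g ae] by simp
  qed
  then show ?thesis unfolding bounded_on_weighted_Lp_def by blast
qed

text \<open>Testing on the indicators of the annuli above, the norm of the annulus cancels and any
  bound \<open>B\<close> would dominate \<open>d * m\<close> for every \<open>m\<close>.\<close>

lemma unbounded_max_bergman_proj:
  assumes p: "1 < p"
    and not_check: "\<And>K c. 1 < K \<Longrightarrow> 1 < c \<Longrightarrow> \<exists>r\<in>{0..<1}. W r < c * W (1 - (1 - r) / K)"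
  shows "\<not> bounded_on_weighted_Lp p \<omega> (max_bergman_proj \<omega>)"
proof
  assume "bounded_on_weighted_Lp p \<omega> (max_bergman_proj \<omega>)"
  then obtain B where B: "\<And>f. f \<in> weighted_Lp p \<omega> \<Longrightarrow> max_bergman_proj \<omega> f \<in> weighted_Lp p \<omega> \<and>
      weighted_Lp_norm p \<omega> (max_bergman_proj \<omega> f) \<le> B * weighted_Lp_norm p \<omega> f"
    unfolding bounded_on_weighted_Lp_def by blast
  obtain d where d: "d > 0" and lower:
    "\<And>m::nat. \<exists>t. 1/2 \<le> t \<and> t < 1 \<and> (\<forall>z. t \<le> cmod z \<longrightarrow> cmod z < 1 \<longrightarrow>
      ennreal (d * real m) \<le> (\<integral>\<^sup>+y. indicator {y. t \<le> cmod y} y * ennreal (cmod (pker coef (z * cnj y))) \<partial>E))"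
    using max_kernel_lower[OF not_check] by blast
  have le: "d * real m \<le> B" for m :: nat
  proof -
    obtain t where t: "1/2 \<le> t" "t < 1" and low: "\<And>z. t \<le> cmod z \<Longrightarrow> cmod z < 1 \<Longrightarrow>
      ennreal (d * real m) \<le> (\<integral>\<^sup>+y. indicator {y. t \<le> cmod y} y * ennreal (cmod (pker coef (z * cnj y))) \<partial>E)"
      using lower[of m] by blast
    define A where "A = {y::complex. t \<le> cmod y}"
    have [measurable]: "A \<in> sets borel" unfolding A_def by measurable
    define f where "f = (indicator A :: complex \<Rightarrow> complex)"
    have f[measurable]: "f \<in> borel_measurable borel" unfolding f_def by measurable
    have fp: "cmod (f z) powr p = indicator A z" for z using p by (simp add: f_def indicator_def)
    define N where "N = measure E A"
    have N: "(LINT z|E. cmod (f z) powr p) = N" by (simp add: fp N_def)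
    have "ennreal (W t) \<le> ennreal N"
      using emeasure_E_annulus[OF t(1)] by (simp add: A_def[symmetric] N_def E.emeasure_eq_measure)
    then have Npos: "N > 0" using W_pos[OF t(2)] by (simp add: N_def)
    have aef: "AE z in lborel. cmod z < 1 \<longrightarrow> f z = f z" by simp
    have fi: "integrable E (\<lambda>z. cmod (f z) powr p)" by (simp add: fp E.emeasure_eq_measure)
    have "f = (\<lambda>z. complex_of_real (indicator A z))" by (auto simp: f_def indicator_def)
    then have fint: "integrable E f" by (simp add: E.emeasure_eq_measure)
    have fLp: "f \<in> weighted_Lp p \<omega>" "weighted_Lp_norm p \<omega> f = N powr (1 / p)"
      using weighted_Lp_transfer[OF f aef] fi N by simp_all
    have P: "d * real m \<le> cmod (max_bergman_proj \<omega> f z)" if z: "z \<in> A" "cmod z < 1" for z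
    proof -
      define k where "k = (\<lambda>y. indicator A y * cmod (pker coef (z * cnj y)))"
      have km: "k \<in> borel_measurable borel" unfolding k_def by measurable
      have kk: "cmod (pker coef (cnj z * y)) = cmod (pker coef (z * cnj y))" if "cmod y < 1" for y
      proof -
        have "cmod (z * cnj y) < 1" using z(2) that mult_strict_mono'[of "cmod z" 1 "cmod y" 1] by (simp add: norm_mult)
        then show ?thesis using kernel_cnj[of "z * cnj y"] by simp
      qed
      have "norm (f y * pker coef (z * cnj y)) = k y" for y
        by (simp add: f_def k_def norm_mult indicator_def)
      then have ki: "integrable E k" using integrable_norm[OF integrable_T[OF fint z(2)]] by simp
      have ae': "AE y in lborel. cmod y < 1 \<longrightarrow> f y * of_real (cmod (bergman_kernel \<omega> z y)) * of_real (\<omega> (cmod y)) =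
          w (cmod y) *\<^sub>R complex_of_real (k y)"
        using version_cmod
        by eventually_elim (auto simp: bergman_kernel_eq kk f_def k_def scaleR_conv_of_real indicator_def)
      have km': "(\<lambda>y. complex_of_real (k y)) \<in> borel_measurable borel" using km by measurable
      have "max_bergman_proj \<omega> f z = (LINT y|E. complex_of_real (k y))"
        unfolding max_bergman_proj_def by (rule disc_area_E(2)[OF km' ae'])
      also have "\<dots> = of_real (LINT y|E. k y)" by simp
      finally have eq: "max_bergman_proj \<omega> f z = of_real (LINT y|E. k y)" .
      have k0: "0 \<le> k y" for y by (simp add: k_def)
      have "ennreal (d * real m) \<le> (\<integral>\<^sup>+y. ennreal (k y) \<partial>E)"
        using low[of z] z by (simp add: A_def[symmetric] k_def ennreal_mult' ennreal_indicator) (simp add: A_def)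
      also have "\<dots> = ennreal (LINT y|E. k y)" using ki k0 by (simp add: nn_integral_eq_integral)
      finally have "d * real m \<le> (LINT y|E. k y)"
        using k0 by (subst (asm) ennreal_le_iff) (auto intro: integral_nonneg_AE)
      then show ?thesis unfolding eq by simp
    qed
    \<comment> \<open>No Borel version of \<open>g\<close> is formed: the assumed boundedness
      supplies its integrability, and the comparison is made directly on the disc. Hence
      nonnegativity of the original weight is used pointwise.\<close>
    define g where "g = max_bergman_proj \<omega> f"
    have gLp: "integrable disc_area (\<lambda>z. cmod (g z) powr p * \<omega> (cmod z))"
      and gle: "weighted_Lp_norm p \<omega> g \<le> B * N powr (1 / p)"
      using B[OF fLp(1)] fLp(2) by (auto simp: weighted_Lp_def g_def)
    have ae1: "AE z in lborel. cmod z < 1 \<longrightarrow> (d * real m) powr p * indicator A z * \<omega> (cmod z) =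
        w (cmod z) *\<^sub>R ((d * real m) powr p * indicator A z)"
      using version_cmod by eventually_elim simp
    have m1: "(\<lambda>z. (d * real m) powr p * indicator A z) \<in> borel_measurable borel" by measurable
    note tr = disc_area_E[OF m1 ae1]
    have "(d * real m) powr p * N = (LINT z|disc_area. (d * real m) powr p * indicator A z * \<omega> (cmod z))"
      unfolding tr(2) by (simp add: N_def)
    also have "\<dots> \<le> (LINT z|disc_area. cmod (g z) powr p * \<omega> (cmod z))"
    proof (rule integral_mono[OF _ gLp])
      show "integrable disc_area (\<lambda>z. (d * real m) powr p * indicator A z * \<omega> (cmod z))"
        unfolding tr(3) by (simp add: E.emeasure_eq_measure)
      fix z assume "z \<in> space disc_area"
      then have z: "cmod z < 1" by (simp add: disc_area_def)
      then have "0 \<le> \<omega> (cmod z)" by (intro \<omega>_nonneg) simp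
      moreover have "(d * real m) powr p * indicator A z \<le> cmod (g z) powr p"
        using P[OF _ z] p d by (cases "z \<in> A") (auto simp: g_def intro!: powr_mono2)
      ultimately show "(d * real m) powr p * indicator A z * \<omega> (cmod z) \<le> cmod (g z) powr p * \<omega> (cmod z)"
        by (intro mult_right_mono)
    qed
    finally have "((d * real m) powr p * N) powr (1 / p) \<le> weighted_Lp_norm p \<omega> g"
      unfolding weighted_Lp_norm_def using p Npos by (intro powr_mono2) auto
    moreover have "((d * real m) powr p * N) powr (1 / p) = d * real m * N powr (1 / p)"
      using p d by (simp add: powr_mult powr_powr)
    ultimately have "d * real m * N powr (1 / p) \<le> B * N powr (1 / p)" using gle by linarith
    then show ?thesis using Npos by simp
  qed
  obtain m :: nat where "B / d < real m" using reals_Archimedean2 by blast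
  then show False using le[of m] d by (simp add: field_simps)
qed

end

lemma weight_version_exists:
  assumes \<omega>: "\<omega> \<in> D_hat"
  obtains w C where "weight_version w C \<omega>"
proof -
  have rw: "radial_weight \<omega>" using \<omega> by (simp add: D_hat_def)
  then have nn: "\<And>s. s \<in> {0..<1} \<Longrightarrow> 0 \<le> \<omega> s" and int: "set_integrable lebesgue {0..<1} \<omega>"
    and pos: "\<And>r. r \<in> {0..<1} \<Longrightarrow> 0 < weight_hat \<omega> r" by (auto simp: radial_weight_def)
  obtain C where C: "C \<ge> 1" "\<And>r. r \<in> {0..<1} \<Longrightarrow> weight_hat \<omega> r \<le> C * weight_hat \<omega> ((1 + r) / 2)"
    using \<omega> by (auto simp: D_hat_def)
  define F where "F = (\<lambda>s. indicator {0..<1} s *\<^sub>R \<omega> s)"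
  have Fi: "integrable lebesgue F" using int by (simp add: F_def set_integrable_def)
  obtain g where gm: "g \<in> borel_measurable lborel" and g: "AE s in lborel. F s = g s"
    using completion_ex_borel_measurable_real[OF borel_measurable_integrable[OF Fi]] by blast
  have [measurable]: "g \<in> borel_measurable borel" using gm by simp
  \<comment> \<open>Truncation gives nonnegativity and vanishing outside at every point; it alters
    the version of \<open>F\<close> only on a null set, as \<open>F\<close> has both
    properties.\<close>
  define w where "w = (\<lambda>s. if s \<in> {0..<1} then max 0 (g s) else 0)"
  have wm: "w \<in> borel_measurable borel" unfolding w_def by measurable
  have Fw: "AE s in lborel. F s = w s"
    using g
  proof eventually_elim
    case (elim s)
    then show ?case using nn[of s] by (auto simp: F_def w_def)
  qed
  have "AE s in lborel. w s = F s" using Fw by eventually_elim simp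
  then have wi: "integrable lborel w" using integral_lebesgue_version(3)[OF wm] Fi by blast
  interpret borel_weight w
    by standard (use wm wi in \<open>auto simp: w_def\<close>)
  have version: "AE s in lborel. s \<in> {0..<1} \<longrightarrow> \<omega> s = w s"
    using Fw by eventually_elim (auto simp: F_def)
  have hat: "weight_hat \<omega> r = W r" if "0 \<le> r" for r
  proof -
    have ae: "AE s in lborel. indicator {r..} s *\<^sub>R w s = indicator {r..<1} s *\<^sub>R \<omega> s"
      using version by eventually_elim (use that in \<open>auto simp: w_outside split: split_indicator\<close>)
    show ?thesis
      unfolding weight_hat_def W_def set_lebesgue_integral_def
      by (rule integral_lebesgue_version(2)[OF _ ae]) measurable
  qed
  have "weight_version w C \<omega>"
  proof
    show "0 < W r" if "r < 1" for r
      using pos[of "max r 0"] hat[of "max r 0"] that W_neg[of r] by (cases "0 \<le> r") (auto simp: max_def)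
    show "W r \<le> C * W ((1 + r) / 2)" if "0 \<le> r" "r < 1" for r
      using C(2)[of r] that by (simp add: hat)
  qed (use C version nn in auto)
  then show ?thesis by (rule that)
qed

theorem corollary10:
  fixes p :: real and \<omega> :: "real \<Rightarrow> real"
  assumes "1 < p" and "\<omega> \<in> D_hat - D_check"
  shows "bounded_on_weighted_Lp p \<omega> (bergman_proj \<omega>) \<and>
         \<not> bounded_on_weighted_Lp p \<omega> (max_bergman_proj \<omega>)"
proof -
  have hat: "\<omega> \<in> D_hat" and check: "\<omega> \<notin> D_check" using assms by auto
  obtain w C where "weight_version w C \<omega>" using weight_version_exists[OF hat] .
  then interpret weight_version w C \<omega> .
  have rw: "radial_weight \<omega>" using hat by (simp add: D_hat_def)
  have "\<exists>r\<in>{0..<1}. W r < c * W (1 - (1 - r) / K)" if K: "1 < K" "1 < c" for K c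
  proof -
    have "\<exists>r\<in>{0..<1}. \<not> weight_hat \<omega> r \<ge> c * weight_hat \<omega> (1 - (1 - r) / K)"
      using check rw K unfolding D_check_def by blast
    then obtain r where r: "r \<in> {0..<1}" "weight_hat \<omega> r < c * weight_hat \<omega> (1 - (1 - r) / K)"
      by (auto simp: not_le)
    \<comment> \<open>The second argument is then nonnegative, the range in which
      \<open>weight_hat\<close> and \<open>W\<close> coincide.\<close>
    have "(1 - r) / K \<le> 1" using r K by (simp add: field_simps)
    then show ?thesis using r by (auto simp: weight_hat_eq)
  qed
  then show ?thesis
    using bounded_bergman_proj[OF assms(1)] unbounded_max_bergman_proj[OF assms(1)] by blast
qed

end
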